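(* Let $y$ be the solution of $\dot y(t)=f(y(t),y(\lfloor t\rfloor))$, $t\in[0,b]$, $y(0)=y_0\in\mathbb{R}^m$, with $f:\mathbb{R}^m\times\mathbb{R}^m\to\mathbb{R}^m$ of class $C^\infty$. Let $h=1/\nu$ with $\nu$ a positive integer, $t_n=nh$ for $n=0,\dots,N$, $N=K\nu$, $b=Nh=K$, with $K$ a fixed positive integer. Let $s\ge1$ be an integer and let $u$ be the piecewise polynomial approximation of degree at most $s$ on each $[t_{n-1},t_n]$ defined by $u(0)=y_0$ and, with $u_n(ch):=u(t_{n-1}+ch)$, by $$\dot u_n(ch)=\sum_{j=0}^{s-1}P_j(c)\,\overline\gamma_j^{\,n},\quad c\in[0,1],\qquad u_n(0)=u(t_{n-1}),$$ $$\overline\gamma_j^{\,n}=\sum_{i=1}^k b_iP_j(c_i)\,f\bigl(u_n(c_ih),u(\lfloor (n-1)/\nu\rfloor)\bigr),\qquad n=1,\dots,N .$$ Assume that the quadrature formula with abscissae $c_i$ and weights $b_i$ ($i=1,\dots,k$) has order $q\ge 2s$. Then, for $n=1,\dots,N$, $$y(t_n)-u(t_n)=y(t_{n-1})-u(t_{n-1})+O(h^{2s+1}),$$ $$y(t_{n-1}+ch)-u(t_{n-1}+ch)=O(h^{s+1}),\qquad c\in(0,1).$$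
   Context: $\lfloor\cdot\rfloor$ is the floor function. A solution $y$ is continuous on $[0,b]$ and satisfies the equation on each $[n,n+1)\subseteq[0,b]$ with integer $n$ (one-sided derivatives at integers). $\{P_j\}_{j\ge0}$ are the shifted and scaled Legendre polynomials on $[0,1]$: $P_j$ has degree $j$ and $\int_0^1P_i(x)P_j(x)\,dx=\delta_{ij}$. The dot is the derivative with respect to time, so that $u_n(ch)=u_n(0)+h\sum_{j=0}^{s-1}\int_0^cP_j(x)\,dx\,\overline\gamma_j^{\,n}$. On $[t_{n-1},t_n)$ one has $\lfloor t\rfloor=\lfloor (n-1)/\nu\rfloor$, so $u(\lfloor (n-1)/\nu\rfloor)$ is the (already computed, constant) memory term. A quadrature formula $\int_0^1 g(x)\,dx\approx\sum_{i=1}^kb_ig(c_i)$ with $c_i\in[0,1]$ has order $q$ if it is exact for all polynomials of degree up to $q-1$. The solution $y$ is assumed to exist on $[0,b]$ and $u$ is assumed to be uniquely defined for all sufficiently small $h$. The $O$ symbols refer to $h=1/\nu\to0$ with constants independent of $n$. *)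

theory Defs
  imports "HOL-Analysis.Analysis" "HOL-Computational_Algebra.Polynomial"
begin

text \<open>
  Between finite-dimensional spaces, continuity of all directional derivatives
  \<open>x \<mapsto> Df(x) v\<close> is the same as continuity of the Frechet derivative \<open>x \<mapsto> Df(x)\<close>,
  so \<open>C_diff k\<close> is the usual class of \<open>k\<close> times continuously differentiable maps.
\<close>

primrec C_diff :: "nat \<Rightarrow> ('a::euclidean_space \<Rightarrow> 'b::euclidean_space) \<Rightarrow> bool" where
  "C_diff 0 f \<longleftrightarrow> continuous_on UNIV f"
| "C_diff (Suc k) f \<longleftrightarrow>
     (\<forall>x. f differentiable (at x)) \<and> (\<forall>v. C_diff k (\<lambda>x. frechet_derivative f (at x) v))"

definition C_infinity :: "('a::euclidean_space \<Rightarrow> 'b::euclidean_space) \<Rightarrow> bool" where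
  "C_infinity f \<longleftrightarrow> (\<forall>k. C_diff k f)"

text \<open>
  Orthonormality and the degree condition determine each polynomial up to its sign. The
  sign is left open: every \<open>P j\<close> enters the method below through the product
  \<open>P j (\<tau>) * P j (c i)\<close> only.
\<close>

definition orthonormal_legendre :: "(nat \<Rightarrow> real poly) \<Rightarrow> bool" where
  "orthonormal_legendre P \<longleftrightarrow>
     (\<forall>j. degree (P j) = j) \<and>
     (\<forall>i j. integral {0..1} (\<lambda>x. poly (P i) x * poly (P j) x) = (if i = j then 1 else 0))"

definition quadrature_order :: "nat \<Rightarrow> (nat \<Rightarrow> real) \<Rightarrow> (nat \<Rightarrow> real) \<Rightarrow> nat \<Rightarrow> bool" where
  "quadrature_order k b c q \<longleftrightarrow>
     (\<forall>p :: real poly. degree p < q \<longrightarrow>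
        (\<Sum>i=1..k. b i * poly p (c i)) = integral {0..1} (poly p))"

text \<open>
  The derivative relative to \<open>{n..<n+1}\<close> is the right derivative at the integer \<open>n\<close> and
  the ordinary derivative elsewhere.
\<close>

definition pca_solution ::
  "((real^'m) \<times> (real^'m) \<Rightarrow> real^'m) \<Rightarrow> real^'m \<Rightarrow> real \<Rightarrow> (real \<Rightarrow> real^'m) \<Rightarrow> bool" where
  "pca_solution f y0 T y \<longleftrightarrow>
     continuous_on {0..T} y \<and> y 0 = y0 \<and>
     (\<forall>n::int. {real_of_int n..<real_of_int n + 1} \<subseteq> {0..T} \<longrightarrow>
        (\<forall>t\<in>{real_of_int n..<real_of_int n + 1}.
           (y has_vector_derivative f (y t, y (real_of_int \<lfloor>t\<rfloor>)))
             (at t within {real_of_int n..<real_of_int n + 1})))"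

definition grid :: "nat \<Rightarrow> nat \<Rightarrow> real" where
  "grid \<nu> n = real n * (1 / real \<nu>)"

text \<open>The step number \<open>n\<close> is positive wherever the following two definitions are used.\<close>

definition gamma_bar ::
  "((real^'m) \<times> (real^'m) \<Rightarrow> real^'m) \<Rightarrow> (nat \<Rightarrow> real poly) \<Rightarrow> nat \<Rightarrow> (nat \<Rightarrow> real) \<Rightarrow>
   (nat \<Rightarrow> real) \<Rightarrow> nat \<Rightarrow> (real \<Rightarrow> real^'m) \<Rightarrow> nat \<Rightarrow> nat \<Rightarrow> real^'m" where
  "gamma_bar f P k b c \<nu> u n j =
     (\<Sum>i=1..k. (b i * poly (P j) (c i)) *\<^sub>R
        f (u (grid \<nu> (n - 1) + c i * (1 / real \<nu>)),
           u (real_of_int \<lfloor>real (n - 1) / real \<nu>\<rfloor>)))"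

text \<open>
  Time derivatives are taken relative to the closed step interval, hence are one-sided
  at its endpoints. The starting value of step \<open>n\<close> is the value of \<open>u\<close> at the left
  endpoint because all steps share the same function \<open>u\<close>.
\<close>

definition hbvm_approx ::
  "((real^'m) \<times> (real^'m) \<Rightarrow> real^'m) \<Rightarrow> real^'m \<Rightarrow> nat \<Rightarrow> (nat \<Rightarrow> real poly) \<Rightarrow> nat \<Rightarrow> nat \<Rightarrow>
   (nat \<Rightarrow> real) \<Rightarrow> (nat \<Rightarrow> real) \<Rightarrow> nat \<Rightarrow> (real \<Rightarrow> real^'m) \<Rightarrow> bool" where
  "hbvm_approx f y0 K P s k b c \<nu> u \<longleftrightarrow>
     u 0 = y0 \<and>
     (\<forall>n\<in>{1..K * \<nu>}.
        (\<exists>a :: nat \<Rightarrow> real^'m. \<forall>\<tau>\<in>{0..1}.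
           u (grid \<nu> (n - 1) + \<tau> * (1 / real \<nu>)) = (\<Sum>i\<le>s. \<tau> ^ i *\<^sub>R a i)) \<and>
        (\<forall>\<tau>\<in>{0..1}.
           (u has_vector_derivative
              (\<Sum>j<s. poly (P j) \<tau> *\<^sub>R gamma_bar f P k b c \<nu> u n j))
             (at (grid \<nu> (n - 1) + \<tau> * (1 / real \<nu>)) within {grid \<nu> (n - 1)..grid \<nu> n})))"

text \<open>Uniqueness concerns the values on \<open>[0, K]\<close> only, where the approximation lives.\<close>

definition unique_hbvm_approx ::
  "((real^'m) \<times> (real^'m) \<Rightarrow> real^'m) \<Rightarrow> real^'m \<Rightarrow> nat \<Rightarrow> (nat \<Rightarrow> real poly) \<Rightarrow> nat \<Rightarrow> nat \<Rightarrow>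
   (nat \<Rightarrow> real) \<Rightarrow> (nat \<Rightarrow> real) \<Rightarrow> nat \<Rightarrow> (real \<Rightarrow> real^'m) \<Rightarrow> bool" where
  "unique_hbvm_approx f y0 K P s k b c \<nu> u \<longleftrightarrow>
     hbvm_approx f y0 K P s k b c \<nu> u \<and>
     (\<forall>w. hbvm_approx f y0 K P s k b c \<nu> w \<longrightarrow> (\<forall>t\<in>{0..real K}. w t = u t))"

end

theory Submission imports Defs begin

text \<open>
  Let \<open>Q g\<close> be the discrete projection of a function \<open>g\<close> on the unit interval: its truncated Legendre
  expansion with the coefficients computed by the quadrature formula. On a step of length \<open>h\<close> with
  memory value \<open>w\<close> the method reads \<open>u' = Q g\<close>, where \<open>g\<close> is the field \<open>f (u, w)\<close> along \<open>u\<close> in the local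
  variable. So \<open>u\<close> solves the differential equation up to the residual \<open>R = g - Q g\<close>, and the
  theorem rests on two properties of \<open>R\<close>.

  First, \<open>R\<close> is of order \<open>h ^ s\<close>, since \<open>Q\<close> reproduces polynomials of degree below \<open>s\<close>
  (\<open>residual_small\<close>). Second, the integral of \<open>R\<close> against any function with bounded derivatives is of
  order \<open>h ^ (2 * s)\<close> (\<open>residual_orthogonal\<close>): for monomials of total degree below \<open>2 * s\<close> it vanishes
  (\<open>disc_proj_moment_power\<close>), and all other terms of the two Taylor expansions carry enough powers
  of \<open>h\<close>. Both require that the derivatives of \<open>u\<close> within a step are bounded uniformly in \<open>h\<close>, which
  holds by a bootstrapping argument (\<open>step_regularity\<close>).

  The first property yields the error inside a step (\<open>interior_error\<close>). For the end of the step the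
  error \<open>\<delta> = y - u\<close> is considered as a solution of the linearised equation \<open>\<delta>' = A \<delta> + R\<close> with
  negligible further terms. Pairing it with a curve \<open>\<Phi>\<close> that solves the adjoint equation
  removes \<open>A\<close> and leaves the integral of \<open>R\<close> against \<open>\<Phi>\<close>, to which the second property applies
  (\<open>one_step_error\<close>). Since \<open>\<delta>\<close> is small anyway, \<open>\<Phi>\<close> need only solve the adjoint equation up to order
  \<open>h ^ s\<close>; finitely many Picard iterations starting from a constant provide it
  (\<open>truncated_adjoint\<close>).

  The nodal error thus grows during one step by at most a multiple of \<open>h\<close> times the sum of the
  current nodal error, the error of the memory term, which is an earlier nodal error, and
  \<open>h ^ (2 * s)\<close>. A discrete Gronwall argument makes it of order \<open>h ^ (2 * s)\<close>, hence the growth of order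
  \<open>h ^ (2 * s + 1)\<close> (\<open>global_error\<close>).

  All constants refer to a fixed ball containing the values of \<open>y\<close> and, for small \<open>h\<close>, of \<open>u\<close>. That the
  approximations stay in a ball is a consequence of their uniqueness: for the field truncated
  outside a ball an approximation close to \<open>y\<close> can be constructed by a contraction argument, and
  it has to be \<open>u\<close> (\<open>hbvm_approx_bounded\<close>).
\<close>

section \<open>Curves with bounded derivatives\<close>

lemma norm_diff_le_of_derivative:
  fixes x :: "real \<Rightarrow> 'a::real_normed_vector"
  assumes "\<And>t. t \<in> {a..b} \<Longrightarrow> (x has_vector_derivative x' t) (at t within {a..b})"
    and "\<And>t. t \<in> {a..b} \<Longrightarrow> norm (x' t) \<le> B" and "t \<in> {a..b}" "t' \<in> {a..b}"
  shows "norm (x t - x t') \<le> B * \<bar>t - t'\<bar>"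
  unfolding real_norm_def[symmetric]
proof (rule differentiable_bound[where S = "{a..b}" and f' = "\<lambda>t h. h *\<^sub>R x' t"])
  fix t assume t: "t \<in> {a..b}"
  show "(x has_derivative (\<lambda>h. h *\<^sub>R x' t)) (at t within {a..b})"
    using assms(1)[OF t] by (simp add: has_vector_derivative_def)
  show "onorm (\<lambda>h. h *\<^sub>R x' t) \<le> B"
  proof (rule onorm_le)
    fix h show "norm (h *\<^sub>R x' t) \<le> B * norm h"
      using mult_right_mono[OF assms(2)[OF t], of "\<bar>h\<bar>"] by (simp add: mult.commute)
  qed
qed (use assms in auto)

text \<open>
  Fixing one bound for the values and all derivatives, without naming the derivatives, makes
  statements uniform over families of curves: below the bound never depends on the step size,
  the step number or the position of the step.
\<close>

primrec bounded_derivs :: "nat \<Rightarrow> real \<Rightarrow> real set \<Rightarrow> (real \<Rightarrow> 'a::real_normed_vector) \<Rightarrow> bool" where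
  "bounded_derivs 0 M S x \<longleftrightarrow> (\<forall>t\<in>S. norm (x t) \<le> M)"
| "bounded_derivs (Suc N) M S x \<longleftrightarrow> (\<forall>t\<in>S. norm (x t) \<le> M) \<and>
     (\<exists>x'. (\<forall>t\<in>S. (x has_vector_derivative x' t) (at t within S)) \<and> bounded_derivs N M S x')"

lemma bounded_derivs_norm: "bounded_derivs N M S x \<Longrightarrow> t \<in> S \<Longrightarrow> norm (x t) \<le> M"
  by (cases N) auto

lemma bounded_derivs_mono: "bounded_derivs N M S x \<Longrightarrow> M \<le> M' \<Longrightarrow> bounded_derivs N M' S x"
proof (induction N arbitrary: x)
  case (Suc N) then show ?case by (auto intro: order_trans)
qed (auto intro: order_trans)

lemma bounded_derivs_Suc_D: "bounded_derivs (Suc N) M S x \<Longrightarrow> bounded_derivs N M S x"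
proof (induction N arbitrary: x)
  case (Suc N)
  then obtain x' where x': "\<forall>t\<in>S. (x has_vector_derivative x' t) (at t within S)"
    "bounded_derivs (Suc N) M S x'" "\<forall>t\<in>S. norm (x t) \<le> M"
    by (metis bounded_derivs.simps(2))
  then have "bounded_derivs N M S x'" using Suc.IH by blast
  with x' show ?case by auto
qed auto

lemma bounded_derivs_le: "N' \<le> N \<Longrightarrow> bounded_derivs N M S x \<Longrightarrow> bounded_derivs N' M S x"
  by (induction rule: inc_induct) (blast dest: bounded_derivs_Suc_D)+

lemma bounded_derivs_continuous: "bounded_derivs (Suc N) M S x \<Longrightarrow> continuous_on S x"
  by (auto simp: continuous_on_eq_continuous_within intro: has_vector_derivative_continuous)

lemma bounded_derivs_Lipschitz:
  assumes "bounded_derivs (Suc N) M {a..b} x" "t \<in> {a..b}" "t' \<in> {a..b}"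
  shows "norm (x t - x t') \<le> M * \<bar>t - t'\<bar>"
proof -
  obtain x' where x': "\<forall>t\<in>{a..b}. (x has_vector_derivative x' t) (at t within {a..b})"
    "bounded_derivs N M {a..b} x'" using assms(1) by auto
  show ?thesis
    using x' assms(2,3) bounded_derivs_norm[OF x'(2)] by (intro norm_diff_le_of_derivative[where x' = x']) auto
qed

lemma bounded_derivs_const: "norm a \<le> M \<Longrightarrow> bounded_derivs N M S (\<lambda>_. a)"
proof (induction N arbitrary: a)
  case (Suc N)
  have "0 \<le> M" using Suc.prems norm_ge_zero[of a] by linarith
  with Suc show ?case by (auto intro!: exI[of _ "\<lambda>_. 0"] has_vector_derivative_const)
qed auto

lemma bounded_derivs_minus: "bounded_derivs N M S x \<Longrightarrow> bounded_derivs N M S (\<lambda>t. - x t)"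
proof (induction N arbitrary: x)
  case (Suc N)
  then obtain x' where x': "\<forall>t\<in>S. (x has_vector_derivative x' t) (at t within S)"
    "bounded_derivs N M S x'" by auto
  show ?case unfolding bounded_derivs.simps
    using Suc x' by (intro conjI exI[of _ "\<lambda>t. - x' t"] ballI has_vector_derivative_minus) auto
qed auto

lemma bounded_derivs_add:
  "bounded_derivs N M1 S x \<Longrightarrow> bounded_derivs N M2 S z \<Longrightarrow> bounded_derivs N (M1 + M2) S (\<lambda>t. x t + z t)"
proof (induction N arbitrary: x z)
  case 0 then show ?case by (auto intro: norm_triangle_mono)
next
  case (Suc N)
  then obtain x' z' where
    "\<forall>t\<in>S. (x has_vector_derivative x' t) (at t within S)" "bounded_derivs N M1 S x'"
    "\<forall>t\<in>S. (z has_vector_derivative z' t) (at t within S)" "bounded_derivs N M2 S z'"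
    by auto
  with Suc show ?case
    by (auto intro!: exI[of _ "\<lambda>t. x' t + z' t"] has_vector_derivative_add norm_triangle_mono)
qed

lemma bounded_derivs_sum:
  assumes "finite I" "\<And>i. i \<in> I \<Longrightarrow> bounded_derivs N (M i) S (x i)"
  shows "bounded_derivs N (\<Sum>i\<in>I. M i) S (\<lambda>t. \<Sum>i\<in>I. x i t)"
  using assms by (induction I) (auto intro: bounded_derivs_const bounded_derivs_add)

lemma bounded_derivs_prod:
  assumes B: "bounded_bilinear pr" and K: "\<And>a b. norm (pr a b) \<le> norm a * norm b" and M: "0 \<le> M1" "0 \<le> M2"
  shows "bounded_derivs N M1 S x \<Longrightarrow> bounded_derivs N M2 S z \<Longrightarrow>
    bounded_derivs N (2 ^ N * (M1 * M2)) S (\<lambda>t. pr (x t) (z t))"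
proof (induction N arbitrary: x z)
  case 0 then show ?case using M by (auto intro!: order_trans[OF K] mult_mono)
next
  case (Suc N)
  then obtain x' z' where *:
    "\<forall>t\<in>S. (x has_vector_derivative x' t) (at t within S)" "bounded_derivs N M1 S x'"
    "\<forall>t\<in>S. (z has_vector_derivative z' t) (at t within S)" "bounded_derivs N M2 S z'"
    by auto
  have "bounded_derivs N M1 S x" "bounded_derivs N M2 S z"
    using Suc.prems bounded_derivs_Suc_D by blast+
  with * have "bounded_derivs N (2 ^ N * (M1 * M2) + 2 ^ N * (M1 * M2)) S
      (\<lambda>t. pr (x t) (z' t) + pr (x' t) (z t))"
    by (intro bounded_derivs_add Suc.IH)
  moreover have "2 ^ N * (M1 * M2) + 2 ^ N * (M1 * M2) = 2 ^ Suc N * (M1 * M2)" by simp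
  ultimately have "bounded_derivs N (2 ^ Suc N * (M1 * M2)) S (\<lambda>t. pr (x t) (z' t) + pr (x' t) (z t))"
    by metis
  moreover have "norm (pr (x t) (z t)) \<le> 2 ^ Suc N * (M1 * M2)" if "t \<in> S" for t
  proof -
    have "norm (pr (x t) (z t)) \<le> 1 * (M1 * M2)"
      using that M bounded_derivs_norm[OF Suc.prems(1)] bounded_derivs_norm[OF Suc.prems(2)]
      by (auto intro!: order_trans[OF K] mult_mono)
    also have "\<dots> \<le> 2 ^ Suc N * (M1 * M2)" using M by (intro mult_right_mono one_le_power) auto
    finally show ?thesis .
  qed
  ultimately show ?case
    using * unfolding bounded_derivs.simps
    by (intro conjI exI[of _ "\<lambda>t. pr (x t) (z' t) + pr (x' t) (z t)"] ballI
        bounded_bilinear.has_vector_derivative[OF B]) auto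
qed

lemmas bounded_derivs_scaleR = bounded_derivs_prod[OF bounded_bilinear_scaleR, simplified]

lemmas bounded_derivs_inner =
  bounded_derivs_prod[OF bounded_bilinear_inner, unfolded real_norm_def, OF Cauchy_Schwarz_ineq2]

lemma bounded_derivs_component:
  fixes x :: "real \<Rightarrow> 'a::euclidean_space"
  assumes "bounded_derivs N M S x" "e \<in> Basis"
  shows "bounded_derivs N M S (\<lambda>t. x t \<bullet> e)"
  using assms(1)
proof (induction N arbitrary: x)
  case 0 then show ?case using Basis_le_norm[OF assms(2)] by (force intro: order_trans)
next
  case (Suc N)
  then obtain x' where x': "\<forall>t\<in>S. (x has_vector_derivative x' t) (at t within S)" "bounded_derivs N M S x'" 
    by auto
  have "norm (x t \<bullet> e) \<le> M" if "t \<in> S" for t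
    using Basis_le_norm[OF assms(2), of "x t"] bounded_derivs_norm[OF Suc.prems that] by simp
  with x' Suc.IH[OF x'(2)] show ?case unfolding bounded_derivs.simps
    by (intro conjI exI[of _ "\<lambda>t. x' t \<bullet> e"] ballI
        bounded_linear.has_vector_derivative[OF bounded_linear_inner_left]) auto
qed

lemma bounded_derivs_Pair_const:
  assumes "bounded_derivs N M S x" "norm w \<le> M"
  shows "bounded_derivs N (2 * M) S (\<lambda>t. (x t, w))"
  using assms
proof (induction N arbitrary: x w)
  case 0
  have "norm (x t, w) \<le> 2 * M" if "t \<in> S" for t
    using 0 that norm_Pair_le[of "x t" w] by force
  then show ?case by simp
next
  case (Suc N)
  then obtain x' where x': "\<forall>t\<in>S. (x has_vector_derivative x' t) (at t within S)" "bounded_derivs N M S x'" 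
    by auto
  have "norm (0::'b) \<le> M" using Suc.prems(2) norm_ge_zero[of w] by (simp del: norm_ge_zero)
  then have "bounded_derivs N (2 * M) S (\<lambda>t. (x' t, 0::'b))" using Suc.IH x' by blast
  moreover have "((\<lambda>t. (x t, w)) has_vector_derivative (x' t, 0)) (at t within S)" if "t \<in> S" for t
    using x' that by (intro has_vector_derivative_Pair has_vector_derivative_const) auto
  moreover have "norm (x t, w) \<le> 2 * M" if "t \<in> S" for t
    using Suc.prems that norm_Pair_le[of "x t" w] by force
  ultimately show ?case unfolding bounded_derivs.simps
    by (intro conjI exI[of _ "\<lambda>t. (x' t, 0::'b)"] ballI)
qed

lemma C_diff_continuous: "C_diff N f \<Longrightarrow> continuous_on UNIV f"
  by (cases N) (auto simp: continuous_on_eq_continuous_within intro!: differentiable_imp_continuous_within)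

lemma continuous_bounded_cball:
  fixes f :: "'a::euclidean_space \<Rightarrow> 'b::euclidean_space"
  assumes "continuous_on UNIV f"
  shows "\<exists>B\<ge>0. \<forall>x\<in>cball 0 M. norm (f x) \<le> B"
proof -
  have "bounded (f ` cball 0 M)"
    using assms by (intro compact_imp_bounded compact_continuous_image) (auto intro: continuous_on_subset)
  then obtain B where "B > 0" "\<forall>z\<in>f ` cball 0 M. norm z \<le> B" unfolding bounded_pos by blast
  then show ?thesis by (intro exI[of _ B]) auto
qed

lemma derivative_in_basis:
  fixes f :: "'a::euclidean_space \<Rightarrow> 'b::euclidean_space"
  assumes "f differentiable at x"
  shows "frechet_derivative f (at x) v = (\<Sum>i\<in>Basis. (v \<bullet> i) *\<^sub>R frechet_derivative f (at x) i)"
proof -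
  interpret linear "frechet_derivative f (at x)" using linear_frechet_derivative[OF assms] .
  have "frechet_derivative f (at x) (\<Sum>i\<in>Basis. (v \<bullet> i) *\<^sub>R i) = (\<Sum>i\<in>Basis. (v \<bullet> i) *\<^sub>R frechet_derivative f (at x) i)"
    by (simp only: sum scaleR)
  then show ?thesis by (simp only: euclidean_representation)
qed

text \<open>
  By induction, since the derivatives of \<open>f (x t)\<close> are sums of products of components of \<open>x'\<close>
  with partial derivatives of \<open>f\<close> along \<open>x\<close>. The bound depends on \<open>x\<close> through \<open>M\<close> only.
\<close>

lemma bounded_derivs_compose:
  fixes f :: "'a::euclidean_space \<Rightarrow> 'b::euclidean_space"
  assumes "C_diff N f" "0 \<le> M"
  shows "\<exists>M'\<ge>0. \<forall>S x. bounded_derivs N M S x \<longrightarrow> bounded_derivs N M' S (\<lambda>t. f (x t))"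
  using assms(1)
proof (induction N arbitrary: f)
  case 0
  then obtain B where "B \<ge> 0" "\<forall>x\<in>cball 0 M. norm (f x) \<le> B" using continuous_bounded_cball by force
  then show ?case by (intro exI[of _ B]) (auto simp: dist_norm)
next
  case (Suc N)
  obtain B where B: "B \<ge> 0" "\<forall>x\<in>cball 0 M. norm (f x) \<le> B"
    using continuous_bounded_cball[OF C_diff_continuous[OF Suc.prems]] by force
  have "\<forall>i. \<exists>M'\<ge>0. \<forall>S x. bounded_derivs N M S x \<longrightarrow>
      bounded_derivs N M' S (\<lambda>t. frechet_derivative f (at (x t)) i)"
    using Suc.prems by (auto intro!: Suc.IH)
  then obtain D where D: "\<And>i. D i \<ge> 0" "\<And>i S x. bounded_derivs N M S x \<Longrightarrow>
      bounded_derivs N (D i) S (\<lambda>t. frechet_derivative f (at (x t)) i)" by metis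
  define C where "C = (\<Sum>i\<in>(Basis::'a set). 2 ^ N * (M * D i))"
  have C: "C \<ge> 0" unfolding C_def using D assms(2) by (auto intro!: sum_nonneg)
  have "bounded_derivs (Suc N) (B + C) S (\<lambda>t. f (x t))" if x: "bounded_derivs (Suc N) M S x" for S x
  proof -
    obtain x' where x': "\<forall>t\<in>S. (x has_vector_derivative x' t) (at t within S)" "bounded_derivs N M S x'"
      using x by auto
    \<comment> \<open>The chain rule, with the derivative of f expanded in the basis: only directional
      derivatives along constant vectors occur, to which the induction hypothesis applies.\<close>
    define z where "z = (\<lambda>t. \<Sum>i\<in>Basis. (x' t \<bullet> i) *\<^sub>R frechet_derivative f (at (x t)) i)"
    have "bounded_derivs N C S z" unfolding z_def C_def
      using bounded_derivs_Suc_D[OF x] x' D assms(2)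
      by (auto intro!: bounded_derivs_sum bounded_derivs_scaleR bounded_derivs_component)
    then have "bounded_derivs N (B + C) S z" using B by (auto elim: bounded_derivs_mono)
    moreover have "((\<lambda>t. f (x t)) has_vector_derivative z t) (at t within S)" if t: "t \<in> S" for t
    proof -
      have df: "f differentiable at (x t)" using Suc.prems by auto
      have "(f has_derivative frechet_derivative f (at (x t))) (at (x t) within x ` S)"
        using df frechet_derivative_works has_derivative_at_withinI by blast
      then have "((f \<circ> x) has_derivative (frechet_derivative f (at (x t)) \<circ> (\<lambda>h. h *\<^sub>R x' t))) (at t within S)"
        using x'(1) t by (intro diff_chain_within) (auto simp: has_vector_derivative_def)
      moreover have "frechet_derivative f (at (x t)) \<circ> (\<lambda>h. h *\<^sub>R x' t) = (\<lambda>h. h *\<^sub>R z t)"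
        using linear_cmul[OF linear_frechet_derivative[OF df]]
        unfolding z_def derivative_in_basis[OF df, symmetric] by (simp add: fun_eq_iff)
      ultimately show ?thesis by (simp add: has_vector_derivative_def o_def)
    qed
    moreover have "norm (f (x t)) \<le> B + C" if "t \<in> S" for t
    proof -
      have "norm (f (x t)) \<le> B" using B x that by (auto simp: dist_norm)
      then show ?thesis using C by simp
    qed
    ultimately show ?thesis unfolding bounded_derivs.simps by (intro conjI exI[of _ z] ballI)
  qed
  then show ?case using B C by (intro exI[of _ "B + C"] conjI allI impI) auto
qed

text \<open>
  Taylor's formula in the form used below: an unspecified jet with bounded coefficients and a
  remainder estimate. It follows by integrating the formula for the derivative.
\<close>

lemma bounded_derivs_Taylor:
  fixes x :: "real \<Rightarrow> 'a::real_normed_vector"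
  assumes "0 \<le> M" "p \<le> q"
  shows "bounded_derivs N M {p..q} x \<Longrightarrow>
    \<exists>a. (\<forall>i. norm (a i) \<le> M) \<and> (\<forall>t\<in>{p..q}. norm (x t - (\<Sum>i<N. (t - p) ^ i *\<^sub>R a i)) \<le> M * (t - p) ^ N)"
proof (induction N arbitrary: x)
  case 0
  then show ?case using assms by (auto intro!: exI[of _ "\<lambda>_. 0"])
next
  case (Suc N)
  then obtain x' where x': "\<And>t. t \<in> {p..q} \<Longrightarrow> (x has_vector_derivative x' t) (at t within {p..q})"
    "bounded_derivs N M {p..q} x'" unfolding bounded_derivs.simps by blast
  from Suc.IH[OF x'(2)] obtain a where a: "\<And>i. norm (a i) \<le> M"
    "\<And>t. t \<in> {p..q} \<Longrightarrow> norm (x' t - (\<Sum>i<N. (t - p) ^ i *\<^sub>R a i)) \<le> M * (t - p) ^ N"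
    by blast
  \<comment> \<open>The jet of x is its value at p followed by the integrated jet of its derivative.\<close>
  define a' where "a' = (\<lambda>i. case i of 0 \<Rightarrow> x p | Suc j \<Rightarrow> (1 / real (Suc j)) *\<^sub>R a j)"
  define r where "r = (\<lambda>t. x t - (\<Sum>i<N. (t - p) ^ Suc i *\<^sub>R ((1 / real (Suc i)) *\<^sub>R a i)))"
  have r': "(r has_vector_derivative (x' t - (\<Sum>i<N. (t - p) ^ i *\<^sub>R a i))) (at t within {p..q})"
    if "t \<in> {p..q}" for t
  proof -
    have "((\<lambda>t. (t - p) ^ Suc i *\<^sub>R ((1 / real (Suc i)) *\<^sub>R a i)) has_vector_derivative (t - p) ^ i *\<^sub>R a i)
      (at t within {p..q})" for i
    proof -
      have "((\<lambda>t. (t - p) ^ Suc i) has_real_derivative real (Suc i) * (t - p) ^ i) (at t within {p..q})"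
        by (rule DERIV_cong[OF DERIV_power_Suc[where D = 1]]) (auto intro!: derivative_eq_intros)
      from has_vector_derivative_scaleR[OF this has_vector_derivative_const, of "(1 / real (Suc i)) *\<^sub>R a i"]
      show ?thesis by (simp del: of_nat_Suc)
    qed
    then show ?thesis unfolding r_def using x'(1)[OF that]
      by (intro has_vector_derivative_diff has_vector_derivative_sum) auto
  qed
  have bnd: "norm (x t - (\<Sum>i<Suc N. (t - p) ^ i *\<^sub>R a' i)) \<le> M * (t - p) ^ Suc N" if t: "t \<in> {p..q}" for t
  proof -
    have "norm (r t - r p) \<le> (M * (t - p) ^ N) * \<bar>t - p\<bar>"
    proof (rule norm_diff_le_of_derivative[where a = p and b = t])
      fix \<sigma> assume \<sigma>: "\<sigma> \<in> {p..t}"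
      show "(r has_vector_derivative (x' \<sigma> - (\<Sum>i<N. (\<sigma> - p) ^ i *\<^sub>R a i))) (at \<sigma> within {p..t})"
        by (rule has_vector_derivative_within_subset[OF r']) (use \<sigma> t in auto)
      have "norm (x' \<sigma> - (\<Sum>i<N. (\<sigma> - p) ^ i *\<^sub>R a i)) \<le> M * (\<sigma> - p) ^ N" using a(2) \<sigma> t by auto
      also have "\<dots> \<le> M * (t - p) ^ N" using \<sigma> assms by (auto intro!: mult_left_mono power_mono)
      finally show "norm (x' \<sigma> - (\<Sum>i<N. (\<sigma> - p) ^ i *\<^sub>R a i)) \<le> M * (t - p) ^ N" .
    qed (use t in auto)
    moreover have "r p = x p" by (simp add: r_def)
    moreover have "(\<Sum>i<Suc N. (t - p) ^ i *\<^sub>R a' i) = x p + (x t - r t)"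
      unfolding sum.lessThan_Suc_shift r_def by (simp add: a'_def)
    ultimately show ?thesis using t by (simp add: mult_ac)
  qed
  have "norm (a' i) \<le> M" for i
  proof (cases i)
    case 0
    then show ?thesis using bounded_derivs_norm[OF Suc.prems, of p] assms by (simp add: a'_def)
  next
    case (Suc j)
    have "norm (a j) / (1 + real j) \<le> norm (a j) / 1" by (intro divide_left_mono) auto
    then show ?thesis using a(1)[of j] by (simp add: a'_def Suc)
  qed
  with bnd show ?case by blast
qed

lemma unit_interval_scale: "\<tau> \<in> {0..1} \<Longrightarrow> 0 \<le> h \<Longrightarrow> a + \<tau> * h \<in> {a..a+h}" for a h :: real
  by (auto intro: mult_left_le_one_le)

text \<open>
  Taylor's formula on a step, rescaled to the unit interval: the coefficient of \<open>\<tau> ^ i\<close> carries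
  the factor \<open>h ^ i\<close>. This is the source of all powers of \<open>h\<close>.
\<close>

lemma bounded_derivs_jet:
  fixes g :: "real \<Rightarrow> 'v::real_normed_vector"
  assumes "bounded_derivs N M {a..a+h} g" "0 \<le> M" "0 < h"
  shows "\<exists>d. (\<forall>i. norm (d i) \<le> M) \<and>
    (\<forall>\<tau>\<in>{0..1}. norm (g (a + \<tau> * h) - (\<Sum>i<N. (h * \<tau>) ^ i *\<^sub>R d i)) \<le> M * h ^ N)"
proof -
  have "a \<le> a + h" using assms by simp
  from bounded_derivs_Taylor[OF assms(2) this assms(1)] obtain d where d: "\<And>i. norm (d i) \<le> M"
    "\<And>t. t \<in> {a..a+h} \<Longrightarrow> norm (g t - (\<Sum>i<N. (t - a) ^ i *\<^sub>R d i)) \<le> M * (t - a) ^ N" by blast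
  have "norm (g (a + \<tau> * h) - (\<Sum>i<N. (h * \<tau>) ^ i *\<^sub>R d i)) \<le> M * h ^ N" if "\<tau> \<in> {0..1}" for \<tau>
  proof -
    have t: "a + \<tau> * h \<in> {a..a+h}" using that assms by (auto intro: mult_left_le_one_le)
    have "M * (\<tau> * h) ^ N \<le> M * h ^ N" using that assms
      by (intro mult_left_mono power_mono) (auto intro: mult_left_le_one_le)
    with d(2)[OF t] show ?thesis by (simp add: mult.commute[of h])
  qed
  with d show ?thesis by blast
qed

text \<open>
  At the right end point only continuity of \<open>y\<close> is given. The equation holds there too because its
  right-hand side extends continuously.
\<close>

lemma derivative_closed_interval:
  fixes y :: "real \<Rightarrow> 'a::banach"
  assumes "a < b" "continuous_on {a..b} y" "continuous_on {a..b} \<phi>"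
    and d: "\<And>t. t \<in> {a..<b} \<Longrightarrow> (y has_vector_derivative \<phi> t) (at t within {a..<b})"
    and t: "t \<in> {a..b}"
  shows "(y has_vector_derivative \<phi> t) (at t within {a..b})"
proof -
  have int: "(\<phi> has_integral (y t - y a)) {a..t}" if "t \<in> {a..b}" for t
  proof (rule fundamental_theorem_of_calculus_interior)
    show "a \<le> t" using that by simp
    show "continuous_on {a..t} y" using that by (intro continuous_on_subset[OF assms(2)]) auto
    fix x assume "x \<in> {a<..<t}"
    then have x: "x \<in> {a<..<b}" using that by auto
    then have "(y has_vector_derivative \<phi> x) (at x within {a<..<b})"
      by (intro has_vector_derivative_within_subset[OF d, of x "{a<..<b}"]) auto
    then show "(y has_vector_derivative \<phi> x) (at x)"
      using has_vector_derivative_within_open[OF x open_greaterThanLessThan] by blast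
  qed
  have 1: "((\<lambda>t. y a + integral {a..t} \<phi>) has_vector_derivative 0 + \<phi> t) (at t within {a..b})"
    by (intro has_vector_derivative_add has_vector_derivative_const integral_has_vector_derivative assms(3) t)
  have "y x = y a + integral {a..x} \<phi>" if "x \<in> {a..b}" for x
    using integral_unique[OF int[OF that]] by simp
  from has_vector_derivative_transform[OF t this 1] show ?thesis by simp
qed

section \<open>Smooth vector fields on balls\<close>

lemma C_infinity_derivative: "C_infinity f \<Longrightarrow> C_infinity (\<lambda>x. frechet_derivative f (at x) v)"
  unfolding C_infinity_def by (metis C_diff.simps(2))

lemma C_infinity_has_derivative: "C_infinity f \<Longrightarrow> (f has_derivative frechet_derivative f (at x)) (at x within S)"
  unfolding C_infinity_def by (metis C_diff.simps(2) frechet_derivative_works has_derivative_at_withinI)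

lemma C_infinity_differentiable: "C_infinity f \<Longrightarrow> f differentiable (at x)"
  unfolding C_infinity_def by (metis C_diff.simps(2))

lemma C_infinity_continuous: "C_infinity f \<Longrightarrow> continuous_on S f"
  using C_diff_continuous[of 0 f] by (auto simp: C_infinity_def intro: continuous_on_subset)

lemma C_infinity_derivative_bound:
  fixes f :: "'a::euclidean_space \<Rightarrow> 'b::euclidean_space"
  assumes "C_infinity f"
  shows "\<exists>B\<ge>0. \<forall>x\<in>cball 0 \<rho>. \<forall>v. norm (frechet_derivative f (at x) v) \<le> B * norm v"
proof -
  have "\<forall>i. \<exists>B\<ge>0. \<forall>x\<in>cball 0 \<rho>. norm (frechet_derivative f (at x) i) \<le> B"
    using C_infinity_continuous[OF C_infinity_derivative[OF assms]] continuous_bounded_cball by blast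
  then obtain B where B: "\<And>i. B i \<ge> 0" "\<And>i x. x \<in> cball 0 \<rho> \<Longrightarrow> norm (frechet_derivative f (at x) i) \<le> B i" by metis
  have "norm (frechet_derivative f (at x) v) \<le> sum B Basis * norm v" if "x \<in> cball 0 \<rho>" for x v
    unfolding derivative_in_basis[OF C_infinity_differentiable[OF assms], of x v] sum_distrib_right
  proof (rule order_trans[OF norm_sum], rule sum_mono)
    fix i :: 'a assume "i \<in> Basis"
    then show "norm ((v \<bullet> i) *\<^sub>R frechet_derivative f (at x) i) \<le> B i * norm v"
      using mult_mono[OF B(2)[OF that, of i] Basis_le_norm[of i v]] B by (simp add: mult.commute)
  qed
  then show ?thesis using B by (intro exI[of _ "sum B Basis"]) (auto intro: sum_nonneg)
qed

lemma C_infinity_Lipschitz: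
  fixes f :: "'a::euclidean_space \<Rightarrow> 'b::euclidean_space"
  assumes "C_infinity f"
  shows "\<exists>L\<ge>0. \<forall>x\<in>cball 0 \<rho>. \<forall>z\<in>cball 0 \<rho>. norm (f x - f z) \<le> L * norm (x - z)"
proof -
  obtain B where B: "B \<ge> 0" "\<forall>x\<in>cball 0 \<rho>. \<forall>v. norm (frechet_derivative f (at x) v) \<le> B * norm v"
    using C_infinity_derivative_bound[OF assms] by blast
  have "norm (f x - f z) \<le> B * norm (x - z)" if "x \<in> cball 0 \<rho>" "z \<in> cball 0 \<rho>" for x z
    using B that by (intro differentiable_bound[where S = "cball 0 \<rho>" and f' = "\<lambda>x. frechet_derivative f (at x)"])
      (auto intro: C_infinity_has_derivative[OF assms] onorm_le)
  with B show ?thesis by blast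
qed

text \<open>
  The derivative itself is Lipschitz on the ball, as its partial derivatives are.
\<close>

lemma C_infinity_remainder:
  fixes f :: "'a::euclidean_space \<Rightarrow> 'b::euclidean_space"
  assumes "C_infinity f"
  shows "\<exists>C\<ge>0. \<forall>x\<in>cball 0 \<rho>. \<forall>z\<in>cball 0 \<rho>.
    norm (f x - f z - frechet_derivative f (at z) (x - z)) \<le> C * (norm (x - z))\<^sup>2"
proof -
  have "\<forall>i. \<exists>L\<ge>0. \<forall>x\<in>cball 0 \<rho>. \<forall>z\<in>cball 0 \<rho>.
      norm (frechet_derivative f (at x) i - frechet_derivative f (at z) i) \<le> L * norm (x - z)"
    using C_infinity_Lipschitz[OF C_infinity_derivative[OF assms]] by blast
  then obtain L where L: "\<And>i. L i \<ge> 0" "\<And>i x z. x \<in> cball 0 \<rho> \<Longrightarrow> z \<in> cball 0 \<rho> \<Longrightarrow>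
      norm (frechet_derivative f (at x) i - frechet_derivative f (at z) i) \<le> L i * norm (x - z)" by metis
  define C where "C = sum L Basis"
  have C: "0 \<le> C" using L by (auto simp: C_def intro: sum_nonneg)
  have lip: "norm (frechet_derivative f (at x) v - frechet_derivative f (at z) v) \<le> C * norm (x - z) * norm v"
    if "x \<in> cball 0 \<rho>" "z \<in> cball 0 \<rho>" for x z v
    unfolding derivative_in_basis[OF C_infinity_differentiable[OF assms], of _ v] C_def sum_distrib_right
      sum_subtractf[symmetric] scaleR_diff_right[symmetric]
  proof (rule order_trans[OF norm_sum], rule sum_mono)
    fix i :: 'a assume "i \<in> Basis"
    then show "norm ((v \<bullet> i) *\<^sub>R (frechet_derivative f (at x) i - frechet_derivative f (at z) i))
      \<le> L i * norm (x - z) * norm v"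
      using mult_mono[OF L(2)[OF that, of i] Basis_le_norm[of i v]] L
      by (simp add: mult.commute)
  qed
  have "norm (f x - f z - frechet_derivative f (at z) (x - z)) \<le> C * (norm (x - z))\<^sup>2"
    if "x \<in> cball 0 \<rho>" "z \<in> cball 0 \<rho>" for x z
  proof -
    have seg: "closed_segment z x \<subseteq> cball 0 \<rho>" using that by (intro closed_segment_subset) auto
    have "norm (f x - f z - frechet_derivative f (at z) (x - z)) \<le> norm (x - z) * (C * norm (x - z))"
    proof (rule differentiable_bound_linearization[where S = "closed_segment z x" and f' = "\<lambda>x. frechet_derivative f (at x)"])
      fix w assume w: "w \<in> closed_segment z x"
      have "norm (w - z) \<le> norm (x - z)" using segment_bound(1)[OF w] .
      have "norm ((frechet_derivative f (at w) - frechet_derivative f (at z)) v) \<le> C * norm (x - z) * norm v" for v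
      proof -
        have "norm ((frechet_derivative f (at w) - frechet_derivative f (at z)) v) \<le> C * norm (w - z) * norm v"
          using lip[of w z v] w seg that by auto
        also have "\<dots> \<le> C * norm (x - z) * norm v"
          using segment_bound(1)[OF w] C by (intro mult_right_mono mult_left_mono) auto
        finally show ?thesis .
      qed
      then show "onorm (frechet_derivative f (at w) - frechet_derivative f (at z)) \<le> C * norm (x - z)"
        using C by (intro onorm_le) (auto simp: fun_diff_def)
    next
      fix t :: real assume "t \<in> {0..1}"
      then show "z + t *\<^sub>R (x - z) \<in> closed_segment z x"
        by (auto simp: closed_segment_def algebra_simps intro!: exI[of _ t])
    qed (auto intro: C_infinity_has_derivative[OF assms])
    then show ?thesis by (simp add: power2_eq_square mult_ac)
  qed
  with C show ?thesis by blast
qed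

section \<open>The discrete Legendre projection\<close>

definition poly_size :: "real poly \<Rightarrow> real" where
  "poly_size p = (\<Sum>i\<le>degree p. \<bar>coeff p i\<bar>)"

lemma poly_size_nonneg: "0 \<le> poly_size p"
  by (simp add: poly_size_def sum_nonneg)

lemma abs_poly_le_poly_size:
  assumes "t \<in> {0..1}" shows "\<bar>poly p t\<bar> \<le> poly_size p"
  unfolding poly_size_def poly_altdef
proof (rule order_trans[OF sum_abs], rule sum_mono)
  fix i
  have "\<bar>coeff p i\<bar> * t ^ i \<le> \<bar>coeff p i\<bar> * 1" using assms by (intro mult_left_mono power_le_one) auto
  then show "\<bar>coeff p i * t ^ i\<bar> \<le> \<bar>coeff p i\<bar>" using assms by (simp add: abs_mult)
qed

lemma poly_integrable: "(\<lambda>x. poly p x) integrable_on {0..1::real}"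
  by (intro integrable_continuous_real continuous_intros)

text \<open>
  Order \<open>2 * s\<close> makes the formula exact on products of two basis polynomials, and on all products of
  monomials for which the projection is to be orthogonal.
\<close>

locale legendre_quadrature =
  fixes P :: "nat \<Rightarrow> real poly" and s k :: nat and b c :: "nat \<Rightarrow> real"
  assumes legendre: "orthonormal_legendre P"
    and nodes: "\<And>i. i \<in> {1..k} \<Longrightarrow> c i \<in> {0..1}"
    and exact: "quadrature_order k b c (2 * s)"
begin

lemma degree_legendre: "degree (P j) = j"
  using legendre by (simp add: orthonormal_legendre_def)

lemma legendre_inner: "integral {0..1} (\<lambda>x. poly (P i * P j) x) = (if i = j then 1 else 0)"
  using legendre by (simp add: orthonormal_legendre_def)

lemma legendre_nonzero: "P j \<noteq> 0"
  using legendre_inner[of j j] by auto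

lemma legendre_span:
  assumes "\<And>i. n \<le> i \<Longrightarrow> coeff p i = 0"
  shows "\<exists>a. p = (\<Sum>j<n. smult (a j) (P j))"
  using assms
proof (induction n arbitrary: p)
  case 0 then show ?case by (simp add: poly_eq_iff)
next
  case (Suc n)
  have nz: "coeff (P n) n \<noteq> 0"
    using legendre_nonzero[of n] degree_legendre[of n] by (metis leading_coeff_0_iff)
  define \<alpha> where "\<alpha> = coeff p n / coeff (P n) n"
  have "coeff (p - smult \<alpha> (P n)) i = 0" if "n \<le> i" for i
    using that Suc.prems[of i] nz degree_legendre[of n] coeff_eq_0[of "P n" i]
    by (cases "i = n") (auto simp: \<alpha>_def)
  from Suc.IH[OF this] obtain a where "p - smult \<alpha> (P n) = (\<Sum>j<n. smult (a j) (P j))" by blast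
  then have "p = (\<Sum>j<Suc n. smult ((a(n := \<alpha>)) j) (P j))" by (simp add: algebra_simps)
  then show ?case by blast
qed

lemma legendre_coefficient:
  assumes "p = (\<Sum>j<n. smult (a j) (P j))"
  shows "integral {0..1} (poly (p * P i)) = (if i < n then a i else 0)"
proof -
  have "integral {0..1} (poly (p * P i)) = integral {0..1} (\<lambda>x. \<Sum>j<n. a j * poly (P j * P i) x)"
    unfolding assms by (intro integral_cong) (simp add: poly_sum sum_distrib_left sum_distrib_right mult_ac)
  also have "\<dots> = (\<Sum>j<n. integral {0..1} (\<lambda>x. a j * poly (P j * P i) x))"
    by (intro integral_sum integrable_on_mult_right poly_integrable) auto
  also have "\<dots> = (\<Sum>j<n. a j * (if j = i then 1 else 0))" by (simp only: integral_mult_right legendre_inner)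
  also have "\<dots> = (if i < n then a i else 0)" by (simp add: if_distrib cong: if_cong)
  finally show ?thesis .
qed

text \<open>
  The coefficients of the method: Fourier coefficients in the Legendre basis whose integrals are
  replaced by the quadrature formula.
\<close>

definition disc_coeff :: "(real \<Rightarrow> 'v::real_vector) \<Rightarrow> nat \<Rightarrow> 'v" where
  "disc_coeff g j = (\<Sum>i=1..k. (b i * poly (P j) (c i)) *\<^sub>R g (c i))"

definition disc_proj :: "(real \<Rightarrow> 'v::real_vector) \<Rightarrow> real \<Rightarrow> 'v" where
  "disc_proj g \<tau> = (\<Sum>j<s. poly (P j) \<tau> *\<^sub>R disc_coeff g j)"

lemma disc_coeff_add: "disc_coeff (\<lambda>x. g x + h x) j = disc_coeff g j + disc_coeff h j"
  by (simp add: disc_coeff_def scaleR_add_right sum.distrib)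

lemma disc_coeff_sum: "disc_coeff (\<lambda>x. \<Sum>i\<in>I. g i x) j = (\<Sum>i\<in>I. disc_coeff (g i) j)"
  unfolding disc_coeff_def scaleR_sum_right by (rule sum.swap)

lemma disc_coeff_scale: "disc_coeff (\<lambda>x. g x *\<^sub>R a) j = disc_coeff g j *\<^sub>R a"
  by (simp add: disc_coeff_def scaleR_sum_left)

lemma disc_proj_add: "disc_proj (\<lambda>x. g x + h x) \<tau> = disc_proj g \<tau> + disc_proj h \<tau>"
  by (simp add: disc_proj_def disc_coeff_add scaleR_add_right sum.distrib)

lemma disc_proj_sum: "disc_proj (\<lambda>x. \<Sum>i\<in>I. g i x) \<tau> = (\<Sum>i\<in>I. disc_proj (g i) \<tau>)"
  unfolding disc_proj_def disc_coeff_sum scaleR_sum_right by (rule sum.swap)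

lemma disc_proj_scale: "disc_proj (\<lambda>x. g x *\<^sub>R a) \<tau> = disc_proj g \<tau> *\<^sub>R a"
  by (simp add: disc_proj_def disc_coeff_scale scaleR_sum_left)

lemma disc_proj_inner: "disc_proj g \<tau> \<bullet> e = disc_proj (\<lambda>x. g x \<bullet> e) \<tau>"
  by (simp add: disc_proj_def disc_coeff_def inner_sum_left)

definition coeff_bound :: "nat \<Rightarrow> real" where
  "coeff_bound j = (\<Sum>i=1..k. \<bar>b i\<bar> * poly_size (P j))"

definition proj_bound :: real where
  "proj_bound = (\<Sum>j<s. poly_size (P j) * coeff_bound j)"

lemma coeff_bound_nonneg: "0 \<le> coeff_bound j"
  by (auto simp: coeff_bound_def poly_size_nonneg intro!: sum_nonneg)

lemma proj_bound_nonneg: "0 \<le> proj_bound"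
  by (auto simp: proj_bound_def poly_size_nonneg coeff_bound_nonneg intro!: sum_nonneg)

lemma norm_disc_coeff_le:
  fixes g :: "real \<Rightarrow> 'v::real_normed_vector"
  assumes "\<And>i. i \<in> {1..k} \<Longrightarrow> norm (g (c i)) \<le> B"
  shows "norm (disc_coeff g j) \<le> coeff_bound j * B"
  unfolding disc_coeff_def coeff_bound_def sum_distrib_right
proof (rule order_trans[OF norm_sum], rule sum_mono)
  fix i assume i: "i \<in> {1..k}"
  have "0 \<le> B" using assms[OF i] norm_ge_zero order_trans by blast
  then show "norm ((b i * poly (P j) (c i)) *\<^sub>R g (c i)) \<le> \<bar>b i\<bar> * poly_size (P j) * B"
    using assms[OF i] abs_poly_le_poly_size[OF nodes[OF i], of "P j"]
    by (auto simp: abs_mult intro!: mult_mono poly_size_nonneg)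
qed

lemma norm_disc_proj_le:
  fixes g :: "real \<Rightarrow> 'v::real_normed_vector"
  assumes "\<And>i. i \<in> {1..k} \<Longrightarrow> norm (g (c i)) \<le> B" "\<tau> \<in> {0..1}"
  shows "norm (disc_proj g \<tau>) \<le> proj_bound * B"
  unfolding disc_proj_def proj_bound_def sum_distrib_right
proof (rule order_trans[OF norm_sum], rule sum_mono)
  fix j
  show "norm (poly (P j) \<tau> *\<^sub>R disc_coeff g j) \<le> poly_size (P j) * coeff_bound j * B"
    using norm_disc_coeff_le[of g B j] assms abs_poly_le_poly_size[OF assms(2), of "P j"]
    by (auto simp: mult.assoc intro!: mult_mono poly_size_nonneg)
qed

lemma disc_coeff_cong: "(\<And>\<tau>. \<tau> \<in> {0..1} \<Longrightarrow> g \<tau> = g' \<tau>) \<Longrightarrow> disc_coeff g j = disc_coeff g' j"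
  using nodes by (auto simp: disc_coeff_def intro!: sum.cong)

lemma disc_proj_cong: "(\<And>\<tau>. \<tau> \<in> {0..1} \<Longrightarrow> g \<tau> = g' \<tau>) \<Longrightarrow> disc_proj g \<sigma> = disc_proj g' \<sigma>"
  using disc_coeff_cong[of g g'] by (simp add: disc_proj_def)

lemma disc_coeff_poly:
  assumes "degree p + j < 2 * s"
  shows "disc_coeff (poly p) j = integral {0..1} (poly (p * P j))"
proof -
  have "degree (p * P j) < 2 * s" using degree_mult_le[of p "P j"] assms degree_legendre[of j] by simp
  then have "(\<Sum>i=1..k. b i * poly (p * P j) (c i)) = integral {0..1} (poly (p * P j))"
    using exact unfolding quadrature_order_def by blast
  then show ?thesis by (simp add: disc_coeff_def mult_ac del: One_nat_def)
qed

text \<open>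
  The quadrature is exact for this product, and \<open>P j\<close> is orthogonal to lower degrees. Hence
  the \<open>j\<close>-th coefficient of a function only sees its Taylor remainder of order \<open>j\<close>.
\<close>

lemma disc_coeff_power_eq_0:
  assumes "d < j" "j < s"
  shows "disc_coeff (\<lambda>x. x ^ d) j = 0"
proof -
  have "\<exists>a. monom (1::real) d = (\<Sum>i<j. smult (a i) (P i))" using assms by (intro legendre_span) auto
  then obtain a where "monom 1 d = (\<Sum>i<j. smult (a i) (P i))" ..
  from legendre_coefficient[OF this, of j]
  have "integral {0..1} (poly (monom 1 d * P j)) = 0" by simp
  moreover have "degree (monom (1::real) d) + j < 2 * s" using assms by (simp add: degree_monom_eq)
  ultimately show ?thesis using disc_coeff_poly[of "monom 1 d" j]
    by (simp add: poly_monom[abs_def])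
qed

text \<open>
  The discrete coefficients of a polynomial of degree below \<open>s\<close> are its true Legendre
  coefficients.
\<close>

lemma disc_proj_power:
  assumes "d < s"
  shows "disc_proj (\<lambda>x. x ^ d) \<tau> = \<tau> ^ d"
proof -
  have "\<exists>a. monom (1::real) d = (\<Sum>i<s. smult (a i) (P i))" using assms by (intro legendre_span) auto
  then obtain a where a: "monom 1 d = (\<Sum>i<s. smult (a i) (P i))" ..
  have "disc_coeff (poly (monom 1 d)) j = a j" if "j < s" for j
    using legendre_coefficient[OF a, of j] disc_coeff_poly[of "monom 1 d" j] that assms
    by (simp add: degree_monom_eq)
  then have "disc_proj (poly (monom 1 d)) \<tau> = (\<Sum>j<s. poly (P j) \<tau> * a j)"
    unfolding disc_proj_def by (intro sum.cong) auto
  also have "\<dots> = poly (monom 1 d) \<tau>" by (subst a) (simp add: poly_sum mult.commute)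
  finally show ?thesis by (simp add: poly_monom[abs_def])
qed

lemma disc_proj_has_integral:
  "((\<lambda>\<tau>. disc_proj g \<tau> * \<tau> ^ e) has_integral (\<Sum>j<s. integral {0..1} (poly (monom 1 e * P j)) * disc_coeff g j)) {0..1}"
  for g :: "real \<Rightarrow> real"
proof -
  have "((\<lambda>\<tau>. \<Sum>j<s. poly (monom 1 e * P j) \<tau> * disc_coeff g j) has_integral
      (\<Sum>j<s. integral {0..1} (poly (monom 1 e * P j)) * disc_coeff g j)) {0..1}"
    by (intro has_integral_sum has_integral_mult_left integrable_integral poly_integrable) auto
  moreover have "(\<lambda>\<tau>. disc_proj g \<tau> * \<tau> ^ e) = (\<lambda>\<tau>. \<Sum>j<s. poly (monom 1 e * P j) \<tau> * disc_coeff g j)"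
    by (simp add: disc_proj_def fun_eq_iff sum_distrib_left sum_distrib_right poly_monom mult_ac)
  ultimately show ?thesis by metis
qed

text \<open>
  Galerkin orthogonality reaches up to total degree \<open>2 * s - 1\<close>, although the projection reproduces
  polynomials only up to degree \<open>s - 1\<close>. If \<open>d < s\<close> the residual is zero; otherwise \<open>e < s\<close>, and the quadrature formula
  evaluates both integrals to that of \<open>\<tau> ^ (d + e)\<close>.
\<close>

lemma disc_proj_moment_power:
  assumes "d + e < 2 * s"
  shows "integral {0..1} (\<lambda>\<tau>. (\<tau> ^ d - disc_proj (\<lambda>x. x ^ d) \<tau>) * \<tau> ^ e) = 0"
proof (cases "d < s")
  case True then show ?thesis by (simp add: disc_proj_power)
next
  case False
  then have e: "e < s" using assms by simp
  then have "\<exists>a. monom (1::real) e = (\<Sum>i<s. smult (a i) (P i))" by (intro legendre_span) auto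
  then obtain a where a: "monom 1 e = (\<Sum>i<s. smult (a i) (P i))" ..
  \<comment> \<open>Now the test monomial lies in the span of the basis, so that integrating the projection
    against it gives back the quadrature sum of the product, of degree below 2s.\<close>
  have "integral {0..1} (\<lambda>\<tau>. disc_proj (\<lambda>x. x ^ d) \<tau> * \<tau> ^ e)
      = (\<Sum>j<s. integral {0..1} (poly (monom 1 e * P j)) * disc_coeff (\<lambda>x. x ^ d) j)"
    using disc_proj_has_integral by (rule integral_unique)
  also have "\<dots> = (\<Sum>j<s. a j * disc_coeff (\<lambda>x. x ^ d) j)"
    by (intro sum.cong) (auto simp: legendre_coefficient[OF a])
  also have "\<dots> = (\<Sum>j<s. \<Sum>i=1..k. b i * (c i ^ d * (a j * poly (P j) (c i))))"
    by (simp add: disc_coeff_def sum_distrib_left mult_ac)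
  also have "\<dots> = (\<Sum>i=1..k. b i * (c i ^ d * (\<Sum>j<s. a j * poly (P j) (c i))))"
    by (subst sum.swap) (simp add: sum_distrib_left)
  also have "\<dots> = (\<Sum>i=1..k. b i * poly (monom 1 (d + e)) (c i))"
  proof -
    have "(\<Sum>j<s. a j * poly (P j) x) = x ^ e" for x
      using arg_cong[OF a, of "\<lambda>p. poly p x"] by (simp add: poly_sum poly_monom)
    then show ?thesis by (simp add: poly_monom power_add)
  qed
  also have "\<dots> = integral {0..1} (poly (monom 1 (d + e)))"
    using exact assms by (simp add: quadrature_order_def degree_monom_eq)
  finally have *: "integral {0..1} (\<lambda>\<tau>. disc_proj (\<lambda>x. x ^ d) \<tau> * \<tau> ^ e) = integral {0..1} (poly (monom 1 (d + e)))" .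
  have "(\<lambda>\<tau>. (\<tau> ^ d - disc_proj (\<lambda>x. x ^ d) \<tau>) * \<tau> ^ e)
      = (\<lambda>\<tau>. poly (monom 1 (d + e)) \<tau> - disc_proj (\<lambda>x. x ^ d) \<tau> * \<tau> ^ e)"
    by (simp add: fun_eq_iff algebra_simps poly_monom power_add)
  then show ?thesis
    using * integral_diff[OF poly_integrable has_integral_integrable[OF disc_proj_has_integral]] by simp
qed

lemma norm_disc_coeff_jet:
  fixes g :: "real \<Rightarrow> 'v::real_normed_vector"
  assumes "\<And>\<tau>. \<tau> \<in> {0..1} \<Longrightarrow> norm (g \<tau> - (\<Sum>d<N. \<tau> ^ d *\<^sub>R a d)) \<le> B" "N \<le> j" "j < s"
  shows "norm (disc_coeff g j) \<le> coeff_bound j * B"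
proof -
  define r where "r = (\<lambda>\<tau>. g \<tau> - (\<Sum>d<N. \<tau> ^ d *\<^sub>R a d))"
  have "disc_coeff g j = disc_coeff (\<lambda>\<tau>. r \<tau> + (\<Sum>d<N. \<tau> ^ d *\<^sub>R a d)) j" by (simp add: r_def)
  also have "\<dots> = disc_coeff r j"
    using assms by (simp add: disc_coeff_add disc_coeff_sum disc_coeff_scale disc_coeff_power_eq_0)
  finally have "disc_coeff g j = disc_coeff r j" .
  then show ?thesis using norm_disc_coeff_le[of r B j] assms(1) nodes by (auto simp: r_def)
qed

lemma norm_residual_jet:
  fixes g :: "real \<Rightarrow> 'v::real_normed_vector"
  assumes "\<And>\<tau>. \<tau> \<in> {0..1} \<Longrightarrow> norm (g \<tau> - (\<Sum>d<s. \<tau> ^ d *\<^sub>R a d)) \<le> B" "\<tau> \<in> {0..1}"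
  shows "norm (g \<tau> - disc_proj g \<tau>) \<le> (1 + proj_bound) * B"
proof -
  define r where "r = (\<lambda>\<tau>. g \<tau> - (\<Sum>d<s. \<tau> ^ d *\<^sub>R a d))"
  have "disc_proj g \<tau> = disc_proj (\<lambda>\<tau>. r \<tau> + (\<Sum>d<s. \<tau> ^ d *\<^sub>R a d)) \<tau>" by (simp add: r_def)
  also have "\<dots> = disc_proj r \<tau> + (\<Sum>d<s. \<tau> ^ d *\<^sub>R a d)"
    by (simp add: disc_proj_add disc_proj_sum disc_proj_scale disc_proj_power)
  finally have "g \<tau> - disc_proj g \<tau> = r \<tau> - disc_proj r \<tau>" by (simp add: r_def)
  moreover have "norm (r \<tau>) \<le> B" using assms by (simp add: r_def)
  moreover have "norm (disc_proj r \<tau>) \<le> proj_bound * B"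
    using assms nodes by (intro norm_disc_proj_le) (auto simp: r_def)
  ultimately have "norm (g \<tau> - disc_proj g \<tau>) \<le> B + proj_bound * B"
    using norm_triangle_ineq4[of "r \<tau>" "disc_proj r \<tau>"] by (smt (verit))
  then show ?thesis by (simp add: distrib_right)
qed

lemma disc_proj_continuous: "continuous_on S (disc_proj g)" for g :: "real \<Rightarrow> 'v::real_normed_vector"
  unfolding disc_proj_def by (intro continuous_intros)

text \<open>
  Superconvergence originates here: the residual of a function with a rescaled jet is only of
  size \<open>\<eta> ^ s\<close>, yet its integral against any other such function is of size \<open>\<eta> ^ (2 * s)\<close>.
\<close>

lemma residual_moment_le:
  assumes M: "0 \<le> M" and \<eta>: "0 \<le> \<eta>" "\<eta> \<le> 1"
    and a: "\<And>d. \<bar>a d\<bar> \<le> M" and \<alpha>: "\<And>d. \<bar>\<alpha> d\<bar> \<le> M"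
    and g: "\<And>\<tau>. \<tau> \<in> {0..1} \<Longrightarrow> \<bar>g \<tau> - (\<Sum>d<2 * s. (\<eta> * \<tau>) ^ d * a d)\<bar> \<le> M * \<eta> ^ (2 * s)"
    and \<phi>: "\<And>\<tau>. \<tau> \<in> {0..1} \<Longrightarrow> \<bar>\<phi> \<tau> - (\<Sum>d<2 * s. (\<eta> * \<tau>) ^ d * \<alpha> d)\<bar> \<le> M * \<eta> ^ (2 * s)"
    and cont: "continuous_on {0..1} g" "continuous_on {0..1} \<phi>"
  shows "\<bar>integral {0..1} (\<lambda>\<tau>. (g \<tau> - disc_proj g \<tau>) * \<phi> \<tau>)\<bar>
    \<le> (1 + proj_bound) * (2 * real s + 1)\<^sup>2 * M\<^sup>2 * \<eta> ^ (2 * s)"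
proof -
  define p where "p = (\<lambda>\<tau>. \<Sum>d<2 * s. (\<eta> * \<tau>) ^ d * a d)"
  define \<pi> where "\<pi> = (\<lambda>\<tau>. \<Sum>d<2 * s. (\<eta> * \<tau>) ^ d * \<alpha> d)"
  define E where "E = (\<lambda>(g::real\<Rightarrow>real) \<tau>. g \<tau> - disc_proj g \<tau>)"
  define r where "r = (\<lambda>\<tau>. g \<tau> - p \<tau>)"
  define \<rho> where "\<rho> = (\<lambda>\<tau>. \<phi> \<tau> - \<pi> \<tau>)"
  define W where "W = M * \<eta> ^ (2 * s)"
  define \<kappa> where "\<kappa> = 1 + proj_bound"
  have \<kappa>: "0 \<le> \<kappa>" using proj_bound_nonneg by (simp add: \<kappa>_def)
  have W: "0 \<le> W" "W \<le> M" using M \<eta> by (auto simp: W_def intro!: mult_left_le power_le_one)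
  have E_bound: "\<bar>E f \<tau>\<bar> \<le> \<kappa> * B" if "\<And>\<tau>. \<tau> \<in> {0..1} \<Longrightarrow> \<bar>f \<tau>\<bar> \<le> B" "\<tau> \<in> {0..1}" for f \<tau> B
  proof -
    have "norm (disc_proj f \<tau>) \<le> proj_bound * B" using that nodes by (intro norm_disc_proj_le) auto
    then show ?thesis using that(1)[OF that(2)] unfolding E_def \<kappa>_def by (simp add: algebra_simps abs_if split: if_splits)
  qed
  have Eg: "E g \<tau> = E p \<tau> + E r \<tau>" for \<tau>
    using disc_proj_add[of r p \<tau>] by (simp add: E_def r_def)
  have jet: "\<bar>\<Sum>d<2 * s. (\<eta> * \<tau>) ^ d * f d\<bar> \<le> 2 * real s * M" if f: "\<And>d. \<bar>f d\<bar> \<le> M" and \<tau>: "\<tau> \<in> {0..1}" for f \<tau>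
  proof -
    have "\<bar>(\<eta> * \<tau>) ^ d * f d\<bar> \<le> M" for d
    proof -
      have "(\<eta> * \<tau>) ^ d \<le> 1" using \<eta> \<tau> by (intro power_le_one mult_le_one) auto
      then have "\<bar>(\<eta> * \<tau>) ^ d\<bar> * \<bar>f d\<bar> \<le> 1 * M" using \<eta> \<tau> f by (intro mult_mono) auto
      then show ?thesis by (simp add: abs_mult)
    qed
    then have "(\<Sum>d<2 * s. \<bar>(\<eta> * \<tau>) ^ d * f d\<bar>) \<le> (\<Sum>d<2 * s. M)" by (intro sum_mono)
    then have "(\<Sum>d<2 * s. \<bar>(\<eta> * \<tau>) ^ d * f d\<bar>) \<le> 2 * real s * M" by simp
    then show ?thesis using sum_abs[of "\<lambda>d. (\<eta> * \<tau>) ^ d * f d" "{..<2 * s}"] by (rule order_trans[rotated])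
  qed
  have contp: "continuous_on {0..1} p" "continuous_on {0..1} \<pi>" unfolding p_def \<pi>_def by (intro continuous_intros)+
  have contE: "continuous_on {0..1} (E f)" if "continuous_on {0..1} f" for f
    unfolding E_def using that disc_proj_continuous[of _ f] by (intro continuous_intros) auto
  have contr: "continuous_on {0..1} r" "continuous_on {0..1} \<rho>" unfolding r_def \<rho>_def
    using cont contp by (auto intro!: continuous_intros)
  \<comment> \<open>Splitting g = p + r and \<phi> = \<pi> + \<rho> into jets and remainders, everything except the
    pairing of the two jets contains a remainder and is small.\<close>
  have 1: "\<bar>integral {0..1} (\<lambda>\<tau>. E p \<tau> * \<rho> \<tau> + E r \<tau> * \<phi> \<tau>)\<bar> \<le> (\<kappa> * (2 * real s * M) * W + \<kappa> * W * (2 * real s * M + W)) * (1 - 0)"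
    unfolding real_norm_def[symmetric]
  proof (rule integral_bound)
    fix \<tau> :: real assume \<tau>: "\<tau> \<in> {0..1}"
    have "\<bar>E p \<tau>\<bar> * \<bar>\<rho> \<tau>\<bar> \<le> (\<kappa> * (2 * real s * M)) * W"
      using \<tau> \<kappa> M \<phi>[OF \<tau>] jet[of a] a by (intro mult_mono E_bound) (auto simp: p_def \<rho>_def \<pi>_def W_def)
    moreover have "\<bar>E r \<tau>\<bar> * \<bar>\<phi> \<tau>\<bar> \<le> (\<kappa> * W) * (2 * real s * M + W)"
    proof (intro mult_mono E_bound)
      have "\<bar>\<pi> \<tau>\<bar> \<le> 2 * real s * M" using jet[of \<alpha>] \<alpha> \<tau> by (simp add: \<pi>_def)
      then show "\<bar>\<phi> \<tau>\<bar> \<le> 2 * real s * M + W" using \<phi>[OF \<tau>] unfolding \<pi>_def W_def by linarith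
    qed (use g \<tau> \<kappa> W in \<open>auto simp: r_def p_def W_def\<close>)
    ultimately show "norm (E p \<tau> * \<rho> \<tau> + E r \<tau> * \<phi> \<tau>) \<le> \<kappa> * (2 * real s * M) * W + \<kappa> * W * (2 * real s * M + W)"
      unfolding real_norm_def using abs_triangle_ineq[of "E p \<tau> * \<rho> \<tau>" "E r \<tau> * \<phi> \<tau>"] by (simp add: abs_mult)
  qed (use contE contp contr cont in \<open>auto intro!: continuous_intros\<close>)
  have Ep: "E p \<tau> * \<pi> \<tau> = (\<Sum>d<2 * s. \<Sum>e<2 * s. \<eta> ^ (d + e) * a d * \<alpha> e * (E (\<lambda>x. x ^ d) \<tau> * \<tau> ^ e))" for \<tau>
  proof -
    have "disc_proj p \<tau> = (\<Sum>d<2 * s. disc_proj (\<lambda>x. x ^ d) \<tau> * (\<eta> ^ d * a d))"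
      unfolding p_def disc_proj_sum using disc_proj_scale[of "\<lambda>x. x ^ d" "\<eta> ^ d * a d" \<tau> for d]
      by (intro sum.cong) (simp_all add: power_mult_distrib mult_ac)
    then have "E p \<tau> = (\<Sum>d<2 * s. \<eta> ^ d * a d * E (\<lambda>x. x ^ d) \<tau>)"
      by (simp add: E_def p_def sum_subtractf[symmetric] power_mult_distrib algebra_simps)
    then show ?thesis unfolding \<pi>_def
      by (simp only: sum_product) (intro sum.cong refl, simp add: power_add power_mult_distrib)
  qed
  have int: "(\<lambda>\<tau>. E (\<lambda>x. x ^ d) \<tau> * \<tau> ^ e) integrable_on {0..1}" for d e
    by (intro integrable_continuous_real continuous_intros contE)
  \<comment> \<open>In the pairing of the jets the terms with d + e < 2s vanish; all others carry the
    power \<eta> ^ (d + e).\<close>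
  have 2: "\<bar>integral {0..1} (\<lambda>\<tau>. E p \<tau> * \<pi> \<tau>)\<bar> \<le> (2 * real s) * (2 * real s) * (\<kappa> * (M * W))"
  proof -
    have "integral {0..1} (\<lambda>\<tau>. E p \<tau> * \<pi> \<tau>) =
      (\<Sum>d<2 * s. \<Sum>e<2 * s. \<eta> ^ (d + e) * a d * \<alpha> e * integral {0..1} (\<lambda>\<tau>. E (\<lambda>x. x ^ d) \<tau> * \<tau> ^ e))"
      unfolding Ep
      by (subst integral_sum integral_mult_right | intro integrable_sum integrable_on_mult_right int finite_lessThan | simp)+
    also have "\<bar>\<dots>\<bar> \<le> (\<Sum>d<2 * s. \<Sum>e<2 * s. \<kappa> * (M * W))"
    proof (rule order_trans[OF sum_abs], rule sum_mono, rule order_trans[OF sum_abs], rule sum_mono)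
      fix d e :: nat
      show "\<bar>\<eta> ^ (d + e) * a d * \<alpha> e * integral {0..1} (\<lambda>\<tau>. E (\<lambda>x. x ^ d) \<tau> * \<tau> ^ e)\<bar> \<le> \<kappa> * (M * W)"
      proof (cases "d + e < 2 * s")
        case True
        then show ?thesis using disc_proj_moment_power[of d e] \<kappa> M W by (simp add: E_def)
      next
        case False
        have "norm (integral {0..1} (\<lambda>\<tau>. E (\<lambda>x. x ^ d) \<tau> * \<tau> ^ e)) \<le> \<kappa> * (1 - 0)"
        proof (rule integral_bound)
          fix \<tau> :: real assume \<tau>: "\<tau> \<in> {0..1}"
          have "\<bar>E (\<lambda>x. x ^ d) \<tau>\<bar> * \<bar>\<tau> ^ e\<bar> \<le> (\<kappa> * 1) * 1"
            using \<tau> \<kappa> by (intro mult_mono E_bound) (auto simp: power_le_one)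
          then show "norm (E (\<lambda>x. x ^ d) \<tau> * \<tau> ^ e) \<le> \<kappa>" by (simp add: abs_mult)
        qed (auto intro!: continuous_intros contE)
        moreover have "\<eta> ^ (d + e) \<le> \<eta> ^ (2 * s)" using False \<eta> by (intro power_decreasing) auto
        ultimately have "\<eta> ^ (d + e) * \<bar>a d\<bar> * \<bar>\<alpha> e\<bar> * \<bar>integral {0..1} (\<lambda>\<tau>. E (\<lambda>x. x ^ d) \<tau> * \<tau> ^ e)\<bar>
          \<le> \<eta> ^ (2 * s) * M * M * \<kappa>"
          using a \<alpha> \<eta> M \<kappa> by (intro mult_mono) auto
        then show ?thesis using \<eta> by (simp add: abs_mult W_def mult_ac)
      qed
    qed
    also have "\<dots> = (2 * real s) * (2 * real s) * (\<kappa> * (M * W))" by simp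
    finally show ?thesis .
  qed
  have "integral {0..1} (\<lambda>\<tau>. (g \<tau> - disc_proj g \<tau>) * \<phi> \<tau>)
      = integral {0..1} (\<lambda>\<tau>. E p \<tau> * \<pi> \<tau> + (E p \<tau> * \<rho> \<tau> + E r \<tau> * \<phi> \<tau>))"
  proof (rule integral_cong)
    fix \<tau> show "(g \<tau> - disc_proj g \<tau>) * \<phi> \<tau> = E p \<tau> * \<pi> \<tau> + (E p \<tau> * \<rho> \<tau> + E r \<tau> * \<phi> \<tau>)"
    proof -
      have E': "g \<tau> - disc_proj g \<tau> = E p \<tau> + E r \<tau>" using Eg[of \<tau>] by (simp add: E_def)
      show ?thesis unfolding E' \<rho>_def by (simp add: algebra_simps)
    qed
  qed
  also have "\<dots> = integral {0..1} (\<lambda>\<tau>. E p \<tau> * \<pi> \<tau>) + integral {0..1} (\<lambda>\<tau>. E p \<tau> * \<rho> \<tau> + E r \<tau> * \<phi> \<tau>)"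
    using contE contp contr cont by (intro integral_add integrable_continuous_real continuous_intros) auto
  also have "\<bar>\<dots>\<bar> \<le> (2 * real s) * (2 * real s) * (\<kappa> * (M * W))
      + (\<kappa> * (2 * real s * M) * W + \<kappa> * W * (2 * real s * M + W)) * (1 - 0)"
    by (rule order_trans[OF abs_triangle_ineq add_mono[OF 2 1]])
  also have "\<dots> = (2 * real s) * (2 * real s) * (\<kappa> * (M * W))
      + (\<kappa> * (2 * real s * M) * W + \<kappa> * W * (2 * real s * M + W))" by simp
  also have "\<dots> \<le> (2 * real s) * (2 * real s) * (\<kappa> * (M * W)) + (\<kappa> * (2 * real s * M) * W + \<kappa> * W * (2 * real s * M + M))"
    using W \<kappa> by (intro add_left_mono mult_left_mono) auto
  also have "\<dots> = \<kappa> * (2 * real s + 1)\<^sup>2 * M * W" by (simp add: algebra_simps power2_eq_square)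
  also have "\<dots> = (1 + proj_bound) * (2 * real s + 1)\<^sup>2 * M\<^sup>2 * \<eta> ^ (2 * s)"
    by (simp add: \<kappa>_def W_def power2_eq_square mult_ac)
  finally show ?thesis .
qed

end

section \<open>Regularity of the approximation within a step\<close>

text \<open>
  Each differentiation of the rescaled polynomial costs a factor \<open>1 / h\<close>, and there are at most \<open>j\<close>
  nonzero derivatives; this is compensated by the smallness of the coefficient.
\<close>

lemma bounded_derivs_scaled_poly:
  assumes "degree p \<le> j"
  shows "\<exists>B\<ge>0. \<forall>a h (\<gamma>::'v::real_normed_vector) C. 0 < h \<and> h \<le> 1 \<and> norm \<gamma> \<le> C * h ^ min j N \<longrightarrow>
    bounded_derivs N (B * C) {a..a+h} (\<lambda>t. poly p ((t - a) / h) *\<^sub>R \<gamma>)"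
  using assms
proof (induction N arbitrary: p j)
  have bnd: "norm (poly p ((t - a) / h) *\<^sub>R \<gamma>) \<le> poly_size p * C"
    if "0 < h" "h \<le> 1" "norm \<gamma> \<le> C * h ^ n" "t \<in> {a..a+h}" for a h C n t and \<gamma> :: 'v and p
  proof -
    have "0 \<le> C" using that norm_ge_zero[of \<gamma>] by (metis order_trans zero_le_mult_iff zero_less_power not_le)
    then have "C * h ^ n \<le> C" using that by (intro mult_left_le power_le_one) auto
    then have "norm \<gamma> \<le> C" using that by linarith
    moreover have "\<bar>poly p ((t - a) / h)\<bar> \<le> poly_size p" using that by (intro abs_poly_le_poly_size) auto
    ultimately show ?thesis by (auto intro!: mult_mono poly_size_nonneg)
  qed
  {
    case 0
    show ?case
      using bnd[where n = 0] by (intro exI[of _ "poly_size p"] conjI allI impI) (simp_all add: poly_size_nonneg del: norm_scaleR)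
  next
    case (Suc N)
    have "degree (pderiv p) \<le> j - 1" using Suc.prems by (simp add: degree_pderiv)
    from Suc.IH[OF this] obtain B where B: "B \<ge> 0" and
      IH: "\<And>a h (\<gamma>::'v) C. 0 < h \<Longrightarrow> h \<le> 1 \<Longrightarrow> norm \<gamma> \<le> C * h ^ min (j - 1) N \<Longrightarrow>
        bounded_derivs N (B * C) {a..a+h} (\<lambda>t. poly (pderiv p) ((t - a) / h) *\<^sub>R \<gamma>)" by blast
    have "bounded_derivs (Suc N) ((poly_size p + B) * C) {a..a+h} (\<lambda>t. poly p ((t - a) / h) *\<^sub>R \<gamma>)"
      if h: "0 < h" "h \<le> 1" and \<gamma>: "norm \<gamma> \<le> C * h ^ min j (Suc N)" for a h C and \<gamma> :: 'v
    proof -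
      have C: "0 \<le> C" using h \<gamma> norm_ge_zero[of \<gamma>] by (metis order_trans zero_le_mult_iff zero_less_power not_le)
      have "bounded_derivs N (B * C) {a..a+h} (\<lambda>t. poly (pderiv p) ((t - a) / h) *\<^sub>R ((1 / h) *\<^sub>R \<gamma>))"
      proof (cases j)
        case 0
        then have "pderiv p = 0" using Suc.prems by (simp add: pderiv_eq_0_iff)
        then show ?thesis using B C by (auto intro!: bounded_derivs_const)
      next
        case (Suc j')
        have "norm \<gamma> \<le> (C * h ^ min (j - 1) N) * h" using \<gamma> Suc by (simp add: mult_ac)
        then have "norm ((1 / h) *\<^sub>R \<gamma>) \<le> C * h ^ min (j - 1) N" using h by (simp add: pos_divide_le_eq)
        then show ?thesis using IH h by blast
      qed
      then have "bounded_derivs N ((poly_size p + B) * C) {a..a+h} (\<lambda>t. poly (pderiv p) ((t - a) / h) *\<^sub>R ((1 / h) *\<^sub>R \<gamma>))"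
        by (rule bounded_derivs_mono) (use C poly_size_nonneg[of p] in \<open>simp add: distrib_right\<close>)
      moreover have "((\<lambda>t. poly p ((t - a) / h) *\<^sub>R \<gamma>) has_vector_derivative
          poly (pderiv p) ((t - a) / h) *\<^sub>R ((1 / h) *\<^sub>R \<gamma>)) (at t within {a..a+h})" for t
      proof -
        have "((\<lambda>t. poly p ((t - a) / h)) has_real_derivative poly (pderiv p) ((t - a) / h) * (1 / h)) (at t within {a..a+h})"
          using h by (intro DERIV_chain2[OF poly_DERIV]) (auto intro!: derivative_eq_intros)
        from has_vector_derivative_scaleR[OF this has_vector_derivative_const, of \<gamma>] show ?thesis by simp
      qed
      moreover have "norm (poly p ((t - a) / h) *\<^sub>R \<gamma>) \<le> (poly_size p + B) * C" if "t \<in> {a..a+h}" for t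
        using bnd[OF h \<gamma> that, of p] B C by (simp add: distrib_right add_increasing2)
      ultimately show ?thesis unfolding bounded_derivs.simps
        by (intro conjI exI[of _ "\<lambda>t. poly (pderiv p) ((t - a) / h) *\<^sub>R ((1 / h) *\<^sub>R \<gamma>)"] ballI)
    qed
    then show ?case using B poly_size_nonneg[of p] 
      by (intro exI[of _ "poly_size p + B"] conjI allI impI) (simp_all del: bounded_derivs.simps)
  }
qed

context legendre_quadrature
begin

text \<open>
  In terms of the discrete projection, the method replaces the field along \<open>u\<close> by its projection.
\<close>

definition hbvm_step :: "('a::euclidean_space \<times> 'a \<Rightarrow> 'a) \<Rightarrow> 'a \<Rightarrow> real \<Rightarrow> real \<Rightarrow> (real \<Rightarrow> 'a) \<Rightarrow> bool" where
  "hbvm_step f w a h u \<longleftrightarrow> (\<forall>\<tau>\<in>{0..1}.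
     (u has_vector_derivative disc_proj (\<lambda>\<sigma>. f (u (a + \<sigma> * h), w)) \<tau>) (at (a + \<tau> * h) within {a..a+h}))"

definition bounded_step :: "('a::euclidean_space \<times> 'a \<Rightarrow> 'a) \<Rightarrow> real \<Rightarrow> 'a \<Rightarrow> real \<Rightarrow> real \<Rightarrow> (real \<Rightarrow> 'a) \<Rightarrow> bool" where
  "bounded_step f \<rho> w a h u \<longleftrightarrow>
     0 < h \<and> h \<le> 1 \<and> norm w \<le> \<rho> \<and> (\<forall>t\<in>{a..a+h}. norm (u t) \<le> \<rho>) \<and> hbvm_step f w a h u"

lemma hbvm_step_derivative:
  assumes "hbvm_step f w a h u" "0 < h" "t \<in> {a..a+h}"
  shows "(u has_vector_derivative disc_proj (\<lambda>\<sigma>. f (u (a + \<sigma> * h), w)) ((t - a) / h)) (at t within {a..a+h})"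
proof -
  have "(t - a) / h \<in> {0..1}" "a + (t - a) / h * h = t" using assms by auto
  with assms(1) show ?thesis unfolding hbvm_step_def by metis
qed

lemma hbvm_step_cong:
  assumes st: "hbvm_step f w a h u" and h: "0 < h"
    and eq: "\<And>t. t \<in> {a..a+h} \<Longrightarrow> u' t = u t" "\<And>t. t \<in> {a..a+h} \<Longrightarrow> f' (u t, w) = f (u t, w)"
  shows "hbvm_step f' w a h u'"
  unfolding hbvm_step_def
proof
  fix \<tau> :: real assume \<tau>: "\<tau> \<in> {0..1}"
  have mem: "a + \<sigma> * h \<in> {a..a+h}" if "\<sigma> \<in> {0..1}" for \<sigma> using unit_interval_scale that h by simp
  have "disc_proj (\<lambda>\<sigma>. f' (u' (a + \<sigma> * h), w)) \<tau> = disc_proj (\<lambda>\<sigma>. f (u (a + \<sigma> * h), w)) \<tau>"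
    by (rule disc_proj_cong) (use eq mem in simp)
  then show "(u' has_vector_derivative disc_proj (\<lambda>\<sigma>. f' (u' (a + \<sigma> * h), w)) \<tau>) (at (a + \<tau> * h) within {a..a+h})"
    using st \<tau> unfolding hbvm_step_def
    by (intro has_vector_derivative_transform[OF mem[OF \<tau>] eq(1)]) auto
qed

text \<open>
  Bootstrapping: if \<open>u\<close> has \<open>N\<close> bounded derivatives, so does the field along \<open>u\<close>; then its \<open>j\<close>-th
  coefficient is of order \<open>h ^ min j N\<close>, which gives \<open>N\<close> bounded derivatives of \<open>u'\<close>. Thus the
  polynomials \<open>u\<close> do not oscillate within a step as \<open>h\<close> shrinks.
\<close>

lemma step_regularity:
  assumes f: "C_infinity f" and \<rho>: "0 \<le> \<rho>"
  shows "\<exists>M\<ge>0. \<forall>a h u w. bounded_step f \<rho> w a h u \<longrightarrow> bounded_derivs N M {a..a+h} u"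
proof (induction N)
  case 0
  then show ?case using \<rho> by (intro exI[of _ \<rho>]) (auto simp: bounded_step_def)
next
  case (Suc N)
  then obtain M where M: "M \<ge> 0" "\<And>a h u w. bounded_step f \<rho> w a h u \<Longrightarrow> bounded_derivs N M {a..a+h} u" by blast
  have "C_diff N f" using f by (simp add: C_infinity_def)
  from bounded_derivs_compose[OF this, of "2 * (M + \<rho>)"] obtain M' where M': "M' \<ge> 0"
    "\<And>S x. bounded_derivs N (2 * (M + \<rho>)) S x \<Longrightarrow> bounded_derivs N M' S (\<lambda>t. f (x t))"
    using M \<rho> by auto
  have "\<forall>j. \<exists>B\<ge>0. \<forall>a h (\<gamma>::'a) C. 0 < h \<and> h \<le> 1 \<and> norm \<gamma> \<le> C * h ^ min j N \<longrightarrow>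
      bounded_derivs N (B * C) {a..a+h} (\<lambda>t. poly (P j) ((t - a) / h) *\<^sub>R \<gamma>)"
    using bounded_derivs_scaled_poly degree_legendre by (metis le_refl)
  then obtain B where B: "\<And>j. B j \<ge> 0" "\<And>j a h (\<gamma>::'a) C. 0 < h \<Longrightarrow> h \<le> 1 \<Longrightarrow> norm \<gamma> \<le> C * h ^ min j N \<Longrightarrow>
      bounded_derivs N (B j * C) {a..a+h} (\<lambda>t. poly (P j) ((t - a) / h) *\<^sub>R \<gamma>)" by metis
  define M2 where "M2 = (\<Sum>j<s. B j * (coeff_bound j * M'))"
  have M2: "0 \<le> M2" using B M' coeff_bound_nonneg by (auto simp: M2_def intro!: sum_nonneg)
  have main: "bounded_derivs (Suc N) (M2 + \<rho>) {a..a+h} u" if st: "bounded_step f \<rho> w a h u" for a h u w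
  proof -
    have h: "0 < h" "h \<le> 1" and w: "norm w \<le> \<rho>" and u: "\<And>t. t \<in> {a..a+h} \<Longrightarrow> norm (u t) \<le> \<rho>"
      and eq: "hbvm_step f w a h u" using st by (auto simp: bounded_step_def)
    define g where "g = (\<lambda>\<sigma>. f (u (a + \<sigma> * h), w))"
    have "bounded_derivs N (M + \<rho>) {a..a+h} u" by (rule bounded_derivs_mono[OF M(2)[OF st]]) (use \<rho> in simp)
    then have "bounded_derivs N (2 * (M + \<rho>)) {a..a+h} (\<lambda>t. (u t, w))"
      using w M by (intro bounded_derivs_Pair_const) auto
    then have G: "bounded_derivs N M' {a..a+h} (\<lambda>t. f (u t, w))" by (rule M'(2))
    \<comment> \<open>N bounded derivatives of the field along u make its j-th coefficient as small as needed
      for N derivatives of the j-th summand of the derivative of u.\<close>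
    have \<gamma>: "norm (disc_coeff g j) \<le> (coeff_bound j * M') * h ^ min j N" if j: "j < s" for j
    proof -
      have "bounded_derivs (min j N) M' {a..a+h} (\<lambda>t. f (u t, w))" using G by (rule bounded_derivs_le[rotated]) simp
      from bounded_derivs_jet[OF this M'(1) h(1)] obtain d where
        "\<And>\<tau>. \<tau> \<in> {0..1} \<Longrightarrow> norm (g \<tau> - (\<Sum>i<min j N. (h * \<tau>) ^ i *\<^sub>R d i)) \<le> M' * h ^ min j N"
        unfolding g_def by blast
      then have "norm (g \<tau> - (\<Sum>i<min j N. \<tau> ^ i *\<^sub>R (h ^ i *\<^sub>R d i))) \<le> M' * h ^ min j N" if "\<tau> \<in> {0..1}" for \<tau>
        using that by (simp add: power_mult_distrib mult.commute)
      from norm_disc_coeff_jet[OF this _ j] show ?thesis by (simp add: mult.assoc)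
    qed
    have "bounded_derivs N M2 {a..a+h} (\<lambda>t. disc_proj g ((t - a) / h))"
      unfolding disc_proj_def M2_def using B(2)[OF h \<gamma>] by (intro bounded_derivs_sum) auto
    then have "bounded_derivs N (M2 + \<rho>) {a..a+h} (\<lambda>t. disc_proj g ((t - a) / h))"
      by (rule bounded_derivs_mono) (use \<rho> in simp)
    moreover have "norm (u t) \<le> M2 + \<rho>" if "t \<in> {a..a+h}" for t using u[OF that] M2 by simp
    ultimately show ?thesis unfolding bounded_derivs.simps
      using hbvm_step_derivative[OF eq h(1)]
      by (intro conjI exI[of _ "\<lambda>t. disc_proj g ((t - a) / h)"] ballI) (simp_all add: g_def)
  qed
  show ?case using M2 \<rho> by (intro exI[of _ "M2 + \<rho>"] conjI allI impI main) auto
qed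

lemma field_regularity:
  fixes f :: "'a::euclidean_space \<times> 'a \<Rightarrow> 'a" and F :: "'a \<times> 'a \<Rightarrow> 'b::euclidean_space"
  assumes f: "C_infinity f" and F: "C_infinity F" and \<rho>: "0 \<le> \<rho>"
  shows "\<exists>M\<ge>0. \<forall>a h u w. bounded_step f \<rho> w a h u \<longrightarrow> bounded_derivs N M {a..a+h} (\<lambda>t. F (u t, w))"
proof -
  obtain M where M: "M \<ge> 0" "\<And>a h u w. bounded_step f \<rho> w a h u \<Longrightarrow> bounded_derivs N M {a..a+h} u"
    using step_regularity[OF f \<rho>] by blast
  have "C_diff N F" using F by (simp add: C_infinity_def)
  from bounded_derivs_compose[OF this, of "2 * (M + \<rho>)"] obtain M' where M': "M' \<ge> 0"
    "\<And>S x. bounded_derivs N (2 * (M + \<rho>)) S x \<Longrightarrow> bounded_derivs N M' S (\<lambda>t. F (x t))"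
    using M \<rho> by auto
  have "bounded_derivs N M' {a..a+h} (\<lambda>t. F (u t, w))" if st: "bounded_step f \<rho> w a h u" for a h u w
  proof (rule M'(2), rule bounded_derivs_Pair_const)
    show "bounded_derivs N (M + \<rho>) {a..a+h} u" by (rule bounded_derivs_mono[OF M(2)[OF st]]) (use \<rho> in simp)
    show "norm w \<le> M + \<rho>" using st M by (simp add: bounded_step_def)
  qed
  with M'(1) show ?thesis by blast
qed

lemma residual_small:
  assumes f: "C_infinity f" and \<rho>: "0 \<le> \<rho>"
  shows "\<exists>C\<ge>0. \<forall>a h u w. bounded_step f \<rho> w a h u \<longrightarrow>
    (\<forall>\<tau>\<in>{0..1}. norm (f (u (a + \<tau> * h), w) - disc_proj (\<lambda>\<sigma>. f (u (a + \<sigma> * h), w)) \<tau>) \<le> C * h ^ s)"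
proof -
  obtain M where M: "M \<ge> 0" "\<And>a h u w. bounded_step f \<rho> w a h u \<Longrightarrow> bounded_derivs s M {a..a+h} (\<lambda>t. f (u t, w))"
    using field_regularity[OF f f \<rho>] by blast
  have "norm (f (u (a + \<tau> * h), w) - disc_proj (\<lambda>\<sigma>. f (u (a + \<sigma> * h), w)) \<tau>) \<le> (1 + proj_bound) * M * h ^ s"
    if st: "bounded_step f \<rho> w a h u" and \<tau>: "\<tau> \<in> {0..1}" for a h u w \<tau>
  proof -
    have h: "0 < h" using st by (simp add: bounded_step_def)
    from bounded_derivs_jet[OF M(2)[OF st] M(1) h] obtain d where
      "\<And>\<tau>. \<tau> \<in> {0..1} \<Longrightarrow> norm (f (u (a + \<tau> * h), w) - (\<Sum>i<s. (h * \<tau>) ^ i *\<^sub>R d i)) \<le> M * h ^ s" by blast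
    then have "norm (f (u (a + \<tau> * h), w) - (\<Sum>i<s. \<tau> ^ i *\<^sub>R (h ^ i *\<^sub>R d i))) \<le> M * h ^ s" if "\<tau> \<in> {0..1}" for \<tau>
      using that by (simp add: power_mult_distrib mult.commute)
    from norm_residual_jet[OF this \<tau>] show ?thesis by (simp add: mult.assoc)
  qed
  then show ?thesis using M proj_bound_nonneg by (intro exI[of _ "(1 + proj_bound) * M"]) auto
qed

lemma residual_orthogonal:
  fixes f :: "'a::euclidean_space \<times> 'a \<Rightarrow> 'a"
  assumes f: "C_infinity f" and \<rho>: "0 \<le> \<rho>" and s: "1 \<le> s" and M': "0 \<le> M'"
  shows "\<exists>C\<ge>0. \<forall>a h u w \<Phi>. bounded_step f \<rho> w a h u \<and> bounded_derivs (2 * s) M' {a..a+h} \<Phi> \<longrightarrow>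
    \<bar>integral {0..1} (\<lambda>\<tau>. (f (u (a + \<tau> * h), w) - disc_proj (\<lambda>\<sigma>. f (u (a + \<sigma> * h), w)) \<tau>) \<bullet> \<Phi> (a + \<tau> * h))\<bar>
      \<le> C * h ^ (2 * s)"
proof -
  obtain M0 where M0: "M0 \<ge> 0" "\<And>a h u w. bounded_step f \<rho> w a h u \<Longrightarrow> bounded_derivs (2 * s) M0 {a..a+h} (\<lambda>t. f (u t, w))"
    using field_regularity[OF f f \<rho>] by blast
  define M where "M = M0 + M'"
  define C where "C = (1 + proj_bound) * (2 * real s + 1)\<^sup>2 * M\<^sup>2"
  have M: "0 \<le> M" "M0 \<le> M" "M' \<le> M" using M0 M' by (auto simp: M_def)
  obtain n where n: "2 * s = Suc n" using s by (cases "2 * s") auto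
  have "\<bar>integral {0..1} (\<lambda>\<tau>. (f (u (a + \<tau> * h), w) - disc_proj (\<lambda>\<sigma>. f (u (a + \<sigma> * h), w)) \<tau>) \<bullet> \<Phi> (a + \<tau> * h))\<bar>
      \<le> real DIM('a) * C * h ^ (2 * s)"
    if st: "bounded_step f \<rho> w a h u" and \<Phi>: "bounded_derivs (2 * s) M' {a..a+h} \<Phi>" for a h u w \<Phi>
  proof -
    have h: "0 < h" "h \<le> 1" using st by (auto simp: bounded_step_def)
    define g where "g = (\<lambda>\<tau>. f (u (a + \<tau> * h), w))"
    define \<phi> where "\<phi> = (\<lambda>\<tau>. \<Phi> (a + \<tau> * h))"
    have img: "(\<lambda>\<tau>. a + \<tau> * h) ` {0..1} \<subseteq> {a..a+h}" using h by (auto intro: mult_left_le_one_le)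
    have G: "bounded_derivs (2 * s) M {a..a+h} (\<lambda>t. f (u t, w))" "bounded_derivs (2 * s) M {a..a+h} \<Phi>"
      using bounded_derivs_mono[OF M0(2)[OF st] M(2)] bounded_derivs_mono[OF \<Phi> M(3)] by auto
    have cont: "continuous_on {0..1} g" "continuous_on {0..1} \<phi>"
    proof -
      have "continuous_on {0..1} (\<lambda>\<tau>. a + \<tau> * h)" by (intro continuous_intros)
      from continuous_on_compose2[OF _ this img] show "continuous_on {0..1} g" "continuous_on {0..1} \<phi>"
        using G bounded_derivs_continuous unfolding n g_def \<phi>_def by blast+
    qed
    have comp: "\<bar>integral {0..1} (\<lambda>\<tau>. (g \<tau> \<bullet> i - disc_proj (\<lambda>\<sigma>. g \<sigma> \<bullet> i) \<tau>) * (\<phi> \<tau> \<bullet> i))\<bar> \<le> C * h ^ (2 * s)"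
      if i: "i \<in> Basis" for i
    proof -
      from bounded_derivs_jet[OF bounded_derivs_component[OF G(1) i] M(1) h(1)] obtain d where d: "\<And>i. norm (d i) \<le> M"
        "\<And>\<tau>. \<tau> \<in> {0..1} \<Longrightarrow> norm (g \<tau> \<bullet> i - (\<Sum>j<2 * s. (h * \<tau>) ^ j *\<^sub>R d j)) \<le> M * h ^ (2 * s)"
        unfolding g_def by blast
      from bounded_derivs_jet[OF bounded_derivs_component[OF G(2) i] M(1) h(1)] obtain d' where d': "\<And>i. norm (d' i) \<le> M"
        "\<And>\<tau>. \<tau> \<in> {0..1} \<Longrightarrow> norm (\<phi> \<tau> \<bullet> i - (\<Sum>j<2 * s. (h * \<tau>) ^ j *\<^sub>R d' j)) \<le> M * h ^ (2 * s)"
        unfolding \<phi>_def by blast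
      show ?thesis unfolding C_def
        using d d' h M cont by (intro residual_moment_le[where a = d and \<alpha> = d']) (auto intro!: continuous_intros)
    qed
    have "integral {0..1} (\<lambda>\<tau>. (g \<tau> - disc_proj g \<tau>) \<bullet> \<phi> \<tau>)
      = integral {0..1} (\<lambda>\<tau>. \<Sum>i\<in>Basis. (g \<tau> \<bullet> i - disc_proj (\<lambda>\<sigma>. g \<sigma> \<bullet> i) \<tau>) * (\<phi> \<tau> \<bullet> i))"
      by (subst euclidean_inner) (simp add: inner_diff_left disc_proj_inner)
    also have "\<dots> = (\<Sum>i\<in>Basis. integral {0..1} (\<lambda>\<tau>. (g \<tau> \<bullet> i - disc_proj (\<lambda>\<sigma>. g \<sigma> \<bullet> i) \<tau>) * (\<phi> \<tau> \<bullet> i)))"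
      using cont by (intro integral_sum integrable_continuous_real continuous_intros disc_proj_continuous) auto
    also have "\<bar>\<dots>\<bar> \<le> (\<Sum>i\<in>(Basis::'a set). C * h ^ (2 * s))"
      using comp by (intro order_trans[OF sum_abs] sum_mono)
    finally show ?thesis by (simp add: g_def \<phi>_def)
  qed
  moreover have "0 \<le> real DIM('a) * C" using proj_bound_nonneg by (simp add: C_def)
  ultimately show ?thesis by blast
qed

end

section \<open>The error of one step\<close>

text \<open>
  Here \<open>w\<close> is the memory term, which is constant during a step.
\<close>

definition exact_step :: "('a::euclidean_space \<times> 'a \<Rightarrow> 'a) \<Rightarrow> real \<Rightarrow> 'a \<Rightarrow> real \<Rightarrow> real \<Rightarrow> (real \<Rightarrow> 'a) \<Rightarrow> bool" where
  "exact_step f \<rho> w a h y \<longleftrightarrow> norm w \<le> \<rho> \<and>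
     (\<forall>t\<in>{a..a+h}. norm (y t) \<le> \<rho> \<and> (y has_vector_derivative f (y t, w)) (at t within {a..a+h}))"

text \<open>
  The curve \<open>\<Phi>\<close> solves, up to a defect of order \<open>h ^ L\<close>, the adjoint of the linear equation whose
  matrix has the columns \<open>D i\<close>, backwards from the end value \<open>e\<close>. Finitely many Picard iterations
  are enough for the error analysis, and they visibly keep derivatives bounded.
\<close>

lemma truncated_adjoint:
  assumes M: "0 \<le> M"
  shows "\<exists>M'\<ge>0. \<forall>a h (D :: 'a::euclidean_space \<Rightarrow> real \<Rightarrow> 'a) e.
    0 < h \<and> h \<le> 1 \<and> norm e \<le> 1 \<and> (\<forall>i\<in>Basis. bounded_derivs (Suc N) M {a..a+h} (D i)) \<longrightarrow>
    (\<exists>\<Phi> r. bounded_derivs (Suc N) M' {a..a+h} \<Phi> \<and> \<Phi> (a + h) = e \<and>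
      (\<forall>t\<in>{a..a+h}. (\<Phi> has_vector_derivative (r t - (\<Sum>i\<in>Basis. (\<Phi> t \<bullet> D i t) *\<^sub>R i))) (at t within {a..a+h}) \<and>
         norm (r t) \<le> M' * h ^ L))"
proof (induction L)
  have adj: "norm (\<Sum>i\<in>Basis. (\<phi> \<bullet> D i) *\<^sub>R i) \<le> real DIM('a) * M * norm \<phi>"
    if "\<And>i. i \<in> Basis \<Longrightarrow> norm (D i) \<le> M" for \<phi> :: 'a and D :: "'a \<Rightarrow> 'a"
  proof -
    have "norm (\<Sum>i\<in>Basis. (\<phi> \<bullet> D i) *\<^sub>R i) \<le> (\<Sum>i\<in>(Basis::'a set). norm \<phi> * M)"
    proof (rule order_trans[OF norm_sum], rule sum_mono)
      fix i :: 'a assume i: "i \<in> Basis"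
      have "\<bar>\<phi> \<bullet> D i\<bar> \<le> norm \<phi> * M"
        using Cauchy_Schwarz_ineq2[of \<phi> "D i"] mult_left_mono[OF that[OF i], of "norm \<phi>"] by simp
      then show "norm ((\<phi> \<bullet> D i) *\<^sub>R i) \<le> norm \<phi> * M" using i by simp
    qed
    then show ?thesis by (simp add: mult_ac)
  qed
  {
    case 0
    show ?case
    proof (intro exI[of _ "1 + real DIM('a) * M"] conjI allI impI)
      fix a h and e :: 'a and D :: "'a \<Rightarrow> real \<Rightarrow> 'a"
      assume *: "0 < h \<and> h \<le> 1 \<and> norm e \<le> 1 \<and> (\<forall>i\<in>Basis. bounded_derivs (Suc N) M {a..a+h} (D i))"
      have "norm (\<Sum>i\<in>Basis. (e \<bullet> D i t) *\<^sub>R i) \<le> 1 + real DIM('a) * M" if "t \<in> {a..a+h}" for t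
      proof -
        have "norm (\<Sum>i\<in>Basis. (e \<bullet> D i t) *\<^sub>R i) \<le> real DIM('a) * M * norm e"
          using * bounded_derivs_norm that by (intro adj) blast
        also have "\<dots> \<le> real DIM('a) * M * 1" using * M by (intro mult_left_mono) auto
        finally show ?thesis by simp
      qed
      then show "\<exists>\<Phi> r. bounded_derivs (Suc N) (1 + real DIM('a) * M) {a..a+h} \<Phi> \<and> \<Phi> (a + h) = e \<and>
        (\<forall>t\<in>{a..a+h}. (\<Phi> has_vector_derivative (r t - (\<Sum>i\<in>Basis. (\<Phi> t \<bullet> D i t) *\<^sub>R i))) (at t within {a..a+h}) \<and>
         norm (r t) \<le> (1 + real DIM('a) * M) * h ^ 0)"
        using * M
        by (intro exI[of _ "\<lambda>_. e"] exI[of _ "\<lambda>t. \<Sum>i\<in>Basis. (e \<bullet> D i t) *\<^sub>R i"])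
          (auto intro!: bounded_derivs_const has_vector_derivative_const simp del: bounded_derivs.simps intro: add_increasing2)
    qed (use M in simp)
  next
    case (Suc L)
    then obtain M1 where M1: "M1 \<ge> 0" and IH: "\<And>a h (D :: 'a \<Rightarrow> real \<Rightarrow> 'a) e.
      0 < h \<Longrightarrow> h \<le> 1 \<Longrightarrow> norm e \<le> 1 \<Longrightarrow> (\<forall>i\<in>Basis. bounded_derivs (Suc N) M {a..a+h} (D i)) \<Longrightarrow>
      (\<exists>\<Phi> r. bounded_derivs (Suc N) M1 {a..a+h} \<Phi> \<and> \<Phi> (a + h) = e \<and>
      (\<forall>t\<in>{a..a+h}. (\<Phi> has_vector_derivative (r t - (\<Sum>i\<in>Basis. (\<Phi> t \<bullet> D i t) *\<^sub>R i))) (at t within {a..a+h}) \<and>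
         norm (r t) \<le> M1 * h ^ L))" by blast
    define M2 where "M2 = (\<Sum>i\<in>(Basis::'a set). 2 ^ Suc N * ((2 ^ Suc N * (M1 * M)) * 1))"
    have M2: "0 \<le> M2" using M M1 by (auto simp: M2_def intro!: sum_nonneg)
    define M3 where "M3 = 1 + M2 + real DIM('a) * M * M1"
    have M3: "0 \<le> M3" "1 + M2 \<le> M3" "real DIM('a) * M * M1 \<le> M3" using M M1 M2 by (auto simp: M3_def)
    have "\<exists>\<Phi> r. bounded_derivs (Suc N) M3 {a..a+h} \<Phi> \<and> \<Phi> (a + h) = e \<and>
      (\<forall>t\<in>{a..a+h}. (\<Phi> has_vector_derivative (r t - (\<Sum>i\<in>Basis. (\<Phi> t \<bullet> D i t) *\<^sub>R i))) (at t within {a..a+h}) \<and>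
         norm (r t) \<le> M3 * h ^ Suc L)"
      if h: "0 < h" "h \<le> 1" and e: "norm e \<le> 1" and D: "\<forall>i\<in>Basis. bounded_derivs (Suc N) M {a..a+h} (D i)"
      for a h and e :: 'a and D :: "'a \<Rightarrow> real \<Rightarrow> 'a"
    proof -
      define A where "A = (\<lambda>t \<phi>. \<Sum>i\<in>Basis. (\<phi> \<bullet> D i t) *\<^sub>R i)"
      obtain \<Phi> r where \<Phi>: "bounded_derivs (Suc N) M1 {a..a+h} \<Phi>" "\<Phi> (a + h) = e"
        "\<And>t. t \<in> {a..a+h} \<Longrightarrow> (\<Phi> has_vector_derivative (r t - A t (\<Phi> t))) (at t within {a..a+h})"
        "\<And>t. t \<in> {a..a+h} \<Longrightarrow> norm (r t) \<le> M1 * h ^ L"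
        using IH[OF h e D] unfolding A_def by blast
      have A: "bounded_derivs (Suc N) M2 {a..a+h} (\<lambda>t. A t (\<Phi> t))"
        unfolding A_def M2_def using \<Phi>(1) D M M1
        by (intro bounded_derivs_sum bounded_derivs_scaleR bounded_derivs_inner bounded_derivs_const) auto
      have cont: "continuous_on {a..a+h} (\<lambda>t. A t (\<Phi> t))" using bounded_derivs_continuous[OF A] .
      define J where "J = (\<lambda>t. integral {a..t} (\<lambda>t. A t (\<Phi> t)))"
      have J: "(J has_vector_derivative A t (\<Phi> t)) (at t within {a..a+h})" if "t \<in> {a..a+h}" for t
        unfolding J_def using integral_has_vector_derivative[OF cont that] .
      \<comment> \<open>One more Picard iterate. It differs from its predecessor by the integrated defect of
        the latter, which is where the additional factor h comes from.\<close>
      define \<Psi> where "\<Psi> = (\<lambda>t. e + (J (a + h) - J t))"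
      have \<Psi>: "(\<Psi> has_vector_derivative - A t (\<Phi> t)) (at t within {a..a+h})" if "t \<in> {a..a+h}" for t
        unfolding \<Psi>_def using J[OF that] by (auto intro!: derivative_eq_intros)
      have diff: "norm (\<Psi> t - \<Phi> t) \<le> M1 * h ^ L * h" if t: "t \<in> {a..a+h}" for t
      proof -
        have "norm ((\<Psi> t - \<Phi> t) - (\<Psi> (a + h) - \<Phi> (a + h))) \<le> M1 * h ^ L * \<bar>t - (a + h)\<bar>"
        proof (rule norm_diff_le_of_derivative)
          fix t assume t: "t \<in> {a..a+h}"
          show "((\<lambda>t. \<Psi> t - \<Phi> t) has_vector_derivative (- A t (\<Phi> t) - (r t - A t (\<Phi> t)))) (at t within {a..a+h})"
            using \<Psi>[OF t] \<Phi>(3)[OF t] by (rule has_vector_derivative_diff)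
          show "norm (- A t (\<Phi> t) - (r t - A t (\<Phi> t))) \<le> M1 * h ^ L" using \<Phi>(4)[OF t] by simp
        qed (use t h in auto)
        also have "\<dots> \<le> M1 * h ^ L * h" using t h M1 by (intro mult_left_mono) auto
        finally show ?thesis by (simp add: \<Psi>_def \<Phi>(2))
      qed
      have "norm (\<Psi> t) \<le> 1 + M2" if t: "t \<in> {a..a+h}" for t
      proof -
        have "norm (\<Psi> t - \<Psi> (a + h)) \<le> M2 * \<bar>t - (a + h)\<bar>"
        proof (rule norm_diff_le_of_derivative[OF \<Psi>])
          show "norm (- A t (\<Phi> t)) \<le> M2" if "t \<in> {a..a+h}" for t using bounded_derivs_norm[OF A that] by simp
        qed (use t h in auto)
        also have "\<dots> \<le> M2 * 1" using t h M2 by (intro mult_left_mono) auto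
        finally have "norm (\<Psi> t - e) \<le> M2" by (simp add: \<Psi>_def)
        then show ?thesis using e norm_triangle_ineq2[of "\<Psi> t" e] by linarith
      qed
      moreover have "bounded_derivs (Suc N) (1 + M2) {a..a+h} (\<lambda>t. - A t (\<Phi> t))"
        using bounded_derivs_mono[OF bounded_derivs_minus[OF A]] by simp
      ultimately have "bounded_derivs (Suc (Suc N)) (1 + M2) {a..a+h} \<Psi>"
        unfolding bounded_derivs.simps(2)[of "Suc N"] using \<Psi>
        by (intro conjI exI[of _ "\<lambda>t. - A t (\<Phi> t)"]) auto
      then have F1: "bounded_derivs (Suc N) M3 {a..a+h} \<Psi>"
        using bounded_derivs_Suc_D bounded_derivs_mono M3 by blast
      have F2: "\<Psi> (a + h) = e" by (simp add: \<Psi>_def)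
      have F3: "(\<Psi> has_vector_derivative ((A t (\<Psi> t - \<Phi> t)) - A t (\<Psi> t))) (at t within {a..a+h})"
        if "t \<in> {a..a+h}" for t
      proof -
        have "A t (\<Psi> t - \<Phi> t) - A t (\<Psi> t) = - A t (\<Phi> t)"
          unfolding A_def by (simp add: inner_diff_left scaleR_diff_left sum_subtractf)
        then show ?thesis using \<Psi>[OF that] by simp
      qed
      have F4: "norm (A t (\<Psi> t - \<Phi> t)) \<le> M3 * h ^ Suc L" if t: "t \<in> {a..a+h}" for t
      proof -
        have "norm (A t (\<Psi> t - \<Phi> t)) \<le> real DIM('a) * M * norm (\<Psi> t - \<Phi> t)"
          unfolding A_def using D bounded_derivs_norm t by (intro adj) blast
        also have "\<dots> \<le> real DIM('a) * M * (M1 * h ^ L * h)" using diff[OF t] M by (intro mult_left_mono) auto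
        also have "\<dots> = (real DIM('a) * M * M1) * h ^ Suc L" by simp
        also have "\<dots> \<le> M3 * h ^ Suc L" using M3 h by (intro mult_right_mono) auto
        finally show ?thesis .
      qed
      show ?thesis using F1 F2 F3 F4 unfolding A_def
        by (intro exI[of _ \<Psi>] exI[of _ "\<lambda>t. \<Sum>i\<in>Basis. ((\<Psi> t - \<Phi> t) \<bullet> D i t) *\<^sub>R i"] conjI ballI) (simp_all del: bounded_derivs.simps)
    qed
    note goal = this
    show ?case by (intro exI[of _ M3] conjI allI impI M3(1); (elim conjE)?; rule goal)
  }
qed

text \<open>
  Used for \<open>q\<close> the pairing of the error with the adjoint curve: up to \<open>B\<close> its derivative is the
  pairing of the residual, expressed in the local variable of the step.
\<close>

lemma integral_unit_rescale:
  fixes q :: "real \<Rightarrow> real"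
  assumes h: "0 < h" and S: "continuous_on {0..1} S"
    and q: "\<And>t. t \<in> {a..a+h} \<Longrightarrow> (q has_vector_derivative q' t) (at t within {a..a+h})"
    and bnd: "\<And>t. t \<in> {a..a+h} \<Longrightarrow> \<bar>q' t - S ((t - a) / h)\<bar> \<le> B"
  shows "\<bar>q (a + h) - q a\<bar> \<le> h * B + h * \<bar>integral {0..1} S\<bar>"
proof -
  define J where "J = (\<lambda>\<tau>. integral {0..\<tau>} S)"
  have J: "(J has_real_derivative S \<tau>) (at \<tau> within {0..1})" if "\<tau> \<in> {0..1}" for \<tau>
    unfolding J_def has_real_derivative_iff_has_vector_derivative using integral_has_vector_derivative[OF S that] .
  have hJ: "((\<lambda>t. h * J ((t - a) / h)) has_vector_derivative S ((t - a) / h)) (at t within {a..a+h})"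
    if t: "t \<in> {a..a+h}" for t
  proof -
    have img: "(\<lambda>t. (t - a) / h) ` {a..a+h} \<subseteq> {0..1}" using h by auto
    have "(J has_real_derivative S ((t - a) / h)) (at ((t - a) / h) within (\<lambda>t. (t - a) / h) ` {a..a+h})"
      by (rule has_field_derivative_subset[OF J img]) (use t h in auto)
    moreover have "((\<lambda>t. (t - a) / h) has_real_derivative 1 / h) (at t within {a..a+h})"
      using h by (auto intro!: derivative_eq_intros)
    ultimately have "(J \<circ> (\<lambda>t. (t - a) / h) has_real_derivative S ((t - a) / h) * (1 / h)) (at t within {a..a+h})"
      by (rule DERIV_image_chain)
    from DERIV_cmult[OF this, of h] show ?thesis
      using h by (simp add: has_real_derivative_iff_has_vector_derivative o_def)
  qed
  have "norm ((q (a + h) - h * J ((a + h - a) / h)) - (q a - h * J ((a - a) / h))) \<le> B * \<bar>a + h - a\<bar>"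
  proof (rule norm_diff_le_of_derivative[where x = "\<lambda>t. q t - h * J ((t - a) / h)"])
    show "((\<lambda>t. q t - h * J ((t - a) / h)) has_vector_derivative q' t - S ((t - a) / h)) (at t within {a..a+h})"
      if "t \<in> {a..a+h}" for t using q[OF that] hJ[OF that] by (rule has_vector_derivative_diff)
  qed (use bnd h in auto)
  then have 1: "\<bar>(q (a + h) - q a) - h * integral {0..1} S\<bar> \<le> h * B"
    using h by (simp add: J_def algebra_simps)
  have 2: "\<bar>h * integral {0..1} S\<bar> = h * \<bar>integral {0..1} S\<bar>" using h by (simp add: abs_mult)
  have "\<bar>x\<bar> \<le> r + p" if "\<bar>x - z\<bar> \<le> r" "\<bar>z\<bar> = p" for x z r p :: real using that by linarith
  from this[OF 1 2] show ?thesis .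
qed

context legendre_quadrature
begin

text \<open>
  The residual is of order \<open>h ^ s\<close> and acts during time \<open>h\<close>; the Lipschitz terms are absorbed for
  small \<open>h\<close>.
\<close>

lemma interior_error:
  fixes f :: "'a::euclidean_space \<times> 'a \<Rightarrow> 'a"
  assumes f: "C_infinity f" and \<rho>: "0 \<le> \<rho>"
  obtains C h0 where "0 \<le> C" "0 < h0"
    "\<And>a h u w' y w t. h \<le> h0 \<Longrightarrow> bounded_step f \<rho> w' a h u \<Longrightarrow> exact_step f \<rho> w a h y \<Longrightarrow>
      t \<in> {a..a+h} \<Longrightarrow> norm (y t - u t) \<le> C * (norm (y a - u a) + norm (w - w') + h ^ (s + 1))"
proof -
  obtain L where L: "L \<ge> 0" "\<And>x z. x \<in> cball 0 (2 * \<rho>) \<Longrightarrow> z \<in> cball 0 (2 * \<rho>) \<Longrightarrow> norm (f x - f z) \<le> L * norm (x - z)"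
    using C_infinity_Lipschitz[OF f] by blast
  obtain R where R: "R \<ge> 0" "\<And>a h u w \<tau>. bounded_step f \<rho> w a h u \<Longrightarrow> \<tau> \<in> {0..1} \<Longrightarrow>
    norm (f (u (a + \<tau> * h), w) - disc_proj (\<lambda>\<sigma>. f (u (a + \<sigma> * h), w)) \<tau>) \<le> R * h ^ s"
    using residual_small[OF f \<rho>] by blast
  define h0 where "h0 = 1 / (2 * (L + 1))"
  have h0: "0 < h0" using L by (simp add: h0_def)
  have main: "norm (y t - u t) \<le> (2 + 2 * R) * (norm (y a - u a) + norm (w - w') + h ^ (s + 1))"
    if h: "h \<le> h0" and st: "bounded_step f \<rho> w' a h u" and ex: "exact_step f \<rho> w a h y" and t: "t \<in> {a..a+h}"
    for a h u w' y w t
  proof -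
    have h': "0 < h" "h \<le> 1" and w': "norm w' \<le> \<rho>" and u: "\<And>t. t \<in> {a..a+h} \<Longrightarrow> norm (u t) \<le> \<rho>"
      and eq: "hbvm_step f w' a h u" using st by (auto simp: bounded_step_def)
    have w: "norm w \<le> \<rho>" and y: "\<And>t. t \<in> {a..a+h} \<Longrightarrow> norm (y t) \<le> \<rho> \<and> (y has_vector_derivative f (y t, w)) (at t within {a..a+h})"
      using ex by (auto simp: exact_step_def)
    define q where "q = (\<lambda>t. disc_proj (\<lambda>\<sigma>. f (u (a + \<sigma> * h), w')) ((t - a) / h))"
    have q: "norm (f (u t, w') - q t) \<le> R * h ^ s" if "t \<in> {a..a+h}" for t
    proof -
      have "(t - a) / h \<in> {0..1}" "a + (t - a) / h * h = t" using that h' by auto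
      then show ?thesis using R(2)[OF st, of "(t - a) / h"] by (simp add: q_def)
    qed
    define \<delta> where "\<delta> = (\<lambda>t. y t - u t)"
    have \<delta>': "(\<delta> has_vector_derivative (f (y t, w) - q t)) (at t within {a..a+h})" if "t \<in> {a..a+h}" for t
      unfolding \<delta>_def q_def using y[OF that] hbvm_step_derivative[OF eq h'(1) that]
      by (intro has_vector_derivative_diff) auto
    \<comment> \<open>Instead of a continuous Gronwall inequality: the maximum X of the error over the step is
      bounded in terms of h L X, and h L is at most one half.\<close>
    have "continuous_on {a..a+h} \<delta>" unfolding continuous_on_eq_continuous_within
      using \<delta>' has_vector_derivative_continuous by blast
    then have "continuous_on {a..a+h} (\<lambda>t. norm (\<delta> t))" by (intro continuous_intros)
    moreover have "{a..a+h} \<noteq> {}" using h' by simp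
    ultimately obtain t0 where t0: "t0 \<in> {a..a+h}" "\<And>t. t \<in> {a..a+h} \<Longrightarrow> norm (\<delta> t) \<le> norm (\<delta> t0)"
      using continuous_attains_sup[of "{a..a+h}" "\<lambda>t. norm (\<delta> t)"] by auto
    define X where "X = norm (\<delta> t0)"
    define W where "W = norm (w - w')"
    have "norm (\<delta> t0 - \<delta> a) \<le> (L * (X + W) + R * h ^ s) * \<bar>t0 - a\<bar>"
    proof (rule norm_diff_le_of_derivative[OF \<delta>'])
      fix t assume t: "t \<in> {a..a+h}"
      have "norm (y t, w) \<le> 2 * \<rho>" "norm (u t, w') \<le> 2 * \<rho>"
        using norm_Pair_le[of "y t" w] norm_Pair_le[of "u t" w'] y[OF t] u[OF t] w w' by auto
      then have "norm (f (y t, w) - f (u t, w')) \<le> L * norm ((y t, w) - (u t, w'))" by (intro L(2)) auto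
      also have "\<dots> \<le> L * (X + W)"
        using norm_Pair_le[of "\<delta> t" "w - w'"] t0(2)[OF t] L(1)
        by (intro mult_left_mono) (auto simp: X_def W_def \<delta>_def)
      finally have "norm (f (y t, w) - f (u t, w')) \<le> L * (X + W)" .
      then have "norm ((f (y t, w) - f (u t, w')) + (f (u t, w') - q t)) \<le> L * (X + W) + R * h ^ s"
        using q[OF t] by (rule norm_triangle_mono)
      then show "norm (f (y t, w) - q t) \<le> L * (X + W) + R * h ^ s" by simp
    qed (use t0 h' in auto)
    also have "\<dots> \<le> (L * (X + W) + R * h ^ s) * h"
      using t0 h' L R by (intro mult_left_mono add_nonneg_nonneg mult_nonneg_nonneg) (auto simp: X_def W_def)
    also have "\<dots> = (h * L) * (X + W) + R * h ^ (s + 1)" by (simp add: algebra_simps)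
    also have "\<dots> \<le> (1 / 2) * (X + W) + R * h ^ (s + 1)"
    proof -
      have "h * L \<le> h0 * (L + 1)" using h h' L by (intro mult_mono) auto
      also have "\<dots> = 1 / 2" using L by (simp add: h0_def field_simps)
      finally show ?thesis by (intro add_right_mono mult_right_mono) (auto simp: X_def W_def)
    qed
    finally have "norm (\<delta> t0 - \<delta> a) \<le> (X + W) / 2 + R * h ^ (s + 1)" by simp
    then have "X \<le> norm (\<delta> a) + (X + W) / 2 + R * h ^ (s + 1)"
      unfolding X_def using norm_triangle_ineq2[of "\<delta> t0" "\<delta> a"] by linarith
    moreover have "p \<le> 2 * d + W + 2 * r" if "p \<le> d + (p + W) / 2 + r" for p d r using that by (simp add: field_simps)
    ultimately have "X \<le> 2 * norm (\<delta> a) + W + 2 * (R * h ^ (s + 1))" by blast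
    moreover have "0 \<le> R * norm (\<delta> a)" "0 \<le> R * W" "0 \<le> W" "0 \<le> h ^ (s + 1)" using R h' by (auto simp: W_def)
    ultimately have "X \<le> (2 + 2 * R) * (norm (\<delta> a) + W + h ^ (s + 1))"
      by (simp add: distrib_left distrib_right)
    then show ?thesis using t0(2)[OF t] unfolding X_def W_def \<delta>_def by linarith
  qed
  show thesis by (rule that[OF _ h0 main]) (use R(1) in auto)
qed

text \<open>
  With \<open>\<delta> = y - u\<close> the error and \<open>\<Phi>\<close> an adjoint curve along \<open>u\<close>, the derivative of \<open>\<delta> \<bullet> \<Phi>\<close> is the
  residual paired with \<open>\<Phi>\<close>, up to the memory error, the square of the error and the adjoint defect
  times the error. The residual term integrates to order \<open>h ^ (2 * s + 1)\<close> by orthogonality. The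
  interior error contributes \<open>h ^ (s + 1)\<close> to \<open>\<delta>\<close>, hence \<open>h ^ (2 * s + 2)\<close> to its square and
  \<open>h ^ (2 * s + 1)\<close> to the product with the defect, even before integration. The part of \<open>\<delta>\<close>
  inherited from earlier values enters linearly: since all values are bounded, so does its square.
\<close>

lemma one_step_error:
  fixes f :: "'a::euclidean_space \<times> 'a \<Rightarrow> 'a"
  assumes f: "C_infinity f" and \<rho>: "0 \<le> \<rho>" and s: "1 \<le> s"
  obtains C h0 where "0 \<le> C" "0 < h0"
    "\<And>a h u w' y w. h \<le> h0 \<Longrightarrow> bounded_step f \<rho> w' a h u \<Longrightarrow> exact_step f \<rho> w a h y \<Longrightarrow>
      norm ((y (a + h) - u (a + h)) - (y a - u a)) \<le> C * h * (norm (y a - u a) + norm (w - w') + h ^ (2 * s))"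
proof -
  obtain C1 h0 where C1: "C1 \<ge> 0" "0 < h0" "\<And>a h u w' y w t. h \<le> h0 \<Longrightarrow> bounded_step f \<rho> w' a h u \<Longrightarrow> exact_step f \<rho> w a h y \<Longrightarrow>
      t \<in> {a..a+h} \<Longrightarrow> norm (y t - u t) \<le> C1 * (norm (y a - u a) + norm (w - w') + h ^ (s + 1))"
    by (rule interior_error[OF f \<rho>]) blast
  obtain B where B: "B \<ge> 0" "\<And>x v. x \<in> cball 0 (2 * \<rho>) \<Longrightarrow> norm (frechet_derivative f (at x) v) \<le> B * norm v"
    using C_infinity_derivative_bound[OF f] by blast
  obtain R where R: "R \<ge> 0" "\<And>x z. x \<in> cball 0 (2 * \<rho>) \<Longrightarrow> z \<in> cball 0 (2 * \<rho>) \<Longrightarrow>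
    norm (f x - f z - frechet_derivative f (at z) (x - z)) \<le> R * (norm (x - z))\<^sup>2"
    using C_infinity_remainder[OF f] by blast
  obtain n where n: "2 * s = Suc n" using s by (cases "2 * s") auto
  have "\<forall>i::'a. \<exists>M\<ge>0. \<forall>a h u w. bounded_step f \<rho> w a h u \<longrightarrow>
      bounded_derivs (Suc n) M {a..a+h} (\<lambda>t. frechet_derivative f (at (u t, w)) (i, 0))"
    using field_regularity[OF f C_infinity_derivative[OF f] \<rho>] by blast
  then obtain MD where MD: "\<And>i::'a. MD i \<ge> 0" "\<And>(i::'a) a h u w. bounded_step f \<rho> w a h u \<Longrightarrow>
      bounded_derivs (Suc n) (MD i) {a..a+h} (\<lambda>t. frechet_derivative f (at (u t, w)) (i, 0))" by metis
  define M where "M = sum MD Basis"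
  have M: "0 \<le> M" "\<And>i. i \<in> Basis \<Longrightarrow> MD i \<le> M" using MD(1) by (auto simp: M_def intro!: sum_nonneg member_le_sum)
  obtain A where A: "A \<ge> 0" "\<And>a h (D :: 'a \<Rightarrow> real \<Rightarrow> 'a) e.
    0 < h \<Longrightarrow> h \<le> 1 \<Longrightarrow> norm e \<le> 1 \<Longrightarrow> (\<forall>i\<in>Basis. bounded_derivs (Suc n) M {a..a+h} (D i)) \<Longrightarrow>
    (\<exists>\<Phi> r. bounded_derivs (Suc n) A {a..a+h} \<Phi> \<and> \<Phi> (a + h) = e \<and>
      (\<forall>t\<in>{a..a+h}. (\<Phi> has_vector_derivative (r t - (\<Sum>i\<in>Basis. (\<Phi> t \<bullet> D i t) *\<^sub>R i))) (at t within {a..a+h}) \<and>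
         norm (r t) \<le> A * h ^ s))"
    using truncated_adjoint[OF M(1), of n s, where ?'a = 'a] by blast
  obtain Q where Q: "Q \<ge> 0" "\<And>a h u w \<Phi>. bounded_step f \<rho> w a h u \<Longrightarrow> bounded_derivs (2 * s) A {a..a+h} \<Phi> \<Longrightarrow>
    \<bar>integral {0..1} (\<lambda>\<tau>. (f (u (a + \<tau> * h), w) - disc_proj (\<lambda>\<sigma>. f (u (a + \<sigma> * h), w)) \<tau>) \<bullet> \<Phi> (a + \<tau> * h))\<bar>
      \<le> Q * h ^ (2 * s)"
    using residual_orthogonal[OF f \<rho> s A(1)] by blast
  define C2 where "C2 = A * (B + R * ((C1 + 1)\<^sup>2 * (8 * \<rho> + 2)) + C1)"
  define C3 where "C3 = C2 + Q + A"
  have C3: "0 \<le> C3" using A(1) B(1) R(1) C1(1) Q(1) \<rho> by (simp add: C3_def C2_def)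
  have main: "norm ((y (a + h) - u (a + h)) - (y a - u a))
      \<le> (real DIM('a) * C3) * h * (norm (y a - u a) + norm (w - w') + h ^ (2 * s))"
    if h: "h \<le> h0" and st: "bounded_step f \<rho> w' a h u" and ex: "exact_step f \<rho> w a h y"
    for a h u w' y w
  proof -
    have h': "0 < h" "h \<le> 1" and w': "norm w' \<le> \<rho>" and u: "\<And>t. t \<in> {a..a+h} \<Longrightarrow> norm (u t) \<le> \<rho>"
      and eq: "hbvm_step f w' a h u" using st by (auto simp: bounded_step_def)
    have w: "norm w \<le> \<rho>" and y: "\<And>t. t \<in> {a..a+h} \<Longrightarrow> norm (y t) \<le> \<rho> \<and> (y has_vector_derivative f (y t, w)) (at t within {a..a+h})"
      using ex by (auto simp: exact_step_def)
    define \<delta> where "\<delta> = (\<lambda>t. y t - u t)"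
    define \<epsilon> where "\<epsilon> = norm (\<delta> a) + norm (w - w')"
    define Z where "Z = \<epsilon> + h ^ (2 * s)"
    define X where "X = C1 * (\<epsilon> + h ^ (s + 1))"
    define D where "D = (\<lambda>i t. frechet_derivative f (at (u t, w')) (i, 0))"
    define g where "g = (\<lambda>\<tau>. f (u (a + \<tau> * h), w'))"
    have pow: "h ^ (2 * s) \<le> 1" "h ^ (s + 1) \<le> 1" "h ^ s \<le> 1" by (rule power_le_one; use h' in simp)+
    have \<epsilon>: "0 \<le> \<epsilon>" "\<epsilon> \<le> 4 * \<rho>" "norm (w - w') \<le> \<epsilon>" "norm (\<delta> a) \<le> \<epsilon>"
    proof -
      have "norm (y a) \<le> \<rho>" "norm (u a) \<le> \<rho>" using y[of a] u[of a] h' by auto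
      then show "\<epsilon> \<le> 4 * \<rho>" using norm_triangle_ineq4[of "y a" "u a"] norm_triangle_ineq4[of w w'] w w'
        by (simp add: \<epsilon>_def \<delta>_def)
    qed (auto simp: \<epsilon>_def)
    have Z: "0 \<le> Z" "\<epsilon> \<le> Z" "h ^ (2 * s) \<le> Z" using \<epsilon> h' by (auto simp: Z_def)
    have \<delta>: "norm (\<delta> t) \<le> X" if "t \<in> {a..a+h}" for t
      using C1(3)[OF h st ex that] by (simp add: X_def \<delta>_def \<epsilon>_def)
    have X: "0 \<le> X" using C1(1) \<epsilon> h' by (simp add: X_def)
    have Xs: "h ^ s * X \<le> C1 * Z"
    proof -
      have "h ^ s * \<epsilon> + h ^ s * h ^ (s + 1) \<le> Z"
      proof -
        have "h ^ s * \<epsilon> \<le> \<epsilon>" using pow \<epsilon> h' by (simp add: mult_left_le_one_le)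
        moreover have "h ^ s * h ^ (s + 1) \<le> h ^ (2 * s)" unfolding power_add[symmetric]
          using h' by (intro power_decreasing) auto
        ultimately show ?thesis by (simp add: Z_def)
      qed
      then have "C1 * (h ^ s * \<epsilon> + h ^ s * h ^ (s + 1)) \<le> C1 * Z" using C1(1) by (rule mult_left_mono)
      then show ?thesis by (simp add: X_def algebra_simps)
    qed
    \<comment> \<open>As all values lie in the ball, \<epsilon> is at most 4 \<rho>, which turns the square of \<epsilon> into a multiple of \<epsilon>.\<close>
    have sq: "(X + norm (w - w'))\<^sup>2 \<le> (C1 + 1)\<^sup>2 * (8 * \<rho> + 2) * Z"
    proof -
      have "X + norm (w - w') \<le> (C1 + 1) * (\<epsilon> + h ^ (s + 1))"
        using \<epsilon> h' by (simp add: X_def distrib_right add_increasing2)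
      then have "(X + norm (w - w'))\<^sup>2 \<le> ((C1 + 1) * (\<epsilon> + h ^ (s + 1)))\<^sup>2"
        using X by (intro power_mono) auto
      also have "\<dots> = (C1 + 1)\<^sup>2 * (\<epsilon> + h ^ (s + 1))\<^sup>2" by (rule power_mult_distrib)
      also have "\<dots> \<le> (C1 + 1)\<^sup>2 * ((8 * \<rho> + 2) * Z)"
      proof (rule mult_left_mono)
        have "(\<epsilon> + h ^ (s + 1))\<^sup>2 \<le> 2 * \<epsilon>\<^sup>2 + 2 * (h ^ (s + 1))\<^sup>2"
          using sum_squares_ge_zero[of "\<epsilon> - h ^ (s + 1)" 0] by (simp add: power2_eq_square algebra_simps)
        also have "\<epsilon>\<^sup>2 \<le> (4 * \<rho>) * Z" unfolding power2_eq_square using \<epsilon> Z \<rho> by (intro mult_mono) auto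
        also have "(h ^ (s + 1))\<^sup>2 \<le> Z"
        proof -
          have "(h ^ (s + 1))\<^sup>2 \<le> h ^ (2 * s)" unfolding power_mult[symmetric] using h' by (intro power_decreasing) auto
          then show ?thesis using Z by linarith
        qed
        finally show "(\<epsilon> + h ^ (s + 1))\<^sup>2 \<le> (8 * \<rho> + 2) * Z" by (simp add: algebra_simps)
      qed simp
      finally show ?thesis by (simp add: mult.assoc)
    qed
    have contu: "continuous_on {a..a+h} u" unfolding continuous_on_eq_continuous_within
      using hbvm_step_derivative[OF eq h'(1)] has_vector_derivative_continuous by blast
    have img: "(\<lambda>\<tau>. a + \<tau> * h) ` {0..1} \<subseteq> {a..a+h}" using h' by (auto intro: mult_left_le_one_le)
    \<comment> \<open>The increment of each component of the error is found by pairing with the adjoint curve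
      that ends in the corresponding basis vector.\<close>
    have comp: "\<bar>(\<delta> (a + h) - \<delta> a) \<bullet> e\<bar> \<le> C3 * h * Z" if e: "e \<in> Basis" for e
    proof -
      have Dreg: "\<forall>i\<in>Basis. bounded_derivs (Suc n) M {a..a+h} (D i)"
        unfolding D_def using bounded_derivs_mono[OF MD(2)[OF st] M(2)] by blast
      have "norm e \<le> 1" using e by simp
      from A(2)[OF h' this Dreg] obtain \<Phi> r where \<Phi>: "bounded_derivs (Suc n) A {a..a+h} \<Phi>" "\<Phi> (a + h) = e"
        and \<Phi>': "\<And>t. t \<in> {a..a+h} \<Longrightarrow> (\<Phi> has_vector_derivative (r t - (\<Sum>i\<in>Basis. (\<Phi> t \<bullet> D i t) *\<^sub>R i))) (at t within {a..a+h})"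
        and r: "\<And>t. t \<in> {a..a+h} \<Longrightarrow> norm (r t) \<le> A * h ^ s" by blast
      define S where "S = (\<lambda>\<tau>. (g \<tau> - disc_proj g \<tau>) \<bullet> \<Phi> (a + \<tau> * h))"
      define q where "q = (\<lambda>t. \<delta> t \<bullet> \<Phi> t)"
      define p where "p = (\<lambda>t. disc_proj g ((t - a) / h))"
      define q' where "q' = (\<lambda>t. \<delta> t \<bullet> (r t - (\<Sum>i\<in>Basis. (\<Phi> t \<bullet> D i t) *\<^sub>R i)) + (f (y t, w) - p t) \<bullet> \<Phi> t)"
      have q': "(q has_vector_derivative q' t) (at t within {a..a+h})" if t: "t \<in> {a..a+h}" for t
      proof -
        have "(\<delta> has_vector_derivative (f (y t, w) - p t)) (at t within {a..a+h})"
          unfolding \<delta>_def p_def g_def using y[OF t] hbvm_step_derivative[OF eq h'(1) t]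
          by (intro has_vector_derivative_diff) auto
        from bounded_bilinear.has_vector_derivative[OF bounded_bilinear_inner this \<Phi>'[OF t]]
        show ?thesis unfolding q_def q'_def .
      qed
      have contS: "continuous_on {0..1} S"
      proof -
        have "continuous_on {0..1} (\<lambda>\<tau>. a + \<tau> * h)" by (intro continuous_intros)
        from continuous_on_compose2[OF contu this img] continuous_on_compose2[OF bounded_derivs_continuous[OF \<Phi>(1)] this img]
        have *: "continuous_on {0..1} (\<lambda>\<tau>. u (a + \<tau> * h))" "continuous_on {0..1} (\<lambda>\<tau>. \<Phi> (a + \<tau> * h))" .
        have "continuous_on {0..1} g" unfolding g_def
          by (rule continuous_on_compose2[OF C_infinity_continuous[OF f, of UNIV]]) (use * in \<open>auto intro!: continuous_intros\<close>)
        with * show ?thesis unfolding S_def by (intro continuous_intros disc_proj_continuous)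
      qed
      have "\<bar>q (a + h) - q a\<bar> \<le> h * (C2 * Z) + h * \<bar>integral {0..1} S\<bar>"
      proof (rule integral_unit_rescale[OF h'(1) contS q'])
        fix t assume t: "t \<in> {a..a+h}"
        have inball: "(y t, w) \<in> cball 0 (2 * \<rho>)" "(u t, w') \<in> cball 0 (2 * \<rho>)"
          using norm_Pair_le[of "y t" w] norm_Pair_le[of "u t" w'] y[OF t] u[OF t] w w' by auto
        \<comment> \<open>Linearisation of the field at the numerical values: E is the quadratic remainder, V the
          contribution of the memory term.\<close>
        define E where "E = f (y t, w) - f (u t, w') - frechet_derivative f (at (u t, w')) ((y t, w) - (u t, w'))"
        define V where "V = frechet_derivative f (at (u t, w')) (0, w - w')"
        have lin: "linear (frechet_derivative f (at (u t, w')))"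
          using linear_frechet_derivative[OF C_infinity_differentiable[OF f]] .
        have split: "frechet_derivative f (at (u t, w')) ((y t, w) - (u t, w')) = (\<Sum>i\<in>Basis. (\<delta> t \<bullet> i) *\<^sub>R D i t) + V"
        proof -
          have "(y t, w) - (u t, w') = (\<Sum>i\<in>Basis. (\<delta> t \<bullet> i) *\<^sub>R (i, 0)) + (0, w - w')"
          proof -
            have "(\<Sum>i\<in>Basis. (\<delta> t \<bullet> i) *\<^sub>R (i, 0::'a)) = (\<Sum>i\<in>Basis. (\<delta> t \<bullet> i) *\<^sub>R i, 0)"
              by (simp add: sum_prod)
            then show ?thesis by (simp add: euclidean_representation \<delta>_def)
          qed
          then show ?thesis unfolding V_def D_def
            by (simp only: linear_add[OF lin] linear_sum[OF lin] linear_cmul[OF lin])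
        qed
        have S: "S ((t - a) / h) = (f (u t, w') - p t) \<bullet> \<Phi> t"
          using h' by (simp add: S_def g_def p_def)
        have ysplit: "f (y t, w) - p t = (\<Sum>i\<in>Basis. (\<delta> t \<bullet> i) *\<^sub>R D i t) + V + E + (f (u t, w') - p t)"
          using split by (simp add: E_def)
        have "q' t - S ((t - a) / h) = (V + E) \<bullet> \<Phi> t + \<delta> t \<bullet> r t
            + ((\<Sum>i\<in>Basis. (\<delta> t \<bullet> i) *\<^sub>R D i t) \<bullet> \<Phi> t - \<delta> t \<bullet> (\<Sum>i\<in>Basis. (\<Phi> t \<bullet> D i t) *\<^sub>R i))"
          unfolding q'_def S ysplit by (simp only: inner_add_left inner_diff_right)
        \<comment> \<open>The point of the adjoint equation: these two terms cancel.\<close>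
        also have "(\<Sum>i\<in>Basis. (\<delta> t \<bullet> i) *\<^sub>R D i t) \<bullet> \<Phi> t = \<delta> t \<bullet> (\<Sum>i\<in>Basis. (\<Phi> t \<bullet> D i t) *\<^sub>R i)"
          by (simp add: inner_sum_left inner_sum_right inner_commute mult.commute)
        finally have q'S: "q' t - S ((t - a) / h) = (V + E) \<bullet> \<Phi> t + \<delta> t \<bullet> r t" by simp
        have V: "norm V \<le> B * Z"
        proof -
          have "norm V \<le> B * norm (0::'a, w - w')" unfolding V_def using inball by (intro B(2)) auto
          also have "\<dots> \<le> B * Z" using \<epsilon> Z B(1) by (intro mult_left_mono) (auto simp: norm_Pair)
          finally show ?thesis .
        qed
        have E: "norm E \<le> R * ((C1 + 1)\<^sup>2 * (8 * \<rho> + 2) * Z)"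
        proof -
          have "norm E \<le> R * (norm ((y t, w) - (u t, w')))\<^sup>2" unfolding E_def using inball by (intro R(2)) auto
          also have "\<dots> \<le> R * (X + norm (w - w'))\<^sup>2"
            using norm_Pair_le[of "\<delta> t" "w - w'"] \<delta>[OF t] R(1)
            by (intro mult_left_mono power_mono) (auto simp: \<delta>_def)
          also have "\<dots> \<le> R * ((C1 + 1)\<^sup>2 * (8 * \<rho> + 2) * Z)" using sq R(1) by (rule mult_left_mono)
          finally show ?thesis .
        qed
        have "\<bar>q' t - S ((t - a) / h)\<bar> \<le> norm (V + E) * norm (\<Phi> t) + norm (\<delta> t) * norm (r t)"
          unfolding q'S using Cauchy_Schwarz_ineq2[of "V + E" "\<Phi> t"] Cauchy_Schwarz_ineq2[of "\<delta> t" "r t"]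
          by (rule order_trans[OF abs_triangle_ineq add_mono])
        also have "\<dots> \<le> (B * Z + R * ((C1 + 1)\<^sup>2 * (8 * \<rho> + 2) * Z)) * A + X * (A * h ^ s)"
          using norm_triangle_mono[OF V E] bounded_derivs_norm[OF \<Phi>(1) t] \<delta>[OF t] r[OF t] X A(1)
          by (intro add_mono mult_mono) (auto intro: order_trans[OF norm_ge_zero])
        also have "\<dots> = A * (B * Z + R * ((C1 + 1)\<^sup>2 * (8 * \<rho> + 2) * Z)) + A * (h ^ s * X)"
          by (simp add: mult_ac)
        also have "\<dots> \<le> A * (B * Z + R * ((C1 + 1)\<^sup>2 * (8 * \<rho> + 2) * Z)) + A * (C1 * Z)"
          using Xs A(1) by (intro add_left_mono mult_left_mono)
        also have "\<dots> = C2 * Z" unfolding C2_def by (simp add: algebra_simps)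
        finally show "\<bar>q' t - S ((t - a) / h)\<bar> \<le> C2 * Z" .
      qed
      also have "\<bar>integral {0..1} S\<bar> \<le> Q * Z"
      proof -
        have "\<bar>integral {0..1} S\<bar> \<le> Q * h ^ (2 * s)" unfolding S_def g_def using st \<Phi>(1) n by (intro Q(2)) simp_all
        also have "\<dots> \<le> Q * Z" using Z Q(1) by (intro mult_left_mono)
        finally show ?thesis .
      qed
      finally have 1: "\<bar>q (a + h) - q a\<bar> \<le> h * (C2 * Z) + h * (Q * Z)" using h' by (simp add: mult_left_mono)
      have 2: "\<bar>\<delta> a \<bullet> (\<Phi> a - e)\<bar> \<le> h * (A * Z)"
      proof -
        have "norm (\<Phi> a - \<Phi> (a + h)) \<le> A * \<bar>a - (a + h)\<bar>"
          by (rule bounded_derivs_Lipschitz[OF \<Phi>(1)]) (use h' in auto)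
        then have "norm (\<delta> a) * norm (\<Phi> a - e) \<le> Z * (A * h)"
          using \<epsilon> Z A(1) h' \<Phi>(2) by (intro mult_mono) auto
        then show ?thesis using Cauchy_Schwarz_ineq2[of "\<delta> a" "\<Phi> a - e"] by (simp add: mult_ac)
      qed
      have "(\<delta> (a + h) - \<delta> a) \<bullet> e = (q (a + h) - q a) + \<delta> a \<bullet> (\<Phi> a - e)"
        by (simp add: q_def \<Phi>(2) inner_diff_left inner_diff_right)
      also have "\<bar>\<dots>\<bar> \<le> (h * (C2 * Z) + h * (Q * Z)) + h * (A * Z)"
        by (rule order_trans[OF abs_triangle_ineq add_mono[OF 1 2]])
      also have "\<dots> = C3 * h * Z" by (simp add: C3_def algebra_simps)
      finally show ?thesis .
    qed
    have "norm (\<delta> (a + h) - \<delta> a) \<le> (\<Sum>e\<in>Basis. \<bar>(\<delta> (a + h) - \<delta> a) \<bullet> e\<bar>)" by (rule norm_le_l1)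
    also have "\<dots> \<le> (\<Sum>e\<in>(Basis::'a set). C3 * h * Z)" using comp by (rule sum_mono)
    finally show ?thesis by (simp add: \<delta>_def Z_def \<epsilon>_def mult.assoc)
  qed
  show thesis by (rule that[OF _ C1(2) main]) (use C3 in auto)
qed

end

section \<open>The grid and the propagation of errors\<close>

text \<open>
  The index \<open>i\<close> is the position of the memory term, which may lie anywhere in the past.
\<close>

lemma discrete_gronwall:
  fixes e :: "nat \<Rightarrow> real"
  assumes h: "0 \<le> h" and A: "0 \<le> A" and B: "0 \<le> B" and T: "real N * h \<le> T"
    and e0: "e 0 = 0" and step: "\<And>n. n < N \<Longrightarrow> \<exists>i\<le>n. e (Suc n) \<le> e n + h * (A * (e n + e i) + B)"
    and n: "n \<le> N"
  shows "e n \<le> T * B * exp (2 * A * T)"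
proof -
  define c where "c = 1 + 2 * h * A"
  have c: "1 \<le> c" using h A by (simp add: c_def)
  have *: "n \<le> N \<Longrightarrow> \<forall>i\<le>n. e i \<le> real n * h * B * c ^ n" for n
  proof (induction n)
    case 0 then show ?case using e0 by simp
  next
    case (Suc n)
    define r where "r = real n * h * B * c ^ n"
    have r: "0 \<le> r" using h B c by (simp add: r_def)
    have IH: "e i \<le> r" if "i \<le> n" for i using Suc that by (simp add: r_def)
    have "r * c + h * B \<le> real (Suc n) * h * B * c ^ Suc n"
    proof -
      have "1 \<le> c ^ Suc n" using c by (rule one_le_power)
      then have "h * B * 1 \<le> h * B * c ^ Suc n" using h B by (intro mult_left_mono) auto
      then show ?thesis by (simp add: r_def algebra_simps)
    qed
    moreover have "r * 1 \<le> r * c" using r c by (intro mult_left_mono)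
    moreover have "0 \<le> h * B" using h B by simp
    moreover have "e (Suc n) \<le> r * c + h * B"
    proof -
      obtain i where i: "i \<le> n" "e (Suc n) \<le> e n + h * (A * (e n + e i) + B)" using step[of n] Suc.prems by auto
      have "h * (A * (e n + e i) + B) \<le> h * (A * (r + r) + B)"
        using IH[of n] IH[OF i(1)] h A by (intro mult_left_mono add_right_mono add_mono) auto
      then have "e (Suc n) \<le> r + h * (A * (r + r) + B)" using i(2) IH[of n] by simp
      then show ?thesis by (simp add: c_def algebra_simps)
    qed
    ultimately have "e i \<le> real (Suc n) * h * B * c ^ Suc n" if "i \<le> Suc n" for i
      using IH[of i] that by (cases "i = Suc n") auto
    then show ?case by blast
  qed
  have nT: "real n * h \<le> T" using n T h by (meson mult_right_mono of_nat_le_iff order_trans)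
  have T0: "0 \<le> T" using nT h by (meson mult_nonneg_nonneg of_nat_0_le_iff order_trans)
  have "c ^ n \<le> exp (2 * h * A) ^ n" unfolding c_def using h A by (intro power_mono exp_ge_add_one_self) auto
  also have "\<dots> = exp (2 * A * (real n * h))" by (simp add: exp_of_nat_mult[symmetric] mult_ac)
  also have "\<dots> \<le> exp (2 * A * T)" using nT A by (simp add: mult_left_mono)
  finally have cn: "c ^ n \<le> exp (2 * A * T)" .
  have "e n \<le> (real n * h * B) * c ^ n" using *[OF n] by blast
  also have "\<dots> \<le> (T * B) * exp (2 * A * T)"
    using nT T0 B c h cn by (intro mult_mono mult_right_mono) auto
  finally show ?thesis .
qed

lemma eventually_small_step:
  assumes "0 < h0"
  shows "\<forall>\<^sub>F \<nu> in sequentially. 0 < \<nu> \<and> 1 / real \<nu> \<le> h0"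
proof -
  obtain N where N: "1 / h0 < real N" using reals_Archimedean2 by blast
  have "0 < \<nu> \<and> 1 / real \<nu> \<le> h0" if "N \<le> \<nu>" for \<nu>
  proof -
    have "0 < 1 / h0" using assms by simp
    then have "0 < real \<nu>" "1 / h0 \<le> real \<nu>" using N that by linarith+
    then show ?thesis using assms by (simp add: field_simps)
  qed
  then show ?thesis by (auto simp: eventually_sequentially)
qed

lemma grid_Suc: "grid \<nu> (Suc n) = grid \<nu> n + 1 / real \<nu>"
  by (simp add: grid_def add_divide_distrib)

lemma grid_mult: "0 < \<nu> \<Longrightarrow> grid \<nu> (m * \<nu>) = real m"
  by (simp add: grid_def)

lemma grid_mono: "i \<le> n \<Longrightarrow> grid \<nu> i \<le> grid \<nu> n"
  by (simp add: grid_def divide_right_mono)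

text \<open>
  A step never crosses an integer, so the memory term does not change during it.
\<close>

lemma grid_between:
  assumes "0 < \<nu>"
  shows "real (n div \<nu>) \<le> grid \<nu> n" "grid \<nu> n + 1 / real \<nu> \<le> real (n div \<nu>) + 1"
proof -
  show "real (n div \<nu>) \<le> grid \<nu> n"
    using grid_mono[of "n div \<nu> * \<nu>" n \<nu>] assms by (simp add: grid_mult)
  have "Suc n \<le> Suc (n div \<nu>) * \<nu>" using assms dividend_less_times_div[of \<nu> n] by (simp add: algebra_simps)
  from grid_mono[OF this, of \<nu>] show "grid \<nu> n + 1 / real \<nu> \<le> real (n div \<nu>) + 1"
    using assms by (simp add: grid_mult grid_Suc del: mult_Suc)
qed

lemma grid_cover:
  assumes "0 < \<nu>" "0 < K" "t \<in> {0..real K}"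
  shows "\<exists>n<K * \<nu>. t \<in> {grid \<nu> n..grid \<nu> n + 1 / real \<nu>}"
proof (cases "t = real K")
  case True
  have "Suc (K * \<nu> - 1) = K * \<nu>" using assms by simp
  then have "grid \<nu> (K * \<nu> - 1) + 1 / real \<nu> = real K" using grid_Suc[of \<nu> "K * \<nu> - 1"] grid_mult[OF assms(1), of K] by simp
  moreover have "0 \<le> 1 / real \<nu>" by simp
  ultimately have "t \<in> {grid \<nu> (K * \<nu> - 1)..grid \<nu> (K * \<nu> - 1) + 1 / real \<nu>}"
    unfolding atLeastAtMost_iff using True by linarith
  then show ?thesis using assms by (intro exI[of _ "K * \<nu> - 1"]) simp
next
  case False
  then have t: "0 \<le> t" "t < real K" using assms by auto
  define n where "n = nat \<lfloor>t * real \<nu>\<rfloor>"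
  have n: "real n \<le> t * real \<nu>" "t * real \<nu> < real n + 1" using t by (auto simp: n_def)
  have "t * real \<nu> < real K * real \<nu>" using t assms by (intro mult_strict_right_mono) auto
  then have "real n < real (K * \<nu>)" using n by simp
  then have "n < K * \<nu>" by linarith
  moreover have "grid \<nu> n \<le> t" "t \<le> grid \<nu> n + 1 / real \<nu>"
    using n assms by (auto simp: grid_def field_simps)
  ultimately show ?thesis by auto
qed

lemma pca_solution_step:
  fixes f :: "(real^'m) \<times> (real^'m) \<Rightarrow> real^'m"
  assumes sol: "pca_solution f y0 (real K) y" and f: "C_infinity f"
    and \<nu>: "0 < \<nu>" and n: "n < K * \<nu>" and t: "t \<in> {grid \<nu> n..grid \<nu> n + 1 / real \<nu>}"
  shows "(y has_vector_derivative f (y t, y (real (n div \<nu>)))) (at t within {grid \<nu> n..grid \<nu> n + 1 / real \<nu>})"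
proof -
  define m where "m = n div \<nu>"
  have m: "m < K" unfolding m_def using n \<nu> by (simp add: less_mult_imp_div_less)
  have cont: "continuous_on {real m..real m + 1} y"
    using sol m by (auto simp: pca_solution_def intro: continuous_on_subset)
  have sub: "{grid \<nu> n..grid \<nu> n + 1 / real \<nu>} \<subseteq> {real m..real m + 1}"
    using grid_between[OF \<nu>, of n] by (auto simp: m_def)
  have "(y has_vector_derivative f (y t, y (real m))) (at t within {real m..real m + 1})"
  proof (rule derivative_closed_interval[OF _ cont])
    show "continuous_on {real m..real m + 1} (\<lambda>t. f (y t, y (real m)))"
      by (rule continuous_on_compose2[OF C_infinity_continuous[OF f, of UNIV]]) (use cont in \<open>auto intro!: continuous_intros\<close>)
    fix t assume t: "t \<in> {real m..<real m + 1}"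
    have fl: "\<lfloor>t\<rfloor> = int m" using t by (simp add: floor_eq_iff)
    have "{real_of_int (int m)..<real_of_int (int m) + 1} \<subseteq> {0..real K}" using m by auto
    then have "\<forall>t\<in>{real_of_int (int m)..<real_of_int (int m) + 1}.
           (y has_vector_derivative f (y t, y (real_of_int \<lfloor>t\<rfloor>)))
             (at t within {real_of_int (int m)..<real_of_int (int m) + 1})"
      using sol unfolding pca_solution_def by blast
    from bspec[OF this, of t] show "(y has_vector_derivative f (y t, y (real m))) (at t within {real m..<real m + 1})"
      using t fl by simp
  qed (use t sub in auto)
  from has_vector_derivative_within_subset[OF this sub] show ?thesis by (simp add: m_def)
qed

section \<open>Existence and boundedness of the approximation\<close>

lemma poly_primitive:
  "\<exists>q::real poly. pderiv q = p \<and> poly q 0 = 0 \<and> degree q \<le> Suc (degree p)"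
proof (intro exI conjI)
  let ?q = "\<Sum>i\<le>degree p. monom (coeff p i / real (Suc i)) (Suc i)"
  have "pderiv ?q = (\<Sum>i\<le>degree p. monom (coeff p i) i)"
    by (simp add: higher_pderiv_sum[where n = 1, simplified] pderiv_monom del: of_nat_Suc)
  then show "pderiv ?q = p" by (simp add: poly_as_sum_of_monoms)
  show "poly ?q 0 = 0" by (simp add: poly_sum poly_monom)
  show "degree ?q \<le> Suc (degree p)" by (intro degree_sum_le) (auto intro: order_trans[OF degree_monom_le])
qed

text \<open>
  The metric projection onto the ball is non-expansive and the identity on the ball; \<open>F\<close> is \<open>f\<close> after
  projecting both arguments.
\<close>

lemma truncated_field:
  fixes f :: "'a::euclidean_space \<times> 'a \<Rightarrow> 'a"
  assumes f: "C_infinity f" and \<rho>: "0 \<le> \<rho>"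
  obtains F L M where "0 \<le> L" "0 \<le> M"
    "\<And>x w z w'. norm (F (x, w) - F (z, w')) \<le> L * (norm (x - z) + norm (w - w'))"
    "\<And>p. norm (F p) \<le> M" "\<And>x w. x \<in> cball 0 \<rho> \<Longrightarrow> w \<in> cball 0 \<rho> \<Longrightarrow> F (x, w) = f (x, w)"
proof -
  obtain L where L: "L \<ge> 0" "\<And>x z. x \<in> cball 0 (2 * \<rho>) \<Longrightarrow> z \<in> cball 0 (2 * \<rho>) \<Longrightarrow> norm (f x - f z) \<le> L * norm (x - z)"
    using C_infinity_Lipschitz[OF f] by blast
  obtain M where M: "M \<ge> 0" "\<And>x. x \<in> cball 0 (2 * \<rho>) \<Longrightarrow> norm (f x) \<le> M"
    using continuous_bounded_cball[OF C_infinity_continuous[OF f]] by blast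
  define cp where "cp = closest_point (cball (0::'a) \<rho>)"
  define F where "F = (\<lambda>p. f (cp (fst p), cp (snd p)))"
  have cp: "norm (cp x) \<le> \<rho>" for x
    using closest_point_in_set[of "cball (0::'a) \<rho>" x] \<rho> by (simp add: cp_def)
  have lip: "norm (cp x - cp z) \<le> norm (x - z)" for x z
    using closest_point_lipschitz[of "cball (0::'a) \<rho>" x z] \<rho> by (simp add: cp_def dist_norm)
  have mem: "(cp x, cp w) \<in> cball 0 (2 * \<rho>)" for x w
    using norm_Pair_le[of "cp x" "cp w"] cp[of x] cp[of w] by simp
  have "norm (F (x, w) - F (z, w')) \<le> L * (norm (x - z) + norm (w - w'))" for x w z w'
  proof -
    have "norm (F (x, w) - F (z, w')) \<le> L * norm ((cp x, cp w) - (cp z, cp w'))"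
      unfolding F_def fst_conv snd_conv by (rule L(2)[OF mem mem])
    also have "\<dots> \<le> L * (norm (x - z) + norm (w - w'))"
      using norm_Pair_le[of "cp x - cp z" "cp w - cp w'"] lip[of x z] lip[of w w'] L(1)
      by (intro mult_left_mono) auto
    finally show ?thesis .
  qed
  moreover have "norm (F p) \<le> M" for p unfolding F_def by (rule M(2)[OF mem])
  moreover have "F (x, w) = f (x, w)" if "x \<in> cball 0 \<rho>" "w \<in> cball 0 \<rho>" for x w
    using that by (simp add: F_def cp_def closest_point_self)
  ultimately show ?thesis using L(1) M(1) by (rule that[rotated 2])
qed

context legendre_quadrature
begin

definition poly_on_step :: "nat \<Rightarrow> nat \<Rightarrow> (real \<Rightarrow> 'v::real_vector) \<Rightarrow> bool" where
  "poly_on_step \<nu> n u \<longleftrightarrow> (\<exists>d. \<forall>\<tau>\<in>{0..1}. u (grid \<nu> n + \<tau> * (1 / real \<nu>)) = (\<Sum>i\<le>s. \<tau> ^ i *\<^sub>R d i))"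

definition grid_step :: "('a::euclidean_space \<times> 'a \<Rightarrow> 'a) \<Rightarrow> nat \<Rightarrow> nat \<Rightarrow> (real \<Rightarrow> 'a) \<Rightarrow> bool" where
  "grid_step f \<nu> n u \<longleftrightarrow> hbvm_step f (u (real (n div \<nu>))) (grid \<nu> n) (1 / real \<nu>) u"

lemma hbvm_approx_iff:
  "hbvm_approx f y0 K P s k b c \<nu> u \<longleftrightarrow>
    u 0 = y0 \<and> (\<forall>n<K * \<nu>. poly_on_step \<nu> n u \<and> grid_step f \<nu> n u)"
proof -
  have g: "gamma_bar f P k b c \<nu> u (Suc n) j = disc_coeff (\<lambda>\<sigma>. f (u (grid \<nu> n + \<sigma> * (1 / real \<nu>)), u (real (n div \<nu>)))) j" for n j
    by (simp add: gamma_bar_def disc_coeff_def floor_divide_of_nat_eq)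
  have "(\<forall>n\<in>{1..K * \<nu>}. Q n) \<longleftrightarrow> (\<forall>n<K * \<nu>. Q (Suc n))" for Q
    by (auto simp: Suc_le_eq) (metis Suc_le_D Suc_le_lessD le_simps(3))
  then show ?thesis
    unfolding hbvm_approx_def poly_on_step_def grid_step_def hbvm_step_def
    by (simp add: g disc_proj_def grid_Suc)
qed

text \<open>
  For a globally Lipschitz field and small \<open>h\<close>, the equation for the values of the polynomial
  on the unit interval is a contraction, because \<open>u\<close> depends on the field through an integral over
  a time of length \<open>h\<close>.
\<close>

lemma hbvm_step_exists:
  fixes F :: "'a::euclidean_space \<times> 'a \<Rightarrow> 'a"
  assumes L: "0 \<le> L" "\<And>x z w. norm (F (x, w) - F (z, w)) \<le> L * norm (x - z)"
  shows "\<exists>h0>0. \<forall>h v w. 0 < h \<and> h \<le> h0 \<longrightarrow> (\<exists>d. d 0 = v \<and> (\<forall>a. hbvm_step F w a h (\<lambda>t. \<Sum>i\<le>s. ((t - a) / h) ^ i *\<^sub>R d i)))"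
proof -
  have "\<forall>j. \<exists>q. pderiv q = P j \<and> poly q 0 = 0 \<and> degree q \<le> Suc j"
    using poly_primitive degree_legendre by metis
  then obtain I where I: "\<And>j. pderiv (I j) = P j" "\<And>j. poly (I j) 0 = 0" "\<And>j. degree (I j) \<le> Suc j" by metis
  define \<kappa> where "\<kappa> = (\<Sum>j<s. poly_size (I j) * coeff_bound j)"
  have \<kappa>: "0 \<le> \<kappa>" by (auto simp: \<kappa>_def intro!: sum_nonneg mult_nonneg_nonneg poly_size_nonneg coeff_bound_nonneg)
  define h0 where "h0 = 1 / (2 * (\<kappa> * L + 1))"
  have h0: "0 < h0" using L \<kappa> by (simp add: h0_def add_nonneg_pos)
  have main: "\<exists>d. d 0 = v \<and> (\<forall>a. hbvm_step F w a h (\<lambda>t. \<Sum>i\<le>s. ((t - a) / h) ^ i *\<^sub>R d i))"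
    if h: "0 < h" "h \<le> h0" for h v w
  proof -
    define \<gamma> where "\<gamma> = (\<lambda>(x :: real \<Rightarrow> 'a). disc_coeff (\<lambda>\<sigma>. F (x \<sigma>, w)))"
    define W where "W = (\<lambda>x \<tau>. v + h *\<^sub>R (\<Sum>j<s. poly (I j) \<tau> *\<^sub>R \<gamma> x j))"
    \<comment> \<open>The fixed point is sought in the complete space of bounded continuous functions on the
      line; clipping the argument to the unit interval makes the polynomials bounded.\<close>
    define T where "T = (\<lambda>x :: real \<Rightarrow>\<^sub>C 'a. Bcontfun (\<lambda>\<tau>. W (apply_bcontfun x) (max 0 (min 1 \<tau>))))"
    have clip: "max 0 (min 1 \<tau>) \<in> {0..1}" for \<tau> :: real by auto
    have T: "apply_bcontfun (T x) \<tau> = W (apply_bcontfun x) (max 0 (min 1 \<tau>))" for x \<tau>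
    proof -
      have cont: "continuous_on S (W x)" for S x unfolding W_def by (intro continuous_intros)
      have bnd: "bounded (W x ` {0..1})" for x
        by (rule compact_imp_bounded[OF compact_continuous_image[OF cont compact_Icc]])
      have "continuous_on UNIV (\<lambda>\<tau>. W x (max 0 (min 1 \<tau>)))" for x
        by (rule continuous_on_compose2[OF cont[of UNIV]]) (intro continuous_intros, simp)
      moreover have "bounded (range (\<lambda>\<tau>. W x (max 0 (min 1 \<tau>))))" for x
        using clip by (intro bounded_subset[OF bnd[of x]]) blast
      ultimately have "(\<lambda>\<tau>. W x (max 0 (min 1 \<tau>))) \<in> bcontfun" for x
        by (simp add: bcontfun_def)
      then show ?thesis by (simp add: T_def Bcontfun_inverse)
    qed
    have "\<exists>!x. T x = x"
    proof (rule banach_fix_type[of "1 / 2"])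
      show "\<forall>x z. dist (T x) (T z) \<le> 1 / 2 * dist x z"
      proof (intro allI dist_bound)
        fix x z :: "real \<Rightarrow>\<^sub>C 'a" and \<tau> :: real
        have \<gamma>: "norm (\<gamma> x j - \<gamma> z j) \<le> coeff_bound j * (L * dist x z)" for j
        proof -
          have "norm (F (x l, w) - F (z l, w)) \<le> L * dist x z" for l
            using L(2)[of "x l" w "z l"] mult_left_mono[OF dist_bounded[of x l z] L(1)] by (simp add: dist_norm)
          from norm_disc_coeff_le[of "\<lambda>\<sigma>. F (x \<sigma>, w) - F (z \<sigma>, w)", OF this] show ?thesis
            unfolding \<gamma>_def by (simp add: disc_coeff_def scaleR_diff_right sum_subtractf)
        qed
        have "norm (\<Sum>j<s. poly (I j) (max 0 (min 1 \<tau>)) *\<^sub>R (\<gamma> x j - \<gamma> z j)) \<le> \<kappa> * (L * dist x z)"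
          unfolding \<kappa>_def sum_distrib_right
        proof (rule order_trans[OF norm_sum], rule sum_mono)
          fix j
          show "norm (poly (I j) (max 0 (min 1 \<tau>)) *\<^sub>R (\<gamma> x j - \<gamma> z j)) \<le> poly_size (I j) * coeff_bound j * (L * dist x z)"
            unfolding norm_scaleR mult.assoc using abs_poly_le_poly_size[OF clip[of \<tau>], of "I j"] \<gamma>[of j]
            by (intro mult_mono poly_size_nonneg norm_ge_zero)
        qed
        then have "h * norm (\<Sum>j<s. poly (I j) (max 0 (min 1 \<tau>)) *\<^sub>R (\<gamma> x j - \<gamma> z j)) \<le> h0 * (\<kappa> * (L * dist x z))"
          using h by (intro mult_mono) auto
        also have "h0 * (\<kappa> * (L * dist x z)) = (h0 * (\<kappa> * L)) * dist x z" by simp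
        also have "\<dots> \<le> (1 / 2) * dist x z"
        proof (rule mult_right_mono)
          have "0 \<le> \<kappa> * L" using L \<kappa> by simp
          then show "h0 * (\<kappa> * L) \<le> 1 / 2" by (simp add: h0_def field_simps add_pos_nonneg)
        qed simp
        finally have "h * norm (\<Sum>j<s. poly (I j) (max 0 (min 1 \<tau>)) *\<^sub>R (\<gamma> x j - \<gamma> z j)) \<le> 1 / 2 * dist x z" .
        moreover have "T x \<tau> - T z \<tau> = h *\<^sub>R (\<Sum>j<s. poly (I j) (max 0 (min 1 \<tau>)) *\<^sub>R (\<gamma> x j - \<gamma> z j))"
          unfolding T W_def by (simp add: scaleR_diff_right sum_subtractf)
        ultimately show "dist (T x \<tau>) (T z \<tau>) \<le> 1 / 2 * dist x z"
          using h by (simp add: dist_norm)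
      qed
    qed auto
    then obtain x where x: "T x = x" by blast
    define V where "V = (\<lambda>\<tau>. v + h *\<^sub>R (\<Sum>j<s. poly (I j) \<tau> *\<^sub>R \<gamma> x j))"
    have "V \<tau> = x \<tau>" if "\<tau> \<in> {0..1}" for \<tau>
      using T[of x \<tau>] that by (simp add: x V_def W_def)
    then have \<gamma>V: "\<gamma> x j = disc_coeff (\<lambda>\<sigma>. F (V \<sigma>, w)) j" for j
      unfolding \<gamma>_def by (intro disc_coeff_cong) simp
    have V': "(V has_vector_derivative h *\<^sub>R disc_proj (\<lambda>\<sigma>. F (V \<sigma>, w)) \<tau>) (at \<tau>)" for \<tau>
    proof -
      have "((\<lambda>\<tau>. poly (I j) \<tau> *\<^sub>R \<gamma> x j) has_vector_derivative poly (P j) \<tau> *\<^sub>R \<gamma> x j) (at \<tau>)" for j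
        using has_vector_derivative_scaleR[OF poly_DERIV[of "I j" \<tau>] has_vector_derivative_const, of "\<gamma> x j"] I(1)[of j] by simp
      then have "((\<lambda>\<tau>. \<Sum>j<s. poly (I j) \<tau> *\<^sub>R \<gamma> x j) has_vector_derivative (\<Sum>j<s. poly (P j) \<tau> *\<^sub>R \<gamma> x j)) (at \<tau>)"
        by (intro has_vector_derivative_sum)
      from has_vector_derivative_add[OF has_vector_derivative_const bounded_linear.has_vector_derivative[OF bounded_linear_scaleR_right this]]
      have "(V has_vector_derivative 0 + h *\<^sub>R (\<Sum>j<s. poly (P j) \<tau> *\<^sub>R \<gamma> x j)) (at \<tau>)"
        unfolding V_def .
      then show ?thesis by (simp add: disc_proj_def \<gamma>V)
    qed
    define X where "X = (\<lambda>i. \<Sum>j<s. coeff (I j) i *\<^sub>R \<gamma> x j)"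
    define d where "d = (\<lambda>i. (if i = 0 then v else 0) + h *\<^sub>R X i)"
    have Vd: "V \<tau> = (\<Sum>i\<le>s. \<tau> ^ i *\<^sub>R d i)" for \<tau>
    proof -
      have "poly (I j) \<tau> = (\<Sum>i\<le>s. coeff (I j) i * \<tau> ^ i)" if "j < s" for j
        unfolding poly_altdef using I(3)[of j] that
        by (intro sum.mono_neutral_left) (auto simp: coeff_eq_0)
      then have "(\<Sum>j<s. poly (I j) \<tau> *\<^sub>R \<gamma> x j) = (\<Sum>j<s. \<Sum>i\<le>s. \<tau> ^ i *\<^sub>R (coeff (I j) i *\<^sub>R \<gamma> x j))"
        by (intro sum.cong) (auto simp: scaleR_sum_left mult.commute)
      also have "\<dots> = (\<Sum>i\<le>s. \<tau> ^ i *\<^sub>R (\<Sum>j<s. coeff (I j) i *\<^sub>R \<gamma> x j))"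
        by (subst sum.swap) (simp add: scaleR_sum_right)
      finally have *: "(\<Sum>j<s. poly (I j) \<tau> *\<^sub>R \<gamma> x j) = (\<Sum>i\<le>s. \<tau> ^ i *\<^sub>R X i)" unfolding X_def .
      have "(\<Sum>i\<le>s. \<tau> ^ i *\<^sub>R (if i = 0 then v else 0)) = (\<Sum>i\<le>s. if i = 0 then v else 0)"
        by (intro sum.cong) auto
      then have "(\<Sum>i\<le>s. \<tau> ^ i *\<^sub>R (if i = 0 then v else 0)) = v" by simp
      then show ?thesis
        unfolding V_def * d_def by (simp add: scaleR_add_right sum.distrib scaleR_sum_right mult.commute)
    qed
    have d0: "d 0 = v" using Vd[of 0] I(2) by (simp add: V_def power_0_left if_distrib[of "\<lambda>r. r *\<^sub>R _"] cong: if_cong)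
    have "hbvm_step F w a h (\<lambda>t. V ((t - a) / h))" for a
      unfolding hbvm_step_def
    proof
      fix \<tau> :: real assume "\<tau> \<in> {0..1}"
      have D: "((\<lambda>t. (t - a) / h) has_vector_derivative 1 / h) (at t within S)" for t S
        unfolding has_real_derivative_iff_has_vector_derivative[symmetric] using h by (auto intro!: derivative_eq_intros)
      have "(V has_vector_derivative h *\<^sub>R disc_proj (\<lambda>\<sigma>. F (V \<sigma>, w)) \<tau>) (at ((a + \<tau> * h - a) / h) within S)" for S
        using has_vector_derivative_at_within[OF V'[of \<tau>], of S] h by simp
      from vector_diff_chain_within[OF D this] show "((\<lambda>t. V ((t - a) / h)) has_vector_derivative disc_proj (\<lambda>\<sigma>. F (V ((a + \<sigma> * h - a) / h), w)) \<tau>) (at (a + \<tau> * h) within {a..a+h})"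
        using h by (simp add: o_def)
    qed
    then show ?thesis using d0 unfolding Vd by (intro exI[of _ d]) simp
  qed
  show ?thesis using h0 main by (intro exI[of _ h0]) blast
qed

lemma hbvm_global_exists:
  fixes F :: "'a::euclidean_space \<times> 'a \<Rightarrow> 'a"
  assumes L: "0 \<le> L" "\<And>x z w. norm (F (x, w) - F (z, w)) \<le> L * norm (x - z)"
  shows "\<exists>h0>0. \<forall>\<nu> N. 0 < \<nu> \<and> 1 / real \<nu> \<le> h0 \<longrightarrow>
    (\<exists>u. u 0 = v0 \<and> (\<forall>n<N. poly_on_step \<nu> n u \<and> grid_step F \<nu> n u))"
proof -
  obtain h0 where h0: "0 < h0" and ex: "\<And>h v w. 0 < h \<Longrightarrow> h \<le> h0 \<Longrightarrow>
    \<exists>d. d 0 = v \<and> (\<forall>a. hbvm_step F w a h (\<lambda>t. \<Sum>i\<le>s. ((t - a) / h) ^ i *\<^sub>R d i))"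
    using hbvm_step_exists[OF L] by blast
  have "\<exists>u. u 0 = v0 \<and> (\<forall>n<N. poly_on_step \<nu> n u \<and> grid_step F \<nu> n u)"
    if \<nu>: "0 < \<nu>" "1 / real \<nu> \<le> h0" for \<nu> N
  proof (induction N)
    case 0 show ?case by (intro exI[of _ "\<lambda>_. v0"]) simp
  next
    case (Suc N)
    then obtain u where u: "u 0 = v0" "\<And>n. n < N \<Longrightarrow> poly_on_step \<nu> n u" "\<And>n. n < N \<Longrightarrow> grid_step F \<nu> n u" by blast
    define h where "h = 1 / real \<nu>"
    define a where "a = grid \<nu> N"
    have h: "0 < h" using \<nu> by (simp add: h_def)
    from ex[OF h, of "u a" "u (real (N div \<nu>))"] \<nu> obtain d where d: "d 0 = u a"
      "hbvm_step F (u (real (N div \<nu>))) a h (\<lambda>t. \<Sum>i\<le>s. ((t - a) / h) ^ i *\<^sub>R d i)" unfolding h_def by blast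
    define V where "V = (\<lambda>t. \<Sum>i\<le>s. ((t - a) / h) ^ i *\<^sub>R d i)"
    \<comment> \<open>The values up to a stay unchanged, so the earlier steps remain valid: they only refer to
      the past.\<close>
    define u' where "u' = (\<lambda>t. if t \<le> a then u t else V t)"
    have "V a = d 0" by (simp add: V_def power_0_left if_distrib[of "\<lambda>r. r *\<^sub>R _"] cong: if_cong)
    then have V: "u' t = V t" if "t \<in> {a..a+h}" for t using that d(1) by (cases "t = a") (auto simp: u'_def)
    have "real (N div \<nu>) \<le> a" using grid_between[OF \<nu>(1)] by (simp add: a_def)
    then have "grid_step F \<nu> N u'"
      using hbvm_step_cong[OF d(2) h, of u' F] V unfolding grid_step_def a_def[symmetric] h_def[symmetric]
      by (simp add: u'_def[THEN fun_cong, of "real (N div \<nu>)"] V_def)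
    moreover have "poly_on_step \<nu> N u'"
    proof -
      have "u' (a + \<tau> * h) = (\<Sum>i\<le>s. \<tau> ^ i *\<^sub>R d i)" if "\<tau> \<in> {0..1}" for \<tau>
        using V[OF unit_interval_scale[OF that]] h by (simp add: V_def)
      then show ?thesis unfolding poly_on_step_def a_def[symmetric] h_def[symmetric] by blast
    qed
    moreover have "poly_on_step \<nu> n u' \<and> grid_step F \<nu> n u'" if n: "n < N" for n
    proof -
      have le: "grid \<nu> n + h \<le> a" using grid_mono[of "Suc n" N \<nu>] n by (simp add: grid_Suc h_def a_def)
      then have eq: "u' t = u t" if "t \<in> {grid \<nu> n..grid \<nu> n + h}" for t using that by (auto simp: u'_def)
      have "real (n div \<nu>) \<le> a" using grid_between(1)[OF \<nu>(1), of n] le h by linarith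
      then have "u' (real (n div \<nu>)) = u (real (n div \<nu>))" by (simp add: u'_def)
      then have "grid_step F \<nu> n u'"
        using hbvm_step_cong[OF u(3)[OF n, unfolded grid_step_def, folded h_def] h, of u' F] eq
        unfolding grid_step_def h_def[symmetric] by simp
      moreover have "poly_on_step \<nu> n u'"
      proof -
        have "u' (grid \<nu> n + \<tau> * h) = u (grid \<nu> n + \<tau> * h)" if "\<tau> \<in> {0..1}" for \<tau>
          using eq[OF unit_interval_scale[OF that]] h by simp
        then show ?thesis using u(2)[OF n] unfolding poly_on_step_def h_def[symmetric] by simp
      qed
      ultimately show ?thesis by blast
    qed
    moreover have "u' 0 = v0" using u(1) grid_mono[of 0 N \<nu>] by (simp add: u'_def a_def grid_def)
    ultimately show ?case by (intro exI[of _ u']) (auto simp: less_Suc_eq)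
  qed
  with h0 show ?thesis by blast
qed

text \<open>
  First-order accuracy, obtained by freezing the field at the left end point. It serves to localise
  the approximation, where the field at hand is the truncated one, which is merely Lipschitz.
\<close>

lemma crude_step_error:
  fixes F :: "'a::euclidean_space \<times> 'a \<Rightarrow> 'a"
  assumes s: "1 \<le> s" and L: "0 \<le> L" "\<And>x w z w'. norm (F (x, w) - F (z, w')) \<le> L * (norm (x - z) + norm (w - w'))"
    and M: "0 \<le> M" "\<And>p. norm (F p) \<le> M"
    and h: "0 < h" and st: "hbvm_step F w' a h u"
    and y: "\<And>t. t \<in> {a..a+h} \<Longrightarrow> (y has_vector_derivative F (y t, w)) (at t within {a..a+h})"
    and t: "t \<in> {a..a+h}"
  shows "norm ((y t - u t) - (y a - u a)) \<le>
    h * (L * (norm (y a - u a) + norm (w - w')) + (L * M + proj_bound * (L * (proj_bound * M))) * h)"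
proof -
  have len: "M * \<bar>x - a\<bar> \<le> M * h" if "x \<in> {a..a+h}" for x using that M h by (intro mult_left_mono) auto
  define g where "g = (\<lambda>\<sigma>. F (u (a + \<sigma> * h), w'))"
  define W where "W = norm (y a - u a) + norm (w - w')"
  have du: "(u has_vector_derivative disc_proj g ((t - a) / h)) (at t within {a..a+h})" if "t \<in> {a..a+h}" for t
    unfolding g_def using hbvm_step_derivative[OF st h that] .
  have unit: "(t - a) / h \<in> {0..1}" if "t \<in> {a..a+h}" for t
    using that h by (simp add: pos_divide_le_eq)
  have a: "a \<in> {a..a+h}" using h by simp
  have ya: "norm (y x - y a) \<le> M * h" if x: "x \<in> {a..a+h}" for x
    using norm_diff_le_of_derivative[OF y M(2) x a] len[OF x] by linarith
  have ua: "norm (u x - u a) \<le> proj_bound * M * h" if x: "x \<in> {a..a+h}" for x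
  proof -
    have "norm (u x - u a) \<le> proj_bound * M * \<bar>x - a\<bar>"
      by (rule norm_diff_le_of_derivative[OF du norm_disc_proj_le[OF _ unit] x a]) (simp_all add: g_def M(2))
    also have "\<dots> \<le> proj_bound * M * h" using x M proj_bound_nonneg by (intro mult_left_mono) auto
    finally show ?thesis .
  qed
  define B where "B = L * W + (L * M + proj_bound * (L * (proj_bound * M))) * h"
  have "norm ((y t - u t) - (y a - u a)) \<le> B * \<bar>t - a\<bar>"
  proof (rule norm_diff_le_of_derivative[OF _ _ t a])
    fix x assume x: "x \<in> {a..a+h}"
    show "((\<lambda>t. y t - u t) has_vector_derivative (F (y x, w) - disc_proj g ((x - a) / h))) (at x within {a..a+h})"
      using y[OF x] du[OF x] by (rule has_vector_derivative_diff)
    define G where "G = F (u a, w')"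
    have "norm (F (y x, w) - G) \<le> L * (norm (y x - u a) + norm (w - w'))" unfolding G_def by (rule L(2))
    also have "\<dots> \<le> L * (M * h + W)"
      using norm_triangle_ineq[of "y x - y a" "y a - u a"] ya[OF x] L(1) by (intro mult_left_mono) (auto simp: W_def)
    finally have 1: "norm (F (y x, w) - G) \<le> L * (M * h + W)" .
    have "disc_proj g ((x - a) / h) = disc_proj (\<lambda>\<sigma>. (g \<sigma> - G) + G) ((x - a) / h)" by simp
    also have "\<dots> = disc_proj (\<lambda>\<sigma>. g \<sigma> - G) ((x - a) / h) + G"
      unfolding disc_proj_add using disc_proj_scale[of "\<lambda>x. x ^ 0" G] disc_proj_power[of 0] s by simp
    finally have D: "F (y x, w) - disc_proj g ((x - a) / h) = (F (y x, w) - G) - disc_proj (\<lambda>\<sigma>. g \<sigma> - G) ((x - a) / h)" by simp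
    have 2: "norm (disc_proj (\<lambda>\<sigma>. g \<sigma> - G) ((x - a) / h)) \<le> proj_bound * (L * (proj_bound * M * h))"
    proof (rule norm_disc_proj_le[OF _ unit[OF x]])
      fix i assume "i \<in> {1..k}"
      then have "a + c i * h \<in> {a..a+h}" using nodes h by (intro unit_interval_scale) auto
      from mult_left_mono[OF ua[OF this] L(1)] show "norm (g (c i) - G) \<le> L * (proj_bound * M * h)"
        using L(2)[of "u (a + c i * h)" w' "u a" w'] by (simp add: g_def G_def)
    qed
    have "norm (F (y x, w) - disc_proj g ((x - a) / h)) \<le> L * (M * h + W) + proj_bound * (L * (proj_bound * M * h))"
      unfolding D by (rule order_trans[OF norm_triangle_ineq4 add_mono[OF 1 2]])
    also have "\<dots> = B" by (simp add: B_def algebra_simps)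
    finally show "norm (F (y x, w) - disc_proj g ((x - a) / h)) \<le> B" .
  qed
  also have "\<dots> \<le> B * h"
    using t L M h proj_bound_nonneg by (intro mult_left_mono) (auto simp: B_def W_def)
  finally show ?thesis by (simp add: B_def W_def mult.commute)
qed

text \<open>
  The equations of the method are implicit, and for a field that is only locally Lipschitz nothing
  in them keeps \<open>u\<close> near \<open>y\<close>. This is where uniqueness enters: the approximation \<open>w\<close> for a truncated
  field exists and is within distance one of \<open>y\<close> for small steps, so it is also an approximation
  for \<open>f\<close> and coincides with \<open>u\<close>.
\<close>

lemma hbvm_approx_bounded:
  fixes f :: "(real^'m) \<times> (real^'m) \<Rightarrow> real^'m"
  assumes f: "C_infinity f" and s: "1 \<le> s" and K: "1 \<le> K" and sol: "pca_solution f y0 (real K) y"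
    and uniq: "\<forall>\<^sub>F \<nu> in sequentially. unique_hbvm_approx f y0 K P s k b c \<nu> (u \<nu>)"
  shows "\<exists>\<rho>\<ge>0. (\<forall>t\<in>{0..real K}. norm (y t) \<le> \<rho>) \<and>
    (\<forall>\<^sub>F \<nu> in sequentially. hbvm_approx f y0 K P s k b c \<nu> (u \<nu>) \<and> (\<forall>t\<in>{0..real K}. norm (u \<nu> t) \<le> \<rho>))"
proof -
  have cont: "continuous_on {0..real K} y" and y0: "y 0 = y0" using sol by (auto simp: pca_solution_def)
  have "bounded (y ` {0..real K})" by (rule compact_imp_bounded[OF compact_continuous_image[OF cont compact_Icc]])
  then obtain Y where Y: "0 < Y" "\<And>t. t \<in> {0..real K} \<Longrightarrow> norm (y t) \<le> Y" unfolding bounded_pos by blast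
  define \<rho> where "\<rho> = Y + 1"
  have \<rho>: "0 \<le> \<rho>" using Y by (simp add: \<rho>_def)
  obtain F L M where L: "0 \<le> L" "\<And>x w z w'. norm (F (x, w) - F (z, w')) \<le> L * (norm (x - z) + norm (w - w'))"
    and M: "0 \<le> M" "\<And>p. norm (F p) \<le> M" and Ff: "\<And>x w. x \<in> cball 0 \<rho> \<Longrightarrow> w \<in> cball 0 \<rho> \<Longrightarrow> F (x, w) = f (x, w)"
    by (rule truncated_field[OF f \<rho>]) blast
  have "norm (F (x, w) - F (z, w)) \<le> L * norm (x - z)" for x z w using L(2)[of x w z w] by simp
  from hbvm_global_exists[OF L(1) this] obtain h0 where h0: "0 < h0" "\<And>\<nu> N. 0 < \<nu> \<Longrightarrow> 1 / real \<nu> \<le> h0 \<Longrightarrow>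
    \<exists>u. u 0 = y0 \<and> (\<forall>n<N. poly_on_step \<nu> n u \<and> grid_step F \<nu> n u)" by blast
  define C where "C = L * M + proj_bound * (L * (proj_bound * M))"
  define G where "G = real K * C * exp (2 * L * real K)"
  define H where "H = G + (L * (2 * G) + C)"
  have C: "0 \<le> C" "0 \<le> G" "0 \<le> H" using L M proj_bound_nonneg by (auto simp: C_def G_def H_def)
  \<comment> \<open>The distance of w from y will be at most h H, hence at most one.\<close>
  define h1 where "h1 = min (min 1 h0) (1 / (H + 1))"
  have h1: "0 < h1" using h0 C by (simp add: h1_def)
  have main: "norm (u \<nu> t) \<le> \<rho>"
    if \<nu>: "0 < \<nu>" "1 / real \<nu> \<le> h1" and un: "unique_hbvm_approx f y0 K P s k b c \<nu> (u \<nu>)" and t: "t \<in> {0..real K}" for \<nu> t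
  proof -
    define h where "h = 1 / real \<nu>"
    have h: "0 < h" "h \<le> 1" "h \<le> h0" "h * H \<le> 1"
    proof -
      have "h * (H + 1) \<le> 1" using \<nu> C by (simp add: h_def h1_def pos_le_divide_eq)
      moreover have "h * H \<le> h * (H + 1)" using \<nu> by (intro mult_left_mono) (auto simp: h_def)
      ultimately show "h * H \<le> 1" by linarith
    qed (use \<nu> in \<open>auto simp: h_def h1_def\<close>)
    obtain w where w: "w 0 = y0" "\<And>n. n < K * \<nu> \<Longrightarrow> poly_on_step \<nu> n w" "\<And>n. n < K * \<nu> \<Longrightarrow> grid_step F \<nu> n w"
      using h0(2)[OF \<nu>(1), of "K * \<nu>"] h(3) unfolding h_def by blast
    have sub: "{grid \<nu> n..grid \<nu> n + h} \<subseteq> {0..real K}" "real (n div \<nu>) \<in> {0..real K}" if n: "n < K * \<nu>" for n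
    proof -
      have "n div \<nu> < K" using n \<nu> by (simp add: less_mult_imp_div_less)
      then have "real (n div \<nu>) + 1 \<le> real K" by linarith
      then show "{grid \<nu> n..grid \<nu> n + h} \<subseteq> {0..real K}" "real (n div \<nu>) \<in> {0..real K}"
        using grid_between[OF \<nu>(1), of n] by (auto simp: h_def)
    qed
    define \<delta> where "\<delta> = (\<lambda>t. y t - w t)"
    have step: "norm (\<delta> t - \<delta> (grid \<nu> n)) \<le> h * (L * (norm (\<delta> (grid \<nu> n)) + norm (\<delta> (real (n div \<nu>)))) + C * h)"
      if n: "n < K * \<nu>" and t: "t \<in> {grid \<nu> n..grid \<nu> n + h}" for n t
      unfolding \<delta>_def C_def
    proof (rule crude_step_error[OF s L M h(1) _ _ t])
      show "hbvm_step F (w (real (n div \<nu>))) (grid \<nu> n) h w" using w(3)[OF n] by (simp add: grid_step_def h_def)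
      fix x assume x: "x \<in> {grid \<nu> n..grid \<nu> n + h}"
      have "norm (y x) \<le> \<rho>" "norm (y (real (n div \<nu>))) \<le> \<rho>" using Y(2)[of x] Y(2)[of "real (n div \<nu>)"] sub[OF n] x by (auto simp: \<rho>_def)
      then have "F (y x, y (real (n div \<nu>))) = f (y x, y (real (n div \<nu>)))" by (intro Ff) auto
      then show "(y has_vector_derivative F (y x, y (real (n div \<nu>)))) (at x within {grid \<nu> n..grid \<nu> n + h})"
        using pca_solution_step[OF sol f \<nu>(1) n] x by (simp add: h_def)
    qed
    have gronwall: "norm (\<delta> (grid \<nu> n)) \<le> h * G" if "n \<le> K * \<nu>" for n
    proof -
      have "norm (\<delta> (grid \<nu> n)) \<le> real K * (C * h) * exp (2 * L * real K)"
      proof (rule discrete_gronwall[where N = "K * \<nu>" and h = h])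
        show "norm (\<delta> (grid \<nu> 0)) = 0" by (simp add: \<delta>_def grid_def y0 w(1))
        show "real (K * \<nu>) * h \<le> real K" using \<nu> by (simp add: h_def)
        fix n assume n: "n < K * \<nu>"
        have "grid \<nu> (Suc n) \<in> {grid \<nu> n..grid \<nu> n + h}" using h by (simp add: grid_Suc h_def)
        from step[OF n this] have "norm (\<delta> (grid \<nu> (Suc n))) \<le> norm (\<delta> (grid \<nu> n)) +
          h * (L * (norm (\<delta> (grid \<nu> n)) + norm (\<delta> (grid \<nu> (n div \<nu> * \<nu>)))) + C * h)"
          using norm_triangle_ineq2[of "\<delta> (grid \<nu> (Suc n))" "\<delta> (grid \<nu> n)"] by (simp add: grid_mult[OF \<nu>(1)])
        then show "\<exists>i\<le>n. norm (\<delta> (grid \<nu> (Suc n))) \<le> norm (\<delta> (grid \<nu> n)) +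
            h * (L * (norm (\<delta> (grid \<nu> n)) + norm (\<delta> (grid \<nu> i))) + C * h)"
          by (intro exI[of _ "n div \<nu> * \<nu>"]) simp
      qed (use that h L C in auto)
      then show ?thesis by (simp add: G_def mult_ac)
    qed
    have \<delta>1: "norm (\<delta> t) \<le> 1" if t: "t \<in> {0..real K}" for t
    proof -
      from grid_cover[OF \<nu>(1) _ t] K obtain n where n: "n < K * \<nu>" "t \<in> {grid \<nu> n..grid \<nu> n + h}" by (auto simp: h_def)
      have "n div \<nu> * \<nu> \<le> K * \<nu>" using n(1) div_times_less_eq_dividend[of n \<nu>] by linarith
      then have 2: "norm (\<delta> (real (n div \<nu>))) \<le> h * G" using gronwall[of "n div \<nu> * \<nu>"] by (simp add: grid_mult[OF \<nu>(1)])
      have 1: "norm (\<delta> (grid \<nu> n)) \<le> h * G" using gronwall n by simp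
      have "L * (norm (\<delta> (grid \<nu> n)) + norm (\<delta> (real (n div \<nu>)))) \<le> L * (h * G + h * G)"
        by (rule mult_left_mono[OF add_mono[OF 1 2] L(1)])
      also have "\<dots> = h * (L * (2 * G))" by (simp add: algebra_simps)
      also have "\<dots> \<le> 1 * (L * (2 * G))" using h L C by (intro mult_right_mono) auto
      finally have "L * (norm (\<delta> (grid \<nu> n)) + norm (\<delta> (real (n div \<nu>)))) + C * h \<le> L * (2 * G) + C"
        using mult_left_le[of h C] h C by simp
      from order_trans[OF step[OF n] mult_left_mono[OF this less_imp_le[OF h(1)]]]
      have "norm (\<delta> t - \<delta> (grid \<nu> n)) \<le> h * (L * (2 * G) + C)" .
      then have "norm (\<delta> t) \<le> h * G + h * (L * (2 * G) + C)"
        using 1 norm_triangle_ineq2[of "\<delta> t" "\<delta> (grid \<nu> n)"] by linarith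
      also have "\<dots> = h * H" by (simp add: H_def algebra_simps)
      finally show ?thesis using h(4) by linarith
    qed
    \<comment> \<open>So w stays in the ball on which F and f agree, and is an approximation for f as well.\<close>
    have wb: "norm (w t) \<le> \<rho>" if t: "t \<in> {0..real K}" for t
      using \<delta>1[OF t] Y(2)[OF t] norm_triangle_ineq2[of "w t" "y t"] by (simp add: \<delta>_def \<rho>_def norm_minus_commute)
    have "grid_step f \<nu> n w" if n: "n < K * \<nu>" for n
      unfolding grid_step_def
    proof (rule hbvm_step_cong[OF w(3)[OF n, unfolded grid_step_def]])
      fix t assume "t \<in> {grid \<nu> n..grid \<nu> n + 1 / real \<nu>}"
      then show "f (w t, w (real (n div \<nu>))) = F (w t, w (real (n div \<nu>)))"
        using wb sub[OF n] by (intro Ff[symmetric]) (auto simp: h_def)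
    qed (use \<nu> in auto)
    then have "hbvm_approx f y0 K P s k b c \<nu> w" using w by (simp add: hbvm_approx_iff)
    then have "w t = u \<nu> t" using un t by (simp add: unique_hbvm_approx_def)
    then show ?thesis using wb[OF t] by simp
  qed
  have "\<forall>\<^sub>F \<nu> in sequentially. hbvm_approx f y0 K P s k b c \<nu> (u \<nu>) \<and> (\<forall>t\<in>{0..real K}. norm (u \<nu> t) \<le> \<rho>)"
    using uniq eventually_small_step[OF h1]
    by eventually_elim (use main in \<open>auto simp: unique_hbvm_approx_def\<close>)
  moreover have "\<forall>t\<in>{0..real K}. norm (y t) \<le> \<rho>" using Y(2) unfolding \<rho>_def by (meson add_increasing2 zero_le_one)
  ultimately show ?thesis using \<rho> by blast
qed

end

section \<open>The global error\<close>

context legendre_quadrature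
begin

text \<open>
  The one-step estimate and the discrete Gronwall inequality give nodal errors of order
  \<open>h ^ (2 * s)\<close>. Inserting this into the one-step estimate gives the first bound, inserting it into the
  interior estimate the second, as \<open>s + 1 \<le> 2 * s\<close>.
\<close>

lemma global_error:
  fixes f :: "(real^'m) \<times> (real^'m) \<Rightarrow> real^'m"
  assumes f: "C_infinity f" and s: "1 \<le> s" and K: "1 \<le> K" and sol: "pca_solution f y0 (real K) y"
    and uniq: "\<forall>\<^sub>F \<nu> in sequentially. unique_hbvm_approx f y0 K P s k b c \<nu> (u \<nu>)"
  shows "\<exists>C. \<forall>\<^sub>F \<nu> in sequentially. \<forall>n<K * \<nu>.
      norm ((y (grid \<nu> (Suc n)) - u \<nu> (grid \<nu> (Suc n))) - (y (grid \<nu> n) - u \<nu> (grid \<nu> n))) \<le> C * (1 / real \<nu>) ^ (2 * s + 1) \<and>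
      (\<forall>t\<in>{grid \<nu> n..grid \<nu> n + 1 / real \<nu>}. norm (y t - u \<nu> t) \<le> C * (1 / real \<nu>) ^ (s + 1))"
proof -
  obtain \<rho> where \<rho>: "0 \<le> \<rho>" "\<And>t. t \<in> {0..real K} \<Longrightarrow> norm (y t) \<le> \<rho>" and
    ev: "\<forall>\<^sub>F \<nu> in sequentially. hbvm_approx f y0 K P s k b c \<nu> (u \<nu>) \<and> (\<forall>t\<in>{0..real K}. norm (u \<nu> t) \<le> \<rho>)"
    using hbvm_approx_bounded[OF f s K sol uniq] by blast
  obtain C h0 where C: "0 \<le> C" "0 < h0" and one: "\<And>a h u w' y w. h \<le> h0 \<Longrightarrow> bounded_step f \<rho> w' a h u \<Longrightarrow> exact_step f \<rho> w a h y \<Longrightarrow>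
      norm ((y (a + h) - u (a + h)) - (y a - u a)) \<le> C * h * (norm (y a - u a) + norm (w - w') + h ^ (2 * s))"
    by (rule one_step_error[OF f \<rho>(1) s]) blast
  obtain C' h0' where C': "0 \<le> C'" "0 < h0'" and inner: "\<And>a h u w' y w t. h \<le> h0' \<Longrightarrow> bounded_step f \<rho> w' a h u \<Longrightarrow> exact_step f \<rho> w a h y \<Longrightarrow>
      t \<in> {a..a+h} \<Longrightarrow> norm (y t - u t) \<le> C' * (norm (y a - u a) + norm (w - w') + h ^ (s + 1))"
    by (rule interior_error[OF f \<rho>(1)]) blast
  define G where "G = real K * C * exp (2 * C * real K)"
  define D where "D = C * (2 * G + 1) + C' * (2 * G + 1)"
  have G: "0 \<le> G" using C by (simp add: G_def)
  have D: "C * (2 * G + 1) \<le> D" "C' * (2 * G + 1) \<le> D" using C C' G by (auto simp: D_def)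
  have main: "norm ((y (grid \<nu> (Suc n)) - u \<nu> (grid \<nu> (Suc n))) - (y (grid \<nu> n) - u \<nu> (grid \<nu> n))) \<le> D * (1 / real \<nu>) ^ (2 * s + 1) \<and>
      (\<forall>t\<in>{grid \<nu> n..grid \<nu> n + 1 / real \<nu>}. norm (y t - u \<nu> t) \<le> D * (1 / real \<nu>) ^ (s + 1))"
    if \<nu>: "0 < \<nu>" "1 / real \<nu> \<le> min 1 (min h0 h0')" and ap: "hbvm_approx f y0 K P s k b c \<nu> (u \<nu>)"
      and ub: "\<And>t. t \<in> {0..real K} \<Longrightarrow> norm (u \<nu> t) \<le> \<rho>" and n: "n < K * \<nu>" for \<nu> n
  proof -
    define h where "h = 1 / real \<nu>"
    have h: "0 < h" "h \<le> 1" "h \<le> h0" "h \<le> h0'" using \<nu> by (auto simp: h_def)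
    define \<delta> where "\<delta> = (\<lambda>t. y t - u \<nu> t)"
    have sub: "{grid \<nu> n..grid \<nu> n + h} \<subseteq> {0..real K}" "real (n div \<nu>) \<in> {0..real K}" if n: "n < K * \<nu>" for n
    proof -
      have "n div \<nu> < K" using n \<nu> by (simp add: less_mult_imp_div_less)
      then have "real (n div \<nu>) + 1 \<le> real K" by linarith
      then show "{grid \<nu> n..grid \<nu> n + h} \<subseteq> {0..real K}" "real (n div \<nu>) \<in> {0..real K}"
        using grid_between[OF \<nu>(1), of n] by (auto simp: h_def)
    qed
    have ust: "bounded_step f \<rho> (u \<nu> (real (n div \<nu>))) (grid \<nu> n) h (u \<nu>)" if n: "n < K * \<nu>" for n
    proof -
      have "hbvm_step f (u \<nu> (real (n div \<nu>))) (grid \<nu> n) h (u \<nu>)"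
        using ap n by (simp add: hbvm_approx_iff grid_step_def h_def)
      then show ?thesis unfolding bounded_step_def using h ub sub[OF n] by blast
    qed
    have yst: "exact_step f \<rho> (y (real (n div \<nu>))) (grid \<nu> n) h y" if n: "n < K * \<nu>" for n
      unfolding exact_step_def using pca_solution_step[OF sol f \<nu>(1) n, folded h_def] \<rho>(2) sub[OF n] by blast
    have step: "norm (\<delta> (grid \<nu> (Suc n)) - \<delta> (grid \<nu> n))
        \<le> C * h * (norm (\<delta> (grid \<nu> n)) + norm (\<delta> (grid \<nu> (n div \<nu> * \<nu>))) + h ^ (2 * s))" if n: "n < K * \<nu>" for n
      using one[OF h(3) ust[OF n] yst[OF n]] by (simp add: \<delta>_def grid_Suc h_def grid_mult[OF \<nu>(1)])
    have nodal: "norm (\<delta> (grid \<nu> n)) \<le> G * h ^ (2 * s)" if "n \<le> K * \<nu>" for n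
    proof -
      have "norm (\<delta> (grid \<nu> n)) \<le> real K * (C * h ^ (2 * s)) * exp (2 * C * real K)"
      proof (rule discrete_gronwall[where N = "K * \<nu>" and h = h])
        have "y 0 = y0" "u \<nu> 0 = y0" using sol ap by (auto simp: pca_solution_def hbvm_approx_def)
        then show "norm (\<delta> (grid \<nu> 0)) = 0" by (simp add: \<delta>_def grid_def)
        show "real (K * \<nu>) * h \<le> real K" using \<nu> by (simp add: h_def)
        fix n assume n: "n < K * \<nu>"
        have "norm (\<delta> (grid \<nu> (Suc n))) \<le> norm (\<delta> (grid \<nu> n)) +
          C * h * (norm (\<delta> (grid \<nu> n)) + norm (\<delta> (grid \<nu> (n div \<nu> * \<nu>))) + h ^ (2 * s))"
          using step[OF n] norm_triangle_ineq2[of "\<delta> (grid \<nu> (Suc n))" "\<delta> (grid \<nu> n)"] by linarith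
        also have "\<dots> = norm (\<delta> (grid \<nu> n)) +
          h * (C * (norm (\<delta> (grid \<nu> n)) + norm (\<delta> (grid \<nu> (n div \<nu> * \<nu>)))) + C * h ^ (2 * s))"
          by (simp add: algebra_simps)
        finally show "\<exists>i\<le>n. norm (\<delta> (grid \<nu> (Suc n))) \<le> norm (\<delta> (grid \<nu> n)) +
            h * (C * (norm (\<delta> (grid \<nu> n)) + norm (\<delta> (grid \<nu> i))) + C * h ^ (2 * s))"
          by (intro exI[of _ "n div \<nu> * \<nu>"]) simp
      qed (use that h C in auto)
      then show ?thesis by (simp add: G_def mult_ac)
    qed
    have "n div \<nu> * \<nu> \<le> K * \<nu>" using n div_times_less_eq_dividend[of n \<nu>] by linarith
    note e = nodal[OF less_imp_le[OF n]] nodal[OF this]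
    have 1: "norm (\<delta> (grid \<nu> (Suc n)) - \<delta> (grid \<nu> n)) \<le> D * h ^ (2 * s + 1)"
    proof -
      have "norm (\<delta> (grid \<nu> (Suc n)) - \<delta> (grid \<nu> n)) \<le> C * h * (G * h ^ (2 * s) + G * h ^ (2 * s) + h ^ (2 * s))"
        using h C by (intro order_trans[OF step[OF n]] mult_left_mono add_mono e) auto
      also have "\<dots> = C * (2 * G + 1) * h ^ (2 * s + 1)" by (simp add: algebra_simps)
      also have "\<dots> \<le> D * h ^ (2 * s + 1)" using D h by (intro mult_right_mono) auto
      finally show ?thesis .
    qed
    have 2: "norm (\<delta> t) \<le> D * h ^ (s + 1)" if t: "t \<in> {grid \<nu> n..grid \<nu> n + h}" for t
    proof -
      have pw: "h ^ (2 * s) \<le> h ^ (s + 1)" using h s by (intro power_decreasing) auto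
      have "norm (\<delta> t) \<le> C' * (norm (\<delta> (grid \<nu> n)) + norm (\<delta> (grid \<nu> (n div \<nu> * \<nu>))) + h ^ (s + 1))"
        using inner[OF h(4) ust[OF n] yst[OF n] t] by (simp add: \<delta>_def grid_mult[OF \<nu>(1)])
      also have "\<dots> \<le> C' * (G * h ^ (s + 1) + G * h ^ (s + 1) + h ^ (s + 1))"
        using C' by (intro mult_left_mono add_mono order_trans[OF e(1)] order_trans[OF e(2)] mult_left_mono[OF pw G]) auto
      also have "\<dots> = C' * (2 * G + 1) * h ^ (s + 1)" by (simp add: algebra_simps)
      also have "\<dots> \<le> D * h ^ (s + 1)" using D h by (intro mult_right_mono) auto
      finally show ?thesis .
    qed
    show ?thesis using 1 2 unfolding \<delta>_def h_def by blast
  qed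
  have "0 < min 1 (min h0 h0')" using C C' by simp
  from eventually_small_step[OF this] ev show ?thesis
    by (intro exI[of _ D], eventually_elim) (use main in blast)
qed

end

theorem theorem5:
  fixes f :: "(real^'m) \<times> (real^'m) \<Rightarrow> real^'m"
    and y0 :: "real^'m" and y :: "real \<Rightarrow> real^'m"
    and u :: "nat \<Rightarrow> real \<Rightarrow> real^'m"
    and P :: "nat \<Rightarrow> real poly" and b c :: "nat \<Rightarrow> real"
    and K s k q :: nat
  assumes "C_infinity f"
    and "K \<ge> 1" and "s \<ge> 1"
    and "pca_solution f y0 (real K) y"
    and "orthonormal_legendre P"
    and "\<forall>i\<in>{1..k}. c i \<in> {0..1}"
    and "quadrature_order k b c q" and "q \<ge> 2 * s"
    and "\<forall>\<^sub>F \<nu> in sequentially. unique_hbvm_approx f y0 K P s k b c \<nu> (u \<nu>)"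
  shows "(\<exists>C. \<forall>\<^sub>F \<nu> in sequentially. \<forall>n\<in>{1..K * \<nu>}.
            norm ((y (grid \<nu> n) - u \<nu> (grid \<nu> n))
                  - (y (grid \<nu> (n - 1)) - u \<nu> (grid \<nu> (n - 1))))
              \<le> C * (1 / real \<nu>) ^ (2 * s + 1)) \<and>
         (\<exists>C. \<forall>\<^sub>F \<nu> in sequentially. \<forall>n\<in>{1..K * \<nu>}. \<forall>\<tau>\<in>{0<..<1}.
            norm (y (grid \<nu> (n - 1) + \<tau> * (1 / real \<nu>))
                  - u \<nu> (grid \<nu> (n - 1) + \<tau> * (1 / real \<nu>)))
              \<le> C * (1 / real \<nu>) ^ (s + 1))"
proof -
  interpret legendre_quadrature P s k b c
    using assms(5-8) by unfold_locales (auto simp: quadrature_order_def)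
  obtain C where C: "\<forall>\<^sub>F \<nu> in sequentially. \<forall>n<K * \<nu>.
      norm ((y (grid \<nu> (Suc n)) - u \<nu> (grid \<nu> (Suc n))) - (y (grid \<nu> n) - u \<nu> (grid \<nu> n))) \<le> C * (1 / real \<nu>) ^ (2 * s + 1) \<and>
      (\<forall>t\<in>{grid \<nu> n..grid \<nu> n + 1 / real \<nu>}. norm (y t - u \<nu> t) \<le> C * (1 / real \<nu>) ^ (s + 1))"
    using global_error[OF assms(1,3,2,4,9)] by blast
  have step: "n - 1 < K * \<nu> \<and> Suc (n - 1) = n" if "n \<in> {1..K * \<nu>}" for n \<nu> using that by auto
  have "\<forall>\<^sub>F \<nu> in sequentially. \<forall>n\<in>{1..K * \<nu>}.
      norm ((y (grid \<nu> n) - u \<nu> (grid \<nu> n)) - (y (grid \<nu> (n - 1)) - u \<nu> (grid \<nu> (n - 1)))) \<le> C * (1 / real \<nu>) ^ (2 * s + 1)"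
    using C by eventually_elim (metis step)
  moreover have "\<forall>\<^sub>F \<nu> in sequentially. \<forall>n\<in>{1..K * \<nu>}. \<forall>\<tau>\<in>{0<..<1}.
      norm (y (grid \<nu> (n - 1) + \<tau> * (1 / real \<nu>)) - u \<nu> (grid \<nu> (n - 1) + \<tau> * (1 / real \<nu>))) \<le> C * (1 / real \<nu>) ^ (s + 1)"
    using C
  proof eventually_elim
    case (elim \<nu>)
    show ?case
    proof (intro ballI)
      fix n and \<tau> :: real assume n: "n \<in> {1..K * \<nu>}" and "\<tau> \<in> {0<..<1}"
      then have "grid \<nu> (n - 1) + \<tau> * (1 / real \<nu>) \<in> {grid \<nu> (n - 1)..grid \<nu> (n - 1) + 1 / real \<nu>}"
        by (intro unit_interval_scale) auto
      with elim step[OF n] show "norm (y (grid \<nu> (n - 1) + \<tau> * (1 / real \<nu>)) - u \<nu> (grid \<nu> (n - 1) + \<tau> * (1 / real \<nu>)))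
        \<le> C * (1 / real \<nu>) ^ (s + 1)" by blast
    qed
  qed
  ultimately show ?thesis by blast
qed

end
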